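(* Let $d\ge2$, let $X=(X^1,\dots,X^d)$ be a random element of $\mathcal X=\mathcal X^1\times\cdots\times\mathcal X^d$ whose distribution satisfies $\mathbb P_X\ne\mathbb P_{X^1}\times\cdots\times\mathbb P_{X^d}$, let $X_1,X_2,\dots$ be i.i.d. copies of $X$, and for each $n$ let $D=(X_1,\dots,X_n)$. Assume the kernel $k=k^1\otimes\cdots\otimes k^d$ on $\mathcal X$ is characteristic, and that there is a constant $C>0$ such that for all $n\ge 2d$ and all $(i_1,\dots,i_{2d})\in\{1,\dots,n\}^{2d}$, $$\mathbb E\left|\prod_{j=1}^dk^j\left(X^j_{i_{2j-1}},X^j_{i_{2j}}\right)\right|<C.$$ Let $\alpha\in(0,1)$ and let $B$ be a fixed positive integer with $B\ge\frac1\alpha-1$. For each $n$, let $\psi_1,\dots,\psi_B$ be i.i.d. random vectors, independent of $D$, each consisting of $d-1$ independent uniformly distributed permutations of $\{1,\dots,n\}$, and let $$\hat p=\frac{1}{B+1}+\frac{1}{B+1}\sum_{i=1}^{B}1\left\{\widehat{\mathrm{dHSIC}}(\psi_iD)\ge\widehat{\mathrm{dHSIC}}(D)\right\}$$ be the $p$-value of the permutation test based on these permutations. Then $$\lim_{n\to\infty}\mathbb P(\hat p\le\alpha)=1.$$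
   Context: Setting. For $i=1,\dots,d$, $\mathcal X^i$ is a locally compact metric space with its Borel sigma-algebra; $\mathcal X=\mathcal X^1\times\cdots\times\mathcal X^d$ carries the product sigma-algebra. $X^i$ is an $\mathcal X^i$-valued random variable, all $X^i$ being defined on one probability space. Superscripts on $X$, $x$, $k$ and $\psi$ are indices, never powers. Each $k^i:\mathcal X^i\times\mathcal X^i\to\mathbb R$ is a $c_0$-universal kernel, meaning that it is continuous and its reproducing kernel Hilbert space (RKHS) is (contained and) dense, in the uniform norm, in $C_0(\mathcal X^i)$, the continuous functions vanishing at infinity. The tensor product kernel is $k(x,y)=\prod_{j=1}^dk^j(x^j,y^j)$, with RKHS $\mathcal H_k$. The mean embedding of a probability measure $\mathbb P$ on $\mathcal X$ is the element $\mu_{\mathbb P}\in\mathcal H_k$ with $\int f\,d\mathbb P=\langle f,\mu_{\mathbb P}\rangle$ for all $f\in\mathcal H_k$; $k$ is characteristic if $\|\mu_{\mathbb P}-\mu_{\mathbb Q}\|_{\mathcal H_k}=0$ if and only if $\mathbb P=\mathbb Q$. Estimator. With $M_q(n)=\{1,\dots,n\}^q$ and $D=(x_1,\dots,x_n)\in\mathcal X^n$, $x_i=(x_i^1,\dots,x_i^d)$, $$\widehat{\mathrm{dHSIC}}(D)=\frac{1}{n^2}\sum_{(i_1,i_2)\in M_2(n)}\prod_{j=1}^dk^j(x^j_{i_1},x^j_{i_2})+\frac{1}{n^{2d}}\sum_{(i_1,\dots,i_{2d})\in M_{2d}(n)}\prod_{j=1}^dk^j(x^j_{i_{2j-1}},x^j_{i_{2j}})-\frac{2}{n^{d+1}}\sum_{(i_1,\dots,i_{d+1})\in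 M_{d+1}(n)}\prod_{j=1}^dk^j(x^j_{i_1},x^j_{i_{j+1}}).$$ Permuted data. For a vector $\psi=(\psi^1,\dots,\psi^{d-1})$ of permutations of $\{1,\dots,n\}$, $\psi D$ is the dataset whose $i$-th point is $(x^1_i,x^2_{\psi^1(i)},\dots,x^d_{\psi^{d-1}(i)})$, $i=1,\dots,n$. The test of level $\alpha$ rejects the null hypothesis of joint independence if and only if $\hat p\le\alpha$. Ties are broken conservatively, i.e. every permuted statistic equal to the original one is counted in $\hat p$. *)

theory Defs
  imports "HOL-Probability.Probability" "HOL-Combinatorics.Permutations"
begin

text \<open>
  A real-valued function on a set \<open>E\<close> is represented by a total function that vanishes outside
  \<open>E\<close>, so that equality of such functions is equality of functions on \<open>E\<close>.
\<close>

definition kernel_section :: "'e set \<Rightarrow> ('e \<Rightarrow> 'e \<Rightarrow> real) \<Rightarrow> 'e \<Rightarrow> 'e \<Rightarrow> real" where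
  "kernel_section E k x = (\<lambda>y. if y \<in> E then k x y else 0)"

definition ip_norm :: "(('e \<Rightarrow> real) \<Rightarrow> ('e \<Rightarrow> real) \<Rightarrow> real) \<Rightarrow> ('e \<Rightarrow> real) \<Rightarrow> real" where
  "ip_norm ip f = sqrt (ip f f)"

definition function_hilbert_space ::
    "'e set \<Rightarrow> ('e \<Rightarrow> real) set \<Rightarrow> (('e \<Rightarrow> real) \<Rightarrow> ('e \<Rightarrow> real) \<Rightarrow> real) \<Rightarrow> bool" where
  "function_hilbert_space E H ip \<longleftrightarrow>
     (\<forall>f\<in>H. \<forall>x. x \<notin> E \<longrightarrow> f x = 0) \<and>
     (\<lambda>x. 0) \<in> H \<and>
     (\<forall>f\<in>H. \<forall>g\<in>H. (\<lambda>x. f x + g x) \<in> H) \<and>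
     (\<forall>c. \<forall>f\<in>H. (\<lambda>x. c * f x) \<in> H) \<and>
     (\<forall>f\<in>H. \<forall>g\<in>H. ip f g = ip g f) \<and>
     (\<forall>f\<in>H. \<forall>g\<in>H. \<forall>h\<in>H. ip (\<lambda>x. f x + g x) h = ip f h + ip g h) \<and>
     (\<forall>c. \<forall>f\<in>H. \<forall>g\<in>H. ip (\<lambda>x. c * f x) g = c * ip f g) \<and>
     (\<forall>f\<in>H. 0 \<le> ip f f) \<and>
     (\<forall>f\<in>H. ip f f = 0 \<longrightarrow> f = (\<lambda>x. 0)) \<and>
     (\<forall>u :: nat \<Rightarrow> 'e \<Rightarrow> real.
        (\<forall>n. u n \<in> H) \<and>
        (\<forall>\<epsilon>>0. \<exists>N. \<forall>m\<ge>N. \<forall>n\<ge>N. ip_norm ip (\<lambda>x. u m x - u n x) < \<epsilon>) \<longrightarrow>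
        (\<exists>f\<in>H. (\<lambda>n. ip_norm ip (\<lambda>x. u n x - f x)) \<longlonglongrightarrow> 0))"

text \<open>
  For given \<open>E\<close> and \<open>k\<close> there is at most one such \<open>H\<close>, and the values of \<open>ip\<close> on \<open>H\<close> are
  determined as well, so an existential quantifier over \<open>H\<close> and \<open>ip\<close> below speaks about the
  RKHS of \<open>k\<close>. Its existence says that \<open>k\<close> is symmetric and positive semidefinite on \<open>E\<close>.
\<close>

definition is_rkhs ::
    "'e set \<Rightarrow> ('e \<Rightarrow> 'e \<Rightarrow> real) \<Rightarrow> ('e \<Rightarrow> real) set \<Rightarrow>
     (('e \<Rightarrow> real) \<Rightarrow> ('e \<Rightarrow> real) \<Rightarrow> real) \<Rightarrow> bool" where
  "is_rkhs E k H ip \<longleftrightarrow>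
     function_hilbert_space E H ip \<and>
     (\<forall>x\<in>E. kernel_section E k x \<in> H \<and> (\<forall>f\<in>H. f x = ip f (kernel_section E k x)))"

definition C0_functions :: "'a topology \<Rightarrow> ('a \<Rightarrow> real) set" where
  "C0_functions T =
     {f. continuous_map T euclideanreal f \<and>
         (\<forall>\<epsilon>>0. compactin T {x \<in> topspace T. \<bar>f x\<bar> \<ge> \<epsilon>})}"

definition c0_universal :: "'a metric \<Rightarrow> ('a \<Rightarrow> 'a \<Rightarrow> real) \<Rightarrow> bool" where
  "c0_universal S k \<longleftrightarrow>
     continuous_map (prod_topology (mtopology_of S) (mtopology_of S)) euclideanreal
       (\<lambda>(x, y). k x y) \<and>
     (\<exists>H ip. is_rkhs (mspace S) k H ip \<and>
        H \<subseteq> C0_functions (mtopology_of S) \<and>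
        (\<forall>g \<in> C0_functions (mtopology_of S). \<forall>\<epsilon>>0. \<exists>f\<in>H. \<forall>x\<in>mspace S. \<bar>f x - g x\<bar> < \<epsilon>))"

definition is_mean_embedding ::
    "('e \<Rightarrow> real) set \<Rightarrow> (('e \<Rightarrow> real) \<Rightarrow> ('e \<Rightarrow> real) \<Rightarrow> real) \<Rightarrow>
     'e measure \<Rightarrow> ('e \<Rightarrow> real) \<Rightarrow> bool" where
  "is_mean_embedding H ip P \<mu> \<longleftrightarrow>
     \<mu> \<in> H \<and> (\<forall>f\<in>H. integrable P f \<and> (\<integral>x. f x \<partial>P) = ip f \<mu>)"

text \<open>
  The measurable space \<open>A\<close> only provides the sigma-algebra. The mean embedding is required to
  exist for every probability measure on it, since otherwise the distance of two mean embeddings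
  is not defined; it is unique when it exists.
\<close>

definition characteristic_kernel :: "'e measure \<Rightarrow> ('e \<Rightarrow> 'e \<Rightarrow> real) \<Rightarrow> bool" where
  "characteristic_kernel A k \<longleftrightarrow>
     (\<exists>H ip. is_rkhs (space A) k H ip \<and>
        (\<forall>P. prob_space P \<and> sets P = sets A \<longrightarrow> (\<exists>\<mu>. is_mean_embedding H ip P \<mu>)) \<and>
        (\<forall>P Q \<mu> \<nu>. prob_space P \<and> sets P = sets A \<and> prob_space Q \<and> sets Q = sets A \<and>
           is_mean_embedding H ip P \<mu> \<and> is_mean_embedding H ip Q \<nu> \<longrightarrow>
           (ip_norm ip (\<lambda>x. \<mu> x - \<nu> x) = 0 \<longleftrightarrow> P = Q)))"


definition metric_borel :: "'a metric \<Rightarrow> 'a measure" where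
  "metric_borel S = sigma (mspace S) {U. openin (mtopology_of S) U}"

definition prod_borel :: "nat \<Rightarrow> (nat \<Rightarrow> 'a metric) \<Rightarrow> (nat \<Rightarrow> 'a) measure" where
  "prod_borel d S = (\<Pi>\<^sub>M j\<in>{1..d}. metric_borel (S j))"

definition tensor_kernel ::
    "nat \<Rightarrow> (nat \<Rightarrow> 'a \<Rightarrow> 'a \<Rightarrow> real) \<Rightarrow> (nat \<Rightarrow> 'a) \<Rightarrow> (nat \<Rightarrow> 'a) \<Rightarrow> real" where
  "tensor_kernel d k x y = (\<Prod>j=1..d. k j (x j) (y j))"


definition index_tuples :: "nat \<Rightarrow> nat \<Rightarrow> (nat \<Rightarrow> nat) set" where
  "index_tuples q n = {1..q} \<rightarrow>\<^sub>E {1..n}"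

text \<open>For a data set \<open>D\<close>, the term \<open>D i j\<close> is the \<open>j\<close>-th coordinate of the \<open>i\<close>-th point.\<close>

definition dHSIC ::
    "nat \<Rightarrow> (nat \<Rightarrow> 'a \<Rightarrow> 'a \<Rightarrow> real) \<Rightarrow> nat \<Rightarrow> (nat \<Rightarrow> nat \<Rightarrow> 'a) \<Rightarrow> real" where
  "dHSIC d k n D =
     1 / real n ^ 2 *
       (\<Sum>i\<in>index_tuples 2 n. \<Prod>j=1..d. k j (D (i 1) j) (D (i 2) j)) +
     1 / real n ^ (2 * d) *
       (\<Sum>i\<in>index_tuples (2 * d) n. \<Prod>j=1..d. k j (D (i (2 * j - 1)) j) (D (i (2 * j)) j)) -
     2 / real n ^ (d + 1) *
       (\<Sum>i\<in>index_tuples (d + 1) n. \<Prod>j=1..d. k j (D (i 1) j) (D (i (j + 1)) j))"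

definition permute_data ::
    "(nat \<Rightarrow> nat \<Rightarrow> nat) \<Rightarrow> (nat \<Rightarrow> nat \<Rightarrow> 'a) \<Rightarrow> nat \<Rightarrow> nat \<Rightarrow> 'a" where
  "permute_data \<psi> D = (\<lambda>i j. if j = 1 then D i 1 else D (\<psi> (j - 1) i) j)"

definition perm_p_value ::
    "nat \<Rightarrow> (nat \<Rightarrow> 'a \<Rightarrow> 'a \<Rightarrow> real) \<Rightarrow> nat \<Rightarrow> nat \<Rightarrow>
     (nat \<Rightarrow> nat \<Rightarrow> nat \<Rightarrow> nat) \<Rightarrow> (nat \<Rightarrow> nat \<Rightarrow> 'a) \<Rightarrow> real" where
  "perm_p_value d k n B \<psi> D =
     1 / (real B + 1) +
     1 / (real B + 1) *
       (\<Sum>b=1..B. if dHSIC d k n (permute_data (\<psi> b) D) \<ge> dHSIC d k n D then 1 else 0)"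

definition perms :: "nat \<Rightarrow> (nat \<Rightarrow> nat) set" where
  "perms n = {p. p permutes {1..n}}"

definition perm_vectors :: "nat \<Rightarrow> nat \<Rightarrow> (nat \<Rightarrow> nat \<Rightarrow> nat) measure" where
  "perm_vectors d n = (\<Pi>\<^sub>M m\<in>{1..d - 1}. count_space (perms n))"

definition uniform_perm_vector ::
    "'w measure \<Rightarrow> nat \<Rightarrow> nat \<Rightarrow> ('w \<Rightarrow> nat \<Rightarrow> nat \<Rightarrow> nat) \<Rightarrow> bool" where
  "uniform_perm_vector M d n \<psi> \<longleftrightarrow>
     \<psi> \<in> M \<rightarrow>\<^sub>M perm_vectors d n \<and>
     prob_space.indep_vars M (\<lambda>m. count_space (perms n)) (\<lambda>m \<omega>. \<psi> \<omega> m) {1..d - 1} \<and>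
     (\<forall>m\<in>{1..d - 1}.
        distr M (count_space (perms n)) (\<lambda>\<omega>. \<psi> \<omega> m) = uniform_count_measure (perms n))"

text \<open>
  The library's \<^const>\<open>prob_space.indep_var\<close> forces both random elements to have the same type;
  this is the same notion for random elements of two different types.
\<close>

definition indep_elements ::
    "'w measure \<Rightarrow> 'b measure \<Rightarrow> ('w \<Rightarrow> 'b) \<Rightarrow> 'c measure \<Rightarrow> ('w \<Rightarrow> 'c) \<Rightarrow> bool" where
  "indep_elements M N Y N' Y' \<longleftrightarrow>
     Y \<in> M \<rightarrow>\<^sub>M N \<and> Y' \<in> M \<rightarrow>\<^sub>M N' \<and>
     prob_space.indep_set M {Y -` A \<inter> space M | A. A \<in> sets N}
                            {Y' -` A \<inter> space M | A. A \<in> sets N'}"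

end

(* If P is the law of X and Q the product of its marginals, then dHSIC is the squared RKHS distance
   of the empirical versions of P and Q.  On the original data it converges in mean to the squared
   distance delta of the embeddings of P and Q, and delta > 0 because the kernel is characteristic.
   For every fixed data set with bounded kernel values, the average of dHSIC over all permutation
   vectors is O(1/n); being nonnegative, dHSIC of the permuted data tends to 0 in probability by
   Markov's inequality.  So with probability tending to 1 no permuted statistic reaches the original
   one, and then the p-value is 1/(B+1), which is at most alpha.

   The kernels are bounded, by uniform boundedness, since their RKHSs consist of bounded functions.
   The marginals are concentrated on sigma-compact sets: a measure on one factor that charges no
   compact set, multiplied by a Dirac measure on the others, would have mean embedding zero whatever
   the Dirac measure.  This gives the joint measurability needed for Fubini. *)

theory Submission
  imports Defs
begin

section \<open>Reproducing kernel Hilbert spaces\<close>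

text \<open>The three terms of the statistic carry the weights 1, 1 and -2. Averaging over
  permutations turns the first, apart from its diagonal, into a product over the coordinates of
  off-diagonal kernel means, and each of the other two into the product of full kernel means. The
  weights then cancel up to the difference between the two kinds of mean, which is O(1/n).

  The obstacle that shapes the proof is measurability. The spaces need not be separable, so a
  continuous kernel may fail to be measurable for the product of the Borel sigma-algebras. Two
  versions of the statistic are therefore carried along. The true one is nonnegative, and the
  integrability in the moment assumption makes it a random variable. The other uses kernels cut off
  to the sigma-compact sets that carry the marginals; it is a measurable function of the data, which
  independence and Fubini require. The two agree almost surely, so that bounds pass from one to the
  other.\<close>

context
  fixes E :: "'e set" and H :: "('e \<Rightarrow> real) set" and ip :: "('e \<Rightarrow> real) \<Rightarrow> ('e \<Rightarrow> real) \<Rightarrow> real"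
  assumes fhs: "function_hilbert_space E H ip"
begin

lemma fhs_outside: "f \<in> H \<Longrightarrow> x \<notin> E \<Longrightarrow> f x = 0"
  using fhs unfolding function_hilbert_space_def by blast

lemma fhs_zero: "(\<lambda>x. 0) \<in> H"
  using fhs unfolding function_hilbert_space_def by blast

lemma fhs_add: "f \<in> H \<Longrightarrow> g \<in> H \<Longrightarrow> (\<lambda>x. f x + g x) \<in> H"
  using fhs unfolding function_hilbert_space_def by blast

lemma fhs_scale: "f \<in> H \<Longrightarrow> (\<lambda>x. c * f x) \<in> H"
  using fhs unfolding function_hilbert_space_def by blast

lemma fhs_commute: "f \<in> H \<Longrightarrow> g \<in> H \<Longrightarrow> ip f g = ip g f"
  using fhs unfolding function_hilbert_space_def by blast

lemma fhs_ip_add: "f \<in> H \<Longrightarrow> g \<in> H \<Longrightarrow> h \<in> H \<Longrightarrow> ip (\<lambda>x. f x + g x) h = ip f h + ip g h"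
  using fhs unfolding function_hilbert_space_def by blast

lemma fhs_ip_scale: "f \<in> H \<Longrightarrow> g \<in> H \<Longrightarrow> ip (\<lambda>x. c * f x) g = c * ip f g"
  using fhs unfolding function_hilbert_space_def by blast

lemma fhs_nonneg: "f \<in> H \<Longrightarrow> 0 \<le> ip f f"
  using fhs unfolding function_hilbert_space_def by blast

lemma fhs_definite: "f \<in> H \<Longrightarrow> ip f f = 0 \<Longrightarrow> f = (\<lambda>x. 0)"
  using fhs unfolding function_hilbert_space_def by blast

lemma fhs_complete:
  assumes "\<And>n::nat. u n \<in> H"
    and "\<And>\<epsilon>. \<epsilon> > 0 \<Longrightarrow> \<exists>N. \<forall>m\<ge>N. \<forall>n\<ge>N. ip_norm ip (\<lambda>x. u m x - u n x) < \<epsilon>"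
  obtains f where "f \<in> H" "(\<lambda>n. ip_norm ip (\<lambda>x. u n x - f x)) \<longlonglongrightarrow> 0"
  using fhs assms unfolding function_hilbert_space_def by blast

lemma fhs_diff:
  assumes "f \<in> H" "g \<in> H"
  shows "(\<lambda>x. f x - g x) \<in> H"
  using fhs_add[OF assms(1) fhs_scale[OF assms(2), of "-1"]] by simp

lemma fhs_ip_diff:
  assumes "f \<in> H" "g \<in> H" "h \<in> H"
  shows "ip (\<lambda>x. f x - g x) h = ip f h - ip g h"
  using fhs_ip_add[OF assms(1) fhs_scale[OF assms(2), of "-1"] assms(3)]
    fhs_ip_scale[OF assms(2,3), of "-1"] by simp

lemma fhs_ip_diff_self:
  assumes "f \<in> H" "g \<in> H"
  shows "ip (\<lambda>x. f x - g x) (\<lambda>x. f x - g x) = ip f f - 2 * ip f g + ip g g"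
proof -
  have d: "(\<lambda>x. f x - g x) \<in> H" using assms by (rule fhs_diff)
  have "ip f (\<lambda>x. f x - g x) = ip f f - ip f g" "ip g (\<lambda>x. f x - g x) = ip f g - ip g g"
    using fhs_ip_diff[OF assms] assms fhs_commute d by metis+
  then show ?thesis using fhs_ip_diff[OF assms d] by simp
qed

lemma fhs_sum: "finite I \<Longrightarrow> (\<And>i. i \<in> I \<Longrightarrow> e i \<in> H) \<Longrightarrow> (\<lambda>x. \<Sum>i\<in>I. c i * e i x) \<in> H"
proof (induction I rule: finite_induct)
  case empty
  then show ?case using fhs_zero by simp
next
  case (insert i I)
  then show ?case using fhs_add[OF fhs_scale[of "e i" "c i"], of "\<lambda>x. \<Sum>i\<in>I. c i * e i x"] by simp
qed

lemma fhs_ip_sum: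
  "finite I \<Longrightarrow> (\<And>i. i \<in> I \<Longrightarrow> e i \<in> H) \<Longrightarrow> h \<in> H \<Longrightarrow>
   ip (\<lambda>x. \<Sum>i\<in>I. c i * e i x) h = (\<Sum>i\<in>I. c i * ip (e i) h)"
proof (induction I rule: finite_induct)
  case empty
  then show ?case using fhs_ip_scale[OF fhs_zero, of h 0] by simp
next
  case (insert i I)
  then show ?case
    using fhs_ip_add[OF fhs_scale[of "e i" "c i"], of "\<lambda>x. \<Sum>i\<in>I. c i * e i x" h] fhs_sum[of I e c]
      fhs_ip_scale[of "e i" h "c i"] by simp
qed

lemma fhs_ip_sum_self:
  assumes "finite I" "\<And>i. i \<in> I \<Longrightarrow> e i \<in> H"
  shows "ip (\<lambda>x. \<Sum>i\<in>I. c i * e i x) (\<lambda>x. \<Sum>i\<in>I. c i * e i x) = (\<Sum>i\<in>I. \<Sum>j\<in>I. c i * c j * ip (e i) (e j))"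
proof -
  let ?f = "\<lambda>x. \<Sum>i\<in>I. c i * e i x"
  have f: "?f \<in> H" using assms by (rule fhs_sum)
  have "ip (e i) ?f = (\<Sum>j\<in>I. c j * ip (e i) (e j))" if "i \<in> I" for i
    using fhs_commute[OF assms(2)[OF that] f] fhs_ip_sum[OF assms assms(2)[OF that], where c=c]
      fhs_commute[OF assms(2)[OF that] assms(2)] by simp
  then show ?thesis
    using fhs_ip_sum[OF assms f, where c=c]
    by (simp add: sum_distrib_left mult.assoc)
qed

lemma fhs_Cauchy_Schwarz:
  assumes "f \<in> H" "g \<in> H"
  shows "(ip f g)\<^sup>2 \<le> ip f f * ip g g"
proof (cases "ip g g = 0")
  case True
  then have "g = (\<lambda>x. 0)" using assms fhs_definite by blast
  moreover have "ip (\<lambda>x. 0) f = 0" using fhs_ip_scale[OF fhs_zero assms(1), of 0] by simp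
  ultimately have "ip f g = 0" using fhs_commute assms by metis
  then show ?thesis using True by simp
next
  case False
  \<comment> \<open>With this \<open>c\<close> the function \<open>f - c g\<close> is orthogonal to
    \<open>g\<close>; its squared norm is the difference to be shown nonnegative.\<close>
  define c where "c = ip f g / ip g g"
  have pos: "ip g g > 0" using fhs_nonneg[OF assms(2)] False by simp
  have g': "(\<lambda>x. c * g x) \<in> H" using assms by (intro fhs_scale)
  have "ip f (\<lambda>x. c * g x) = c * ip f g" "ip (\<lambda>x. c * g x) (\<lambda>x. c * g x) = c * c * ip g g"
    using fhs_commute fhs_ip_scale assms g' by (metis mult.assoc)+
  then have "0 \<le> ip f f - 2 * (c * ip f g) + c * c * ip g g"
    using fhs_ip_diff_self[OF assms(1) g'] fhs_nonneg[OF fhs_diff[OF assms(1) g']] by simp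
  also have "\<dots> = ip f f - (ip f g)\<^sup>2 / ip g g"
    using pos by (simp add: c_def field_simps power2_eq_square)
  finally show ?thesis using pos by (simp add: field_simps)
qed

end

section \<open>Consequences of the reproducing property\<close>

context
  fixes E :: "'e set" and k :: "'e \<Rightarrow> 'e \<Rightarrow> real" and H ip
  assumes rkhs: "is_rkhs E k H ip"
begin

lemma rkhs_fhs: "function_hilbert_space E H ip"
  using rkhs unfolding is_rkhs_def by blast

lemma rkhs_section: "x \<in> E \<Longrightarrow> kernel_section E k x \<in> H"
  using rkhs unfolding is_rkhs_def by blast

lemma rkhs_eval: "f \<in> H \<Longrightarrow> x \<in> E \<Longrightarrow> f x = ip f (kernel_section E k x)"
  using rkhs unfolding is_rkhs_def by blast

lemma rkhs_ip_sections:
  assumes "x \<in> E" "y \<in> E"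
  shows "ip (kernel_section E k x) (kernel_section E k y) = k x y"
  using rkhs_eval[OF rkhs_section[OF assms(1)] assms(2)] assms by (simp add: kernel_section_def)

lemma rkhs_commute: "x \<in> E \<Longrightarrow> y \<in> E \<Longrightarrow> k x y = k y x"
  using rkhs_ip_sections fhs_commute[OF rkhs_fhs] rkhs_section by metis

text \<open>The quadratic form is the squared norm of the corresponding combination of kernel
  sections. The points form an indexed family, which may repeat, as data points may.\<close>

lemma rkhs_psd:
  assumes "finite I" "\<And>i. i \<in> I \<Longrightarrow> z i \<in> E"
  shows "0 \<le> (\<Sum>i\<in>I. \<Sum>j\<in>I. c i * c j * k (z i) (z j))"
proof -
  have m: "\<And>i. i \<in> I \<Longrightarrow> kernel_section E k (z i) \<in> H" using assms rkhs_section by blast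
  have "0 \<le> (\<Sum>i\<in>I. \<Sum>j\<in>I. c i * c j * ip (kernel_section E k (z i)) (kernel_section E k (z j)))"
    using fhs_nonneg[OF rkhs_fhs fhs_sum[OF rkhs_fhs assms(1) m, where c=c]]
      fhs_ip_sum_self[OF rkhs_fhs assms(1) m, where c=c] by simp
  then show ?thesis using assms(2) by (simp add: rkhs_ip_sections)
qed

lemma rkhs_eval_le:
  assumes "f \<in> H" "x \<in> E"
  shows "\<bar>f x\<bar> \<le> ip_norm ip f * sqrt (k x x)"
proof -
  have "(f x)\<^sup>2 \<le> ip f f * k x x"
    using fhs_Cauchy_Schwarz[OF rkhs_fhs assms(1) rkhs_section[OF assms(2)]]
      rkhs_eval[OF assms] rkhs_ip_sections[OF assms(2,2)] by simp
  then show ?thesis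
    by (metis ip_norm_def real_sqrt_abs real_sqrt_le_iff real_sqrt_mult)
qed

lemma rkhs_abs_kernel_le:
  assumes "x \<in> E" "y \<in> E"
  shows "\<bar>k x y\<bar> \<le> sqrt (k x x) * sqrt (k y y)"
  using rkhs_eval_le[OF rkhs_section[OF assms(1)] assms(2)] rkhs_ip_sections[OF assms(1,1)] assms
  by (simp add: ip_norm_def kernel_section_def)

lemma rkhs_diag_nonneg: "x \<in> E \<Longrightarrow> 0 \<le> k x x"
  using rkhs_ip_sections[of x x] fhs_nonneg[OF rkhs_fhs rkhs_section[of x]] by simp

text \<open>Gliding hump: if the evaluation functionals were unbounded, a series
  \<open>\<Sum>n. \<plusminus> 3\<^sup>-\<^sup>n k(x\<^sub>n, \<cdot>) / \<parallel>k(x\<^sub>n, \<cdot>)\<parallel>\<close> with suitable signs would be an unbounded element of \<open>H\<close>.\<close>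

lemma rkhs_diag_bounded:
  assumes bdd: "\<And>f. f \<in> H \<Longrightarrow> \<exists>b. \<forall>x\<in>E. \<bar>f x\<bar> \<le> b"
  shows "\<exists>b. \<forall>x\<in>E. k x x \<le> b"
proof (rule ccontr)
  assume "\<nexists>b. \<forall>x\<in>E. k x x \<le> b"
  \<comment> \<open>The square yields \<open>4 ^ n\<close> as a lower bound for the norms
    \<open>s n\<close> of the kernel sections, which have to outgrow the weights
    \<open>(1/3) ^ n\<close>.\<close>
  then have "\<forall>n::nat. \<exists>x\<in>E. k x x > (4 ^ n)\<^sup>2" by (meson not_le)
  then obtain z where zE: "\<And>n. z n \<in> E" and z: "\<And>n. k (z n) (z n) > (4 ^ n)\<^sup>2" by metis
  define s where "s n = sqrt (k (z n) (z n))" for n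
  have s4: "s n > 4 ^ n" for n
    unfolding s_def by (rule real_less_rsqrt[OF z])
  then have s0: "s n > 0" for n by (rule less_trans[rotated]) simp
  \<comment> \<open>\<open>e n\<close> is the section at \<open>z n\<close> scaled to norm one; its
    value \<open>s n\<close> at \<open>z n\<close> is the largest that a unit vector can take
    there.\<close>
  define e where "e n x = 1 / s n * kernel_section E k (z n) x" for n x
  have eH: "e n \<in> H" for n
    unfolding e_def[abs_def] by (intro fhs_scale[OF rkhs_fhs] rkhs_section zE)
  have e_eval: "e m (z n) = k (z m) (z n) / s m" for m n
    using zE by (simp add: e_def kernel_section_def)
  have e_z: "\<bar>e m (z n)\<bar> \<le> s n" for m n
    using rkhs_abs_kernel_le[OF zE zE, of m n] s0[of m]
    by (simp add: e_eval s_def[symmetric] field_simps abs_mult)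
  have s2: "s n * s n = k (z n) (z n)" for n
    using rkhs_diag_nonneg[OF zE] by (simp add: s_def)
  have e_zz: "e n (z n) = s n" for n
    using s0[of n] s2[of n] by (simp add: e_eval field_simps)
  have e_ip: "\<bar>ip (e m) (e n)\<bar> \<le> 1" for m n
  proof -
    have "ip (e m) (e n) = e m (z n) / s n"
    proof -
      have "ip (e m) (e n) = ip (\<lambda>x. 1 / s n * kernel_section E k (z n) x) (e m)"
        using fhs_commute[OF rkhs_fhs eH eH, of m n] by (simp add: e_def[abs_def])
      also have "\<dots> = 1 / s n * ip (kernel_section E k (z n)) (e m)"
        by (rule fhs_ip_scale[OF rkhs_fhs rkhs_section[OF zE] eH])
      also have "\<dots> = e m (z n) / s n"
        using rkhs_eval[OF eH zE, of m n] fhs_commute[OF rkhs_fhs eH rkhs_section[OF zE]] by simp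
      finally show ?thesis .
    qed
    then show ?thesis using e_z[of m n] s0[of n] by (simp add: abs_divide)
  qed
  \<comment> \<open>The sign of a coefficient depends on all earlier ones, so the recursion carries
    the whole coefficient function, and \<open>d n\<close> reads off entry \<open>n\<close> once it
    is final. The sign is that of the partial sum at \<open>z n\<close>, so that the new term cannot
    cancel it.\<close>
  define c where "c = rec_nat (\<lambda>n. 0) (\<lambda>n c. c(n := (if (\<Sum>i<n. c i * e i (z n)) \<ge> 0 then 1 else -1) * (1/3) ^ n))"
  define d where "d n = c (Suc n) n" for n
  have c_Suc: "c (Suc n) = (c n)(n := (if (\<Sum>i<n. c n i * e i (z n)) \<ge> 0 then 1 else -1) * (1/3) ^ n)" for n
    by (simp add: c_def)
  have c_d: "i < n \<Longrightarrow> c n i = d i" for i n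
  proof (induction n)
    case (Suc n)
    then show ?case by (cases "i = n") (auto simp: c_Suc d_def)
  qed simp
  have d_eq: "d n = (if (\<Sum>i<n. d i * e i (z n)) \<ge> 0 then 1 else -1) * (1/3) ^ n" for n
    using c_d[of _ n] by (simp add: d_def c_Suc)
  have d_abs: "\<bar>d n\<bar> = (1/3) ^ n" for n by (simp add: d_eq[of n] abs_mult)
  have hump: "\<bar>\<Sum>i<Suc n. d i * e i (z n)\<bar> \<ge> (1/3) ^ n * s n" for n
    using s0[of n] e_zz[of n] d_eq[of n] by (auto split: if_splits)
  have tail: "(\<Sum>i=m..<n. \<bar>d i\<bar>) \<le> 3 / 2 * (1/3) ^ m" for m n :: nat
  proof (cases "m \<le> n")
    case True
    have "(\<Sum>i=m..<n. (1/3 :: real) ^ i) = 3 / 2 * ((1/3) ^ m - (1/3) ^ n)"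
      using True by (induction rule: dec_induct) (auto simp: algebra_simps)
    then show ?thesis by (simp add: d_abs)
  qed simp
  define u where "u n x = (\<Sum>i<n. d i * e i x)" for n x
  have uH: "u n \<in> H" for n
    unfolding u_def[abs_def] by (intro fhs_sum[OF rkhs_fhs] eH) simp
  have u_diff: "u n x - u m x = (\<Sum>i=m..<n. d i * e i x)" if "m \<le> n" for m n x
    using that by (simp add: u_def lessThan_atLeast0 sum_diff_nat_ivl)
  have u_norm: "ip_norm ip (\<lambda>x. u n x - u m x) \<le> 3 / 2 * (1/3) ^ m" if "m \<le> n" for m n
  proof -
    have "ip (\<lambda>x. u n x - u m x) (\<lambda>x. u n x - u m x)
        = (\<Sum>i=m..<n. \<Sum>j=m..<n. d i * d j * ip (e i) (e j))"
      using u_diff[OF that] fhs_ip_sum_self[OF rkhs_fhs _ eH, of "{m..<n}" d "\<lambda>x. x"] by simp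
    also have "\<dots> \<le> (\<Sum>i=m..<n. \<Sum>j=m..<n. \<bar>d i\<bar> * \<bar>d j\<bar>)"
    proof (intro sum_mono)
      fix i j
      have "d i * d j * ip (e i) (e j) \<le> \<bar>d i * d j\<bar> * \<bar>ip (e i) (e j)\<bar>"
        by (metis abs_ge_self abs_mult)
      also have "\<dots> \<le> \<bar>d i * d j\<bar> * 1" by (intro mult_left_mono e_ip) simp
      finally show "d i * d j * ip (e i) (e j) \<le> \<bar>d i\<bar> * \<bar>d j\<bar>" by (simp add: abs_mult)
    qed
    also have "\<dots> = (\<Sum>i=m..<n. \<bar>d i\<bar>)\<^sup>2" by (simp add: power2_eq_square sum_product)
    finally have "ip_norm ip (\<lambda>x. u n x - u m x) \<le> sqrt ((\<Sum>i=m..<n. \<bar>d i\<bar>)\<^sup>2)"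
      unfolding ip_norm_def by (rule real_sqrt_le_mono)
    also have "\<dots> = (\<Sum>i=m..<n. \<bar>d i\<bar>)" by (simp add: sum_nonneg)
    finally show ?thesis using tail[of m n] by simp
  qed
  have sym: "ip_norm ip (\<lambda>x. u n x - u m x) = ip_norm ip (\<lambda>x. u m x - u n x)" for m n
    using fhs_ip_diff_self[OF rkhs_fhs uH uH, of m n] fhs_ip_diff_self[OF rkhs_fhs uH uH, of n m]
      fhs_commute[OF rkhs_fhs uH uH, of m n] by (simp add: ip_norm_def)
  obtain f where f: "f \<in> H" and lim: "(\<lambda>n. ip_norm ip (\<lambda>x. u n x - f x)) \<longlonglongrightarrow> 0"
  proof (rule fhs_complete[OF rkhs_fhs uH])
    fix \<epsilon> :: real assume "\<epsilon> > 0"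
    have "(\<lambda>m. 3 / 2 * (1/3 :: real) ^ m) \<longlonglongrightarrow> 3 / 2 * 0"
      by (intro tendsto_intros) simp_all
    then have "\<forall>\<^sub>F m in sequentially. 3 / 2 * (1/3 :: real) ^ m < \<epsilon>"
      using \<open>\<epsilon> > 0\<close> by (intro order_tendstoD) auto
    then obtain N where N: "\<And>m. m \<ge> N \<Longrightarrow> 3 / 2 * (1/3 :: real) ^ m < \<epsilon>"
      unfolding eventually_sequentially by blast
    have "ip_norm ip (\<lambda>x. u m x - u n x) < \<epsilon>" if "m \<ge> N" "n \<ge> N" for m n
      using u_norm[of m n] u_norm[of n m] sym[of m n] N[of m] N[of n] that
      by (cases "m \<le> n") (auto intro: le_less_trans)
    then show "\<exists>N. \<forall>m\<ge>N. \<forall>n\<ge>N. ip_norm ip (\<lambda>x. u m x - u n x) < \<epsilon>" by blast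
  qed
  have ptw: "(\<lambda>n. u n x) \<longlonglongrightarrow> f x" if "x \<in> E" for x
  proof (rule LIM_zero_cancel, rule Lim_null_comparison)
    show "\<forall>\<^sub>F n in sequentially. norm (u n x - f x) \<le> ip_norm ip (\<lambda>x. u n x - f x) * sqrt (k x x)"
      using rkhs_eval_le[OF fhs_diff[OF rkhs_fhs uH f] that] by simp
    show "(\<lambda>n. ip_norm ip (\<lambda>x. u n x - f x) * sqrt (k x x)) \<longlonglongrightarrow> 0"
      by (rule tendsto_mult_left_zero[OF lim])
  qed
  have f_large: "\<bar>f (z n)\<bar> \<ge> 1 / 2 * (4/3) ^ n" for n
  proof -
    \<comment> \<open>By \<open>tail\<close> the terms after \<open>n\<close> contribute at most
      \<open>3 / 2 * (1/3) ^ Suc n * s n\<close>, half of the hump \<open>(1/3) ^ n * s n\<close>;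
      the other half survives in the limit.\<close>
    have ge: "\<bar>u m (z n)\<bar> \<ge> 1 / 2 * (1/3) ^ n * s n" if "m \<ge> Suc n" for m
    proof -
      have "\<bar>u m (z n) - u (Suc n) (z n)\<bar> \<le> (\<Sum>i=Suc n..<m. \<bar>d i * e i (z n)\<bar>)"
        unfolding u_diff[OF that] by (rule sum_abs)
      also have "\<dots> \<le> (\<Sum>i=Suc n..<m. \<bar>d i\<bar> * s n)"
        unfolding abs_mult by (intro sum_mono mult_left_mono e_z) simp
      also have "\<dots> = (\<Sum>i=Suc n..<m. \<bar>d i\<bar>) * s n" by (simp add: sum_distrib_right)
      also have "\<dots> \<le> 3 / 2 * (1/3) ^ Suc n * s n"
        using tail[of "Suc n" m] s0[of n] by (intro mult_right_mono) auto
      finally have "\<bar>u m (z n) - u (Suc n) (z n)\<bar> \<le> 1 / 2 * ((1/3) ^ n * s n)" by simp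
      moreover have "\<bar>u (Suc n) (z n)\<bar> \<ge> (1/3) ^ n * s n" using hump[of n] unfolding u_def .
      ultimately show ?thesis by linarith
    qed
    have "1 / 2 * (1/3) ^ n * s n \<le> \<bar>f (z n)\<bar>"
      by (rule LIMSEQ_le_const[OF tendsto_rabs[OF ptw[OF zE]]]) (use ge in blast)
    moreover have "1 / 2 * (1/3) ^ n * 4 ^ n \<le> 1 / 2 * (1/3) ^ n * s n"
      using s4[of n] by (intro mult_left_mono) auto
    ultimately show ?thesis by (simp add: power_divide)
  qed
  obtain b where b: "\<And>x. x \<in> E \<Longrightarrow> \<bar>f x\<bar> \<le> b" using bdd[OF f] by blast
  obtain n where "2 * b < (4/3 :: real) ^ n" using real_arch_pow[of "4/3" "2 * b"] by auto
  then show False using f_large[of n] b[OF zE, of n] by simp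
qed

lemma rkhs_kernel_bounded:
  assumes "\<And>f. f \<in> H \<Longrightarrow> \<exists>b. \<forall>x\<in>E. \<bar>f x\<bar> \<le> b"
  shows "\<exists>b. \<forall>x\<in>E. \<forall>y\<in>E. \<bar>k x y\<bar> \<le> b"
proof -
  obtain b where b: "\<And>x. x \<in> E \<Longrightarrow> k x x \<le> b" using rkhs_diag_bounded[OF assms] by blast
  have "\<bar>k x y\<bar> \<le> b" if xy: "x \<in> E" "y \<in> E" for x y
  proof -
    have "\<bar>k x y\<bar> \<le> sqrt (k x x) * sqrt (k y y)" using xy by (rule rkhs_abs_kernel_le)
    also have "\<dots> \<le> sqrt b * sqrt b"
      using b xy rkhs_diag_nonneg order_trans[OF rkhs_diag_nonneg[OF xy(1)] b[OF xy(1)]] by (intro mult_mono) auto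
    also have "\<dots> = b" using b[OF xy(1)] rkhs_diag_nonneg[OF xy(1)] by simp
    finally show ?thesis .
  qed
  then show ?thesis by blast
qed

end

section \<open>The statistic as a function of the Gram matrices\<close>

lemma sum_index_tuples_2:
  "(\<Sum>i\<in>index_tuples 2 n. f (i 1) (i 2)) = (\<Sum>a=1..n. \<Sum>b=1..n. f a b)"
proof -
  have "(\<Sum>i\<in>index_tuples 2 n. f (i 1) (i 2)) = (\<Sum>(a, b)\<in>{1..n} \<times> {1..n}. f a b)"
    unfolding index_tuples_def
    by (rule sum.reindex_bij_witness[of _ "\<lambda>(a, b). \<lambda>m\<in>{1..2}. if m = 1 then a else b" "\<lambda>i. (i 1, i 2)"])
      (auto simp: PiE_iff extensional_def fun_eq_iff le_Suc_eq numeral_2_eq_2)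
  then show ?thesis by (simp add: sum.cartesian_product)
qed

text \<open>A tuple of length \<open>2 * d\<close> is a choice of \<open>d\<close> unrelated pairs,
  one for each factor, so the sum of products is a product of sums.\<close>

lemma sum_index_tuples_double:
  fixes f :: "nat \<Rightarrow> nat \<Rightarrow> nat \<Rightarrow> real"
  shows "(\<Sum>i\<in>index_tuples (2 * d) n. \<Prod>j=1..d. f j (i (2 * j - 1)) (i (2 * j)))
    = (\<Prod>j=1..d. \<Sum>a=1..n. \<Sum>b=1..n. f j a b)"
proof -
  \<comment> \<open>Pair \<open>j\<close> occupies the positions \<open>2 * j - 1\<close> and
    \<open>2 * j\<close>: an odd position \<open>m\<close> belongs to pair
    \<open>Suc (m div 2)\<close>, an even one to pair \<open>m div 2\<close>.\<close>
  let ?u = "\<lambda>g. \<lambda>m\<in>{1..2 * d}. if odd m then fst (g (Suc (m div 2))) else snd (g (m div 2))"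
  let ?v = "\<lambda>i. \<lambda>j\<in>{1..d}. (i (2 * j - 1), i (2 * j))"
  have "(\<Sum>i\<in>index_tuples (2 * d) n. \<Prod>j=1..d. f j (i (2 * j - 1)) (i (2 * j)))
      = (\<Sum>g\<in>{1..d} \<rightarrow>\<^sub>E {1..n} \<times> {1..n}. \<Prod>j=1..d. (\<lambda>(a, b). f j a b) (g j))"
    unfolding index_tuples_def
  proof (rule sum.reindex_bij_witness[of _ ?u ?v])
    fix i assume i: "i \<in> {1..2 * d} \<rightarrow>\<^sub>E {1..n}"
    show "?u (?v i) = i"
    proof
      fix m
      show "?u (?v i) m = i m"
      proof (cases "m \<in> {1..2 * d}")
        case True
        then show ?thesis by (cases "odd m") (auto elim!: oddE evenE)
      qed (use i in \<open>auto simp: PiE_iff extensional_def\<close>)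
    qed
    show "?v i \<in> {1..d} \<rightarrow>\<^sub>E {1..n} \<times> {1..n}"
    proof (intro restrict_PiE_iff[THEN iffD2] ballI)
      fix j assume "j \<in> {1..d}"
      then have "2 * j - 1 \<in> {1..2 * d}" "2 * j \<in> {1..2 * d}" by auto
      then show "(i (2 * j - 1), i (2 * j)) \<in> {1..n} \<times> {1..n}" using i by (meson PiE_mem SigmaI)
    qed
  next
    fix g assume g: "g \<in> {1..d} \<rightarrow>\<^sub>E {1..n} \<times> {1..n}"
    show "?v (?u g) = g"
    proof
      fix j
      show "?v (?u g) j = g j"
      proof (cases "j \<in> {1..d}")
        case True
        then have "2 * j - 1 \<in> {1..2 * d}" "2 * j \<in> {1..2 * d}" "odd (2 * j - 1)" "Suc ((2 * j - 1) div 2) = j"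
          by auto
        with True show ?thesis by simp
      qed (use g in \<open>auto simp: PiE_iff extensional_def\<close>)
    qed
    have "Suc (m div 2) \<in> {1..d}" if "m \<in> {1..2 * d}" "odd m" for m
      using that by (auto elim!: oddE)
    moreover have "m div 2 \<in> {1..d}" if "m \<in> {1..2 * d}" "even m" for m
      using that by (auto elim!: evenE)
    ultimately have "odd m \<Longrightarrow> fst (g (Suc (m div 2))) \<in> {1..n}" "even m \<Longrightarrow> snd (g (m div 2)) \<in> {1..n}"
      if "m \<in> {1..2 * d}" for m
      using g that by (auto simp: PiE_iff mem_Times_iff)
    then show "?u g \<in> {1..2 * d} \<rightarrow>\<^sub>E {1..n}" by auto
  qed auto
  also have "\<dots> = (\<Prod>j=1..d. \<Sum>(a, b)\<in>{1..n} \<times> {1..n}. f j a b)"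
    by (rule prod_sum_PiE[symmetric]) auto
  finally show ?thesis by (simp add: sum.cartesian_product)
qed

text \<open>Once the shared first index is fixed, the remaining \<open>d\<close> indices vary freely
  and the sum over them factors.\<close>

lemma sum_index_tuples_Suc:
  fixes f :: "nat \<Rightarrow> nat \<Rightarrow> nat \<Rightarrow> real"
  shows "(\<Sum>i\<in>index_tuples (d + 1) n. \<Prod>j=1..d. f j (i 1) (i (j + 1)))
    = (\<Sum>a=1..n. \<Prod>j=1..d. \<Sum>b=1..n. f j a b)"
proof -
  let ?u = "\<lambda>(a, g). \<lambda>m\<in>{1..d + 1}. if m = 1 then a else g (m - 1)"
  let ?v = "\<lambda>i. (i 1, \<lambda>j\<in>{1..d}. i (j + 1))"
  have "(\<Sum>i\<in>index_tuples (d + 1) n. \<Prod>j=1..d. f j (i 1) (i (j + 1)))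
      = (\<Sum>(a, g)\<in>{1..n} \<times> ({1..d} \<rightarrow>\<^sub>E {1..n}). \<Prod>j=1..d. f j a (g j))"
    unfolding index_tuples_def
  proof (rule sum.reindex_bij_witness[of _ ?u ?v])
    fix i assume "i \<in> {1..d + 1} \<rightarrow>\<^sub>E {1..n}"
    then show "?u (?v i) = i" "?v i \<in> {1..n} \<times> ({1..d} \<rightarrow>\<^sub>E {1..n})"
      by (auto simp: PiE_iff extensional_def fun_eq_iff)
  next
    fix h assume "h \<in> {1..n} \<times> ({1..d} \<rightarrow>\<^sub>E {1..n})"
    then obtain a g where h: "h = (a, g)" "a \<in> {1..n}" "g \<in> {1..d} \<rightarrow>\<^sub>E {1..n}" by auto
    have "(m - 1) \<in> {1..d}" if "m \<in> {1..d + 1}" "m \<noteq> 1" for m using that by auto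
    then have "g (m - 1) \<in> {1..n}" if "m \<in> {1..d + 1}" "m \<noteq> 1" for m
      using h(3) that by (meson PiE_mem)
    then show "?u h \<in> {1..d + 1} \<rightarrow>\<^sub>E {1..n}" using h(1,2) by auto
    show "?v (?u h) = h"
      using h by (auto simp: PiE_iff extensional_def fun_eq_iff)
  qed auto
  then show ?thesis by (simp add: prod_sum_PiE sum.cartesian_product)
qed

text \<open>Arbitrary arrays are allowed, so that the same expression serves permuted data and
  cut-off kernels. The powers of \<open>n\<close> are distributed such that every factor is an
  average and inherits the bound on the entries.\<close>

definition gram_stat :: "nat \<Rightarrow> nat \<Rightarrow> (nat \<Rightarrow> nat \<Rightarrow> nat \<Rightarrow> real) \<Rightarrow> real" where
  "gram_stat d n K =
     (\<Sum>a=1..n. \<Sum>b=1..n. \<Prod>j=1..d. K j a b) / (real n)\<^sup>2 +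
     (\<Prod>j=1..d. (\<Sum>a=1..n. \<Sum>b=1..n. K j a b) / (real n)\<^sup>2) -
     2 * ((\<Sum>a=1..n. \<Prod>j=1..d. (\<Sum>b=1..n. K j a b) / real n) / real n)"

lemma dHSIC_eq_gram_stat: "dHSIC d k n D = gram_stat d n (\<lambda>j a b. k j (D a j) (D b j))"
proof -
  have "(\<Sum>i\<in>index_tuples 2 n. \<Prod>j=1..d. k j (D (i 1) j) (D (i 2) j))
      = (\<Sum>a=1..n. \<Sum>b=1..n. \<Prod>j=1..d. k j (D a j) (D b j))"
    using sum_index_tuples_2[of "\<lambda>a b. \<Prod>j=1..d. k j (D a j) (D b j)" n] by simp
  then show ?thesis
    unfolding dHSIC_def gram_stat_def
      sum_index_tuples_double[where d=d and n=n and f="\<lambda>j a b. k j (D a j) (D b j)"]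
      sum_index_tuples_Suc[where d=d and n=n and f="\<lambda>j a b. k j (D a j) (D b j)"]
    by (simp add: prod_dividef power_mult sum_divide_distrib[symmetric])
qed

lemma gram_stat_cong:
  assumes "\<And>j a b. j \<in> {1..d} \<Longrightarrow> a \<in> {1..n} \<Longrightarrow> b \<in> {1..n} \<Longrightarrow> K j a b = K' j a b"
  shows "gram_stat d n K = gram_stat d n K'"
proof -
  have "(\<Sum>a=1..n. \<Sum>b=1..n. \<Prod>j=1..d. K j a b) = (\<Sum>a=1..n. \<Sum>b=1..n. \<Prod>j=1..d. K' j a b)"
    by (intro sum.cong prod.cong refl assms)
  moreover have "(\<Prod>j=1..d. (\<Sum>a=1..n. \<Sum>b=1..n. K j a b) / (real n)\<^sup>2)
      = (\<Prod>j=1..d. (\<Sum>a=1..n. \<Sum>b=1..n. K' j a b) / (real n)\<^sup>2)"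
    by (intro sum.cong prod.cong arg_cong2[where f="(/)"] refl assms)
  moreover have "(\<Sum>a=1..n. \<Prod>j=1..d. (\<Sum>b=1..n. K j a b) / real n)
      = (\<Sum>a=1..n. \<Prod>j=1..d. (\<Sum>b=1..n. K' j a b) / real n)"
    by (intro sum.cong prod.cong arg_cong2[where f="(/)"] refl assms)
  ultimately show ?thesis unfolding gram_stat_def by (simp only:)
qed

text \<open>The statistic is the squared RKHS distance between the embeddings of the empirical measure
  and of the product of its marginals.\<close>

lemma gram_stat_nonneg:
  assumes rk: "is_rkhs E (tensor_kernel d k) H ip" and n: "n \<ge> 1"
    and E: "\<And>g. g \<in> {1..d} \<rightarrow>\<^sub>E {1..n} \<Longrightarrow> (\<lambda>j\<in>{1..d}. D (g j) j) \<in> E"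
  shows "gram_stat d n (\<lambda>j a b. k j (D a j) (D b j)) \<ge> 0"
proof -
  define K where "K j a b = k j (D a j) (D b j)" for j a b
  define G where "G = {1..d} \<rightarrow>\<^sub>E {1..n}"
  have finG: "finite G" unfolding G_def by (intro finite_PiE) auto
  define pt where "pt g = (\<lambda>j\<in>{1..d}. D (g j) j)" for g :: "nat \<Rightarrow> nat"
  define diag where "diag a = (\<lambda>j\<in>{1..d}. a)" for a :: nat
  \<comment> \<open>The difference of the two empirical measures is a signed sum of point masses
    over a disjoint union: \<open>Inl a\<close> is the data point \<open>a\<close>, with weight
    \<open>1 / n\<close>, and \<open>Inr g\<close> is the point whose coordinate \<open>j\<close>
    comes from data point \<open>g j\<close>, with weight \<open>- 1 / n ^ d\<close>.\<close>
  define z where "z = case_sum (\<lambda>a. pt (diag a)) pt"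
  define c :: "nat + (nat \<Rightarrow> nat) \<Rightarrow> real" where "c = case_sum (\<lambda>a. 1 / real n) (\<lambda>g. - 1 / real n ^ d)"
  define I where "I = {1..n} <+> G"
  have tk: "tensor_kernel d k (pt g) (pt h) = (\<Prod>j=1..d. K j (g j) (h j))" for g h
    unfolding tensor_kernel_def K_def pt_def by (intro prod.cong) auto
  have tkz: "tensor_kernel d k (z (Inl a)) (z (Inl b)) = (\<Prod>j=1..d. K j a b)"
    "tensor_kernel d k (z (Inl a)) (z (Inr g)) = (\<Prod>j=1..d. K j a (g j))"
    "tensor_kernel d k (z (Inr g)) (z (Inl a)) = (\<Prod>j=1..d. K j (g j) a)"
    "tensor_kernel d k (z (Inr g)) (z (Inr h)) = (\<Prod>j=1..d. K j (g j) (h j))" for a b g h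
    unfolding z_def sum.case tk diag_def by (intro prod.cong refl; simp)+
  have "0 \<le> (\<Sum>i\<in>I. \<Sum>j\<in>I. c i * c j * tensor_kernel d k (z i) (z j))"
  proof (rule rkhs_psd[OF rk])
    show "finite I" using finG by (simp add: I_def)
    fix i assume "i \<in> I"
    then show "z i \<in> E"
    proof (cases i)
      case (Inl a)
      then have "diag a \<in> {1..d} \<rightarrow>\<^sub>E {1..n}" using \<open>i \<in> I\<close> by (auto simp: diag_def I_def)
      then show ?thesis using E Inl by (simp add: z_def pt_def)
    next
      case (Inr g)
      then show ?thesis using E \<open>i \<in> I\<close> by (auto simp: z_def pt_def I_def G_def)
    qed
  qed
  also have "\<dots> =
      (\<Sum>a=1..n. \<Sum>b=1..n. 1 / real n * (1 / real n) * (\<Prod>j=1..d. K j a b))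
      + (\<Sum>a=1..n. \<Sum>g\<in>G. 1 / real n * (- 1 / real n ^ d) * (\<Prod>j=1..d. K j a (g j)))
      + (\<Sum>g\<in>G. \<Sum>a=1..n. (- 1 / real n ^ d) * (1 / real n) * (\<Prod>j=1..d. K j (g j) a))
      + (\<Sum>g\<in>G. \<Sum>h\<in>G. (- 1 / real n ^ d) * (- 1 / real n ^ d) * (\<Prod>j=1..d. K j (g j) (h j)))"
    unfolding I_def using finG
    by (simp only: sum.Plus tkz c_def sum.case sum.distrib finite_atLeastAtMost comp_def add.assoc)
  \<comment> \<open>The two mixed blocks agree by symmetry of the tensor kernel; this is where the
    factor 2 of the third term comes from.\<close>
  also have "(\<Sum>g\<in>G. \<Sum>a=1..n. (- 1 / real n ^ d) * (1 / real n) * (\<Prod>j=1..d. K j (g j) a))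
      = (\<Sum>a=1..n. \<Sum>g\<in>G. 1 / real n * (- 1 / real n ^ d) * (\<Prod>j=1..d. K j a (g j)))"
  proof -
    have "(\<Prod>j=1..d. K j (g j) a) = (\<Prod>j=1..d. K j a (g j))" if "a \<in> {1..n}" "g \<in> G" for a g
    proof -
      have da: "diag a \<in> {1..d} \<rightarrow>\<^sub>E {1..n}" using that by (auto simp: diag_def)
      have "tensor_kernel d k (z (Inr g)) (z (Inl a)) = tensor_kernel d k (z (Inl a)) (z (Inr g))"
        using rkhs_commute[OF rk E E[OF da], of g] that by (simp add: pt_def G_def z_def)
      then show ?thesis by (simp only: tkz)
    qed
    then show ?thesis
      by (subst sum.swap) (intro sum.cong, auto)
  qed
  also have "(\<Sum>a=1..n. \<Sum>g\<in>G. 1 / real n * (- 1 / real n ^ d) * (\<Prod>j=1..d. K j a (g j)))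
      = - (\<Sum>a=1..n. \<Prod>j=1..d. (\<Sum>b=1..n. K j a b) / real n) / real n"
    by (simp add: prod_dividef prod_sum_PiE G_def sum_divide_distrib sum_negf mult.commute)
  also have "(\<Sum>g\<in>G. \<Sum>h\<in>G. (- 1 / real n ^ d) * (- 1 / real n ^ d) * (\<Prod>j=1..d. K j (g j) (h j)))
      = (\<Prod>j=1..d. (\<Sum>a=1..n. \<Sum>b=1..n. K j a b) / (real n)\<^sup>2)"
    by (simp add: prod_dividef prod_sum_PiE G_def sum_divide_distrib power2_eq_square power_mult_distrib)
  also have "(\<Sum>a=1..n. \<Sum>b=1..n. 1 / real n * (1 / real n) * (\<Prod>j=1..d. K j a b))
      = (\<Sum>a=1..n. \<Sum>b=1..n. \<Prod>j=1..d. K j a b) / (real n)\<^sup>2"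
    by (simp add: sum_divide_distrib power2_eq_square)
  finally show ?thesis unfolding gram_stat_def K_def[symmetric] by simp
qed

section \<open>Averages over permutations\<close>

text \<open>One transposition takes \<open>a\<close> to \<open>a'\<close>; a second one corrects the
  image of \<open>b\<close> and fixes \<open>a'\<close>, which differs from both points that it
  exchanges.\<close>

lemma permutes_pair:
  assumes "a \<in> A" "b \<in> A" "a \<noteq> b" "a' \<in> A" "b' \<in> A" "a' \<noteq> b'"
  obtains p where "p permutes A" "p a = a'" "p b = b'"
proof -
  let ?q = "Transposition.transpose a a'"
  have q: "?q permutes A" using assms by (intro permutes_swap_id)
  have "?q b \<in> A" using q assms permutes_in_image by metis
  then have "Transposition.transpose (?q b) b' permutes A" using assms by (intro permutes_swap_id)
  then have comp: "(Transposition.transpose (?q b) b' \<circ> ?q) permutes A" using q by (rule permutes_compose[rotated])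
  have "?q b \<noteq> a'" using assms by (auto simp: Transposition.transpose_def)
  then have "(Transposition.transpose (?q b) b' \<circ> ?q) a = a'"
    using assms by (auto simp: Transposition.transpose_def)
  moreover have "(Transposition.transpose (?q b) b' \<circ> ?q) b = b'" by simp
  ultimately show ?thesis by (rule that[OF comp])
qed

lemma finite_perms: "finite (perms n)" unfolding perms_def by (simp add: finite_permutations)

lemma card_perms: "card (perms n) = fact n" unfolding perms_def by (simp add: card_permutations)

lemma sum_perms_compose:
  assumes "q \<in> perms n"
  shows "(\<Sum>p\<in>perms n. f (p \<circ> q)) = (\<Sum>p\<in>perms n. f p)"
  using sum_permutations_compose_right[of q "{1..n}" f] assms unfolding perms_def by simp

text \<open>Composition with a transposition shows that the sum does not depend on \<open>a\<close>.
  Summed over all \<open>a\<close>, the permutation drops out.\<close>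

lemma sum_perms_point:
  fixes f :: "nat \<Rightarrow> real"
  assumes "a \<in> {1..n}"
  shows "(\<Sum>p\<in>perms n. f (p a)) = fact n * ((\<Sum>c=1..n. f c) / real n)"
proof -
  have n: "n > 0" using assms by auto
  have eq: "(\<Sum>p\<in>perms n. f (p b)) = (\<Sum>p\<in>perms n. f (p a))" if "b \<in> {1..n}" for b
    using sum_perms_compose[of "Transposition.transpose a b" n "\<lambda>p. f (p a)"]
      permutes_swap_id[OF assms that] by (simp add: perms_def)
  have "real n * (\<Sum>p\<in>perms n. f (p a)) = (\<Sum>b=1..n. \<Sum>p\<in>perms n. f (p b))"
    by (simp add: eq)
  also have "\<dots> = (\<Sum>p\<in>perms n. \<Sum>b=1..n. f (p b))" by (rule sum.swap)
  also have "\<dots> = (\<Sum>p\<in>perms n. \<Sum>b=1..n. f b)"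
  proof (rule sum.cong[OF refl])
    fix p assume "p \<in> perms n"
    then show "(\<Sum>b=1..n. f (p b)) = (\<Sum>b=1..n. f b)"
      using sum.permute[of p "{1..n}" f] by (simp add: perms_def)
  qed
  also have "\<dots> = fact n * (\<Sum>b=1..n. f b)" by (simp add: card_perms)
  finally show ?thesis using n by (simp add: field_simps)
qed

text \<open>A uniform permutation sends a pair of distinct indices to a uniform pair of distinct
  indices; this is the mean under that distribution.\<close>

definition off_diag_mean :: "nat \<Rightarrow> (nat \<Rightarrow> nat \<Rightarrow> real) \<Rightarrow> real" where
  "off_diag_mean n f = (\<Sum>a=1..n. \<Sum>b\<in>{1..n} - {a}. f a b) / (real n * (real n - 1))"

text \<open>The symmetrisation used for one index works for ordered pairs of distinct indices,
  because permutations act transitively on these.\<close>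

lemma sum_perms_pair:
  fixes f :: "nat \<Rightarrow> nat \<Rightarrow> real"
  assumes ab: "a \<in> {1..n}" "b \<in> {1..n}" "a \<noteq> b"
  shows "(\<Sum>p\<in>perms n. f (p a) (p b)) = fact n * off_diag_mean n f"
proof -
  have n: "n \<ge> 2" using ab by (cases "n = 1") auto
  have eq: "(\<Sum>p\<in>perms n. f (p a') (p b')) = (\<Sum>p\<in>perms n. f (p a) (p b))"
    if ab': "a' \<in> {1..n}" "b' \<in> {1..n}" "a' \<noteq> b'" for a' b'
  proof -
    obtain q where "q permutes {1..n}" "q a = a'" "q b = b'" using permutes_pair[OF ab ab'] .
    then show ?thesis
      using sum_perms_compose[of q n "\<lambda>p. f (p a) (p b)"] by (simp add: perms_def)
  qed
  have "(\<Sum>a'=1..n. \<Sum>b'\<in>{1..n} - {a'}. \<Sum>p\<in>perms n. f (p a') (p b'))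
      = (\<Sum>a'=1..n. \<Sum>b'\<in>{1..n} - {a'}. \<Sum>p\<in>perms n. f (p a) (p b))"
    by (intro sum.cong refl eq) auto
  also have "\<dots> = real n * (real n - 1) * (\<Sum>p\<in>perms n. f (p a) (p b))"
    using n by (simp add: of_nat_diff)
  finally have "real n * (real n - 1) * (\<Sum>p\<in>perms n. f (p a) (p b))
      = (\<Sum>a'=1..n. \<Sum>b'\<in>{1..n} - {a'}. \<Sum>p\<in>perms n. f (p a') (p b'))" by simp
  also have "\<dots> = (\<Sum>a'=1..n. \<Sum>p\<in>perms n. \<Sum>b'\<in>{1..n} - {a'}. f (p a') (p b'))"
    by (intro sum.cong refl sum.swap)
  also have "\<dots> = (\<Sum>p\<in>perms n. \<Sum>a'=1..n. \<Sum>b'\<in>{1..n} - {a'}. f (p a') (p b'))"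
    by (rule sum.swap)
  also have "\<dots> = (\<Sum>p\<in>perms n. \<Sum>a'=1..n. \<Sum>b'\<in>{1..n} - {a'}. f a' b')"
  proof (rule sum.cong[OF refl])
    fix p assume "p \<in> perms n"
    then have p: "p permutes {1..n}" by (simp add: perms_def)
    have "(\<Sum>b'\<in>{1..n} - {a'}. f (p a') (p b')) = (\<Sum>b'\<in>{1..n} - {p a'}. f (p a') b')" for a'
    proof (rule sum.reindex_bij_betw)
      have "p ` ({1..n} - {a'}) = {1..n} - {p a'}"
        using permutes_image[OF p] permutes_inj[OF p] by (simp add: image_set_diff)
      then show "bij_betw p ({1..n} - {a'}) ({1..n} - {p a'})"
        using permutes_inj_on[OF p] by (simp add: bij_betw_def)
    qed
    then show "(\<Sum>a'=1..n. \<Sum>b'\<in>{1..n} - {a'}. f (p a') (p b')) = (\<Sum>a'=1..n. \<Sum>b'\<in>{1..n} - {a'}. f a' b')"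
      using sum.permute[OF p, of "\<lambda>a'. \<Sum>b'\<in>{1..n} - {a'}. f a' b'"] by simp
  qed
  also have "\<dots> = fact n * (\<Sum>a'=1..n. \<Sum>b'\<in>{1..n} - {a'}. f a' b')" by (simp add: card_perms)
  finally show ?thesis using n unfolding off_diag_mean_def by (simp add: field_simps)
qed

text \<open>Division by \<open>\<kappa>\<close> brings all factors into the unit ball, where the
  telescoping estimate \<open>norm_prod_diff\<close> applies. Scaling back costs
  \<open>\<kappa> ^ card I\<close>; one power could be saved but is given away, using \<kappa> \<ge>
  1.\<close>

lemma prod_diff_le:
  fixes z w :: "'i \<Rightarrow> real"
  assumes "finite I" "\<kappa> \<ge> 1" "\<And>i. i \<in> I \<Longrightarrow> \<bar>z i\<bar> \<le> \<kappa>" "\<And>i. i \<in> I \<Longrightarrow> \<bar>w i\<bar> \<le> \<kappa>"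
  shows "\<bar>(\<Prod>i\<in>I. z i) - (\<Prod>i\<in>I. w i)\<bar> \<le> \<kappa> ^ card I * (\<Sum>i\<in>I. \<bar>z i - w i\<bar>)"
proof -
  have "norm ((\<Prod>i\<in>I. z i / \<kappa>) - (\<Prod>i\<in>I. w i / \<kappa>)) \<le> (\<Sum>i\<in>I. norm (z i / \<kappa> - w i / \<kappa>))"
    using assms by (intro norm_prod_diff) (auto simp: abs_divide)
  also have "\<dots> \<le> (\<Sum>i\<in>I. \<bar>z i - w i\<bar>)"
  proof (rule sum_mono)
    fix i
    have "norm (z i / \<kappa> - w i / \<kappa>) = \<bar>z i - w i\<bar> / \<kappa>"
      using assms(2) by (simp add: diff_divide_distrib[symmetric] abs_divide)
    also have "\<dots> \<le> \<bar>z i - w i\<bar> / 1" using assms(2) by (intro divide_left_mono) auto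
    finally show "norm (z i / \<kappa> - w i / \<kappa>) \<le> \<bar>z i - w i\<bar>" by simp
  qed
  finally have "\<bar>(\<Prod>i\<in>I. z i) - (\<Prod>i\<in>I. w i)\<bar> / \<kappa> ^ card I \<le> (\<Sum>i\<in>I. \<bar>z i - w i\<bar>)"
    using assms(2) by (simp add: prod_dividef diff_divide_distrib[symmetric] abs_divide)
  then show ?thesis using assms(2) by (simp add: field_simps)
qed

lemma abs_prod_le:
  fixes z :: "'i \<Rightarrow> real"
  assumes "\<And>i. i \<in> I \<Longrightarrow> \<bar>z i\<bar> \<le> \<kappa>"
  shows "\<bar>\<Prod>i\<in>I. z i\<bar> \<le> \<kappa> ^ card I"
  using prod_mono[of I "\<lambda>i. \<bar>z i\<bar>" "\<lambda>_. \<kappa>"] assms by (simp add: abs_prod)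

lemma abs_sum_le:
  fixes f :: "nat \<Rightarrow> real"
  assumes "\<And>a. a \<in> {1..n} \<Longrightarrow> \<bar>f a\<bar> \<le> c"
  shows "\<bar>\<Sum>a=1..n. f a\<bar> \<le> real n * c"
  using sum_norm_bound[of "{1..n}" f c] assms by simp

lemma prod_from_1:
  fixes g :: "nat \<Rightarrow> real"
  assumes "d \<ge> 1"
  shows "(\<Prod>j=1..d. g j) = g 1 * (\<Prod>m=1..d - 1. g (Suc m))"
proof -
  obtain e where e: "d = Suc e" using assms by (cases d) auto
  show ?thesis unfolding e
    by (simp add: prod.atLeast_Suc_atMost prod.shift_bounds_cl_Suc_ivl del: prod.cl_ivl_Suc)
qed

text \<open>Letting the first coordinate carry the identity gives all \<open>d\<close> coordinates
  the same form; the components of \<open>\<sigma>\<close> are shifted by one.\<close>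

definition perm_at :: "(nat \<Rightarrow> nat \<Rightarrow> nat) \<Rightarrow> nat \<Rightarrow> nat \<Rightarrow> nat" where
  "perm_at \<sigma> j = (if j = 1 then id else \<sigma> (j - 1))"

lemma permute_data_eq: "permute_data \<sigma> D a j = D (perm_at \<sigma> j a) j"
  by (simp add: permute_data_def perm_at_def)

text \<open>The functions are extensional, so that this set is exactly the space of
  \<open>perm_vectors d n\<close>.\<close>

definition perm_tuples :: "nat \<Rightarrow> nat \<Rightarrow> (nat \<Rightarrow> nat \<Rightarrow> nat) set" where
  "perm_tuples d n = {1..d - 1} \<rightarrow>\<^sub>E perms n"

lemma finite_perm_tuples: "finite (perm_tuples d n)"
  unfolding perm_tuples_def by (intro finite_PiE finite_perms) simp

lemma card_perm_tuples: "card (perm_tuples d n) = fact n ^ (d - 1)"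
  unfolding perm_tuples_def by (simp add: card_PiE card_perms)

lemma perm_at_permutes:
  assumes "\<sigma> \<in> perm_tuples d n" "j \<in> {1..d}"
  shows "perm_at \<sigma> j permutes {1..n}"
proof (cases "j = 1")
  case False
  then have "j - 1 \<in> {1..d - 1}" using assms(2) by auto
  then show ?thesis using assms(1) False by (auto simp: perm_tuples_def perm_at_def perms_def)
qed (simp add: perm_at_def permutes_id)

text \<open>Independence of the component permutations in counting form; the first factor only ever
  sees the identity.\<close>

lemma sum_perm_tuples_prod:
  fixes F :: "nat \<Rightarrow> (nat \<Rightarrow> nat) \<Rightarrow> real"
  assumes "d \<ge> 1"
  shows "(\<Sum>\<sigma>\<in>perm_tuples d n. \<Prod>j=1..d. F j (perm_at \<sigma> j))
    = F 1 id * (\<Prod>m=1..d - 1. \<Sum>p\<in>perms n. F (Suc m) p)"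
proof -
  have "(\<Prod>j=1..d. F j (perm_at \<sigma> j)) = F 1 id * (\<Prod>m=1..d - 1. F (Suc m) (\<sigma> m))" for \<sigma>
    unfolding prod_from_1[OF assms] by (simp add: perm_at_def)
  then show ?thesis
    unfolding perm_tuples_def by (simp add: sum_distrib_left[symmetric] prod_sum_PiE finite_perms)
qed

text \<open>Up to the number of permutation vectors, the first term averages to at most
  \<open>\<kappa> ^ d / n\<close> plus \<open>(n - 1) / n\<close> times the product of the
  \<open>U j\<close>, the second to the product of the \<open>V j\<close>, and the third to minus
  twice that product. What remains is a diagonal contribution, the difference of the two products,
  and the product of the \<open>U j\<close> over \<open>n\<close>. No symmetry or positivity of the
  arrays enters.\<close>

lemma gram_stat_perm_average:
  assumes d: "d \<ge> 1" and n: "n \<ge> 2" and \<kappa>: "\<kappa> \<ge> 1"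
    and bd: "\<And>j a b. j \<in> {1..d} \<Longrightarrow> a \<in> {1..n} \<Longrightarrow> b \<in> {1..n} \<Longrightarrow> \<bar>K j a b\<bar> \<le> \<kappa>"
  shows "(\<Sum>\<sigma>\<in>perm_tuples d n. gram_stat d n (\<lambda>j a b. K j (perm_at \<sigma> j a) (perm_at \<sigma> j b)))
    \<le> fact n ^ (d - 1) * ((2 * real d + 2) * \<kappa> ^ (d + 1) / real n)"
proof -
  define N :: real where "N = fact n ^ (d - 1)"
  have N0: "N > 0" by (simp add: N_def)
  \<comment> \<open>\<open>U j\<close> and \<open>V j\<close> are the means of the array
    \<open>K j\<close> without and with its diagonal; \<open>r j\<close> consists of its row means,
    whose average is again \<open>V j\<close>.\<close>
  define U where "U j = off_diag_mean n (K j)" for j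
  define V where "V j = (\<Sum>a=1..n. \<Sum>b=1..n. K j a b) / (real n)\<^sup>2" for j
  define r where "r j a = (\<Sum>b=1..n. K j a b) / real n" for j a
  have N_prod: "(\<Prod>m=1..d - 1. fact n * g m) = N * (\<Prod>m=1..d - 1. g m)" for g :: "nat \<Rightarrow> real"
    by (simp add: prod.distrib N_def)
  have at_in: "perm_at \<sigma> j a \<in> {1..n}" if "\<sigma> \<in> perm_tuples d n" "j \<in> {1..d}" "a \<in> {1..n}" for \<sigma> j a
    using permutes_in_image[OF perm_at_permutes[OF that(1,2)]] that(3) by blast
  have off: "(\<Sum>\<sigma>\<in>perm_tuples d n. \<Prod>j=1..d. K j (perm_at \<sigma> j a) (perm_at \<sigma> j b))
      = N * (K 1 a b * (\<Prod>m=1..d - 1. U (Suc m)))" if "a \<in> {1..n}" "b \<in> {1..n}" "a \<noteq> b" for a b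
    using sum_perm_tuples_prod[OF d, of "\<lambda>j p. K j (p a) (p b)" n] sum_perms_pair[OF that]
    by (simp add: N_prod[simplified] U_def)
  have on: "(\<Sum>\<sigma>\<in>perm_tuples d n. \<Prod>j=1..d. K j (perm_at \<sigma> j a) (perm_at \<sigma> j a)) \<le> N * \<kappa> ^ d"
    if "a \<in> {1..n}" for a
  proof -
    have "(\<Prod>j=1..d. K j (perm_at \<sigma> j a) (perm_at \<sigma> j a)) \<le> \<kappa> ^ d" if "\<sigma> \<in> perm_tuples d n" for \<sigma>
    proof -
      have "\<bar>\<Prod>j=1..d. K j (perm_at \<sigma> j a) (perm_at \<sigma> j a)\<bar> \<le> \<kappa> ^ card {1..d}"
        using at_in[OF that _ \<open>a \<in> {1..n}\<close>] by (intro abs_prod_le bd) blast+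
      then show ?thesis by simp
    qed
    then show ?thesis
      using sum_bounded_above[of "perm_tuples d n" _ "\<kappa> ^ d"] by (simp add: card_perm_tuples N_def)
  qed
  have T1: "(\<Sum>\<sigma>\<in>perm_tuples d n. \<Sum>a=1..n. \<Sum>b=1..n. \<Prod>j=1..d. K j (perm_at \<sigma> j a) (perm_at \<sigma> j b))
      \<le> N * (real n * \<kappa> ^ d + real n * (real n - 1) * (\<Prod>j=1..d. U j))"
  proof -
    let ?f = "\<lambda>a b. \<Sum>\<sigma>\<in>perm_tuples d n. \<Prod>j=1..d. K j (perm_at \<sigma> j a) (perm_at \<sigma> j b)"
    have "(\<Sum>\<sigma>\<in>perm_tuples d n. \<Sum>a=1..n. \<Sum>b=1..n. \<Prod>j=1..d. K j (perm_at \<sigma> j a) (perm_at \<sigma> j b))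
        = (\<Sum>a=1..n. \<Sum>b=1..n. ?f a b)"
      by (subst sum.swap) (intro sum.cong refl sum.swap)
    also have "\<dots> = (\<Sum>a=1..n. ?f a a + (\<Sum>b\<in>{1..n} - {a}. ?f a b))"
      by (intro sum.cong refl sum.remove) auto
    also have "\<dots> \<le> (\<Sum>a=1..n. N * \<kappa> ^ d + (\<Sum>b\<in>{1..n} - {a}. N * (K 1 a b * (\<Prod>m=1..d - 1. U (Suc m)))))"
    proof (rule sum_mono)
      fix a assume a: "a \<in> {1..n}"
      have "(\<Sum>b\<in>{1..n} - {a}. ?f a b) = (\<Sum>b\<in>{1..n} - {a}. N * (K 1 a b * (\<Prod>m=1..d - 1. U (Suc m))))"
        using a by (intro sum.cong refl off) auto
      then show "?f a a + (\<Sum>b\<in>{1..n} - {a}. ?f a b)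
          \<le> N * \<kappa> ^ d + (\<Sum>b\<in>{1..n} - {a}. N * (K 1 a b * (\<Prod>m=1..d - 1. U (Suc m))))"
        using on[OF a] by simp
    qed
    also have "\<dots> = N * (real n * \<kappa> ^ d + (\<Sum>a=1..n. \<Sum>b\<in>{1..n} - {a}. K 1 a b) * (\<Prod>m=1..d - 1. U (Suc m)))"
      by (simp add: sum.distrib sum_distrib_left[symmetric] sum_distrib_right[symmetric] algebra_simps)
    \<comment> \<open>The first coordinate is not permuted, but the sum over all pairs of distinct
      indices turns its factor into the missing \<open>U 1\<close>.\<close>
    also have "(\<Sum>a=1..n. \<Sum>b\<in>{1..n} - {a}. K 1 a b) = real n * (real n - 1) * U 1"
      using n by (simp add: U_def off_diag_mean_def)
    finally show ?thesis using prod_from_1[OF d, of U] by (simp add: mult.assoc)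
  qed
  have T2: "(\<Sum>\<sigma>\<in>perm_tuples d n. \<Prod>j=1..d. (\<Sum>a=1..n. \<Sum>b=1..n. K j (perm_at \<sigma> j a) (perm_at \<sigma> j b)) / (real n)\<^sup>2)
      = N * (\<Prod>j=1..d. V j)"
  proof -
    \<comment> \<open>A permutation only reorders rows and columns, so the second term does not
      change at all.\<close>
    have "(\<Sum>a=1..n. \<Sum>b=1..n. K j (perm_at \<sigma> j a) (perm_at \<sigma> j b)) = (\<Sum>a=1..n. \<Sum>b=1..n. K j a b)"
      if "\<sigma> \<in> perm_tuples d n" "j \<in> {1..d}" for \<sigma> j
      using sum.permute[OF perm_at_permutes[OF that], of "\<lambda>a. \<Sum>b=1..n. K j a b"]
        sum.permute[OF perm_at_permutes[OF that], of "\<lambda>b. K j _ b"] by (simp add: comp_def)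
    then show ?thesis by (simp add: V_def card_perm_tuples N_def)
  qed
  have rV: "(\<Sum>c=1..n. r j c) / real n = V j" for j
    by (simp add: r_def V_def sum_divide_distrib[symmetric] power2_eq_square)
  have T3: "(\<Sum>\<sigma>\<in>perm_tuples d n. \<Sum>a=1..n. \<Prod>j=1..d. (\<Sum>b=1..n. K j (perm_at \<sigma> j a) (perm_at \<sigma> j b)) / real n)
      = N * (real n * (\<Prod>j=1..d. V j))"
  proof -
    have "(\<Sum>b=1..n. K j (perm_at \<sigma> j a) (perm_at \<sigma> j b)) / real n = r j (perm_at \<sigma> j a)"
      if "\<sigma> \<in> perm_tuples d n" "j \<in> {1..d}" for \<sigma> j a
      using sum.permute[OF perm_at_permutes[OF that], of "\<lambda>b. K j (perm_at \<sigma> j a) b"]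
      by (simp add: comp_def r_def)
    then have "(\<Sum>\<sigma>\<in>perm_tuples d n. \<Sum>a=1..n. \<Prod>j=1..d. (\<Sum>b=1..n. K j (perm_at \<sigma> j a) (perm_at \<sigma> j b)) / real n)
        = (\<Sum>\<sigma>\<in>perm_tuples d n. \<Sum>a=1..n. \<Prod>j=1..d. r j (perm_at \<sigma> j a))"
      by simp
    also have "\<dots> = (\<Sum>a=1..n. \<Sum>\<sigma>\<in>perm_tuples d n. \<Prod>j=1..d. r j (perm_at \<sigma> j a))"
      by (rule sum.swap)
    also have "\<dots> = (\<Sum>a=1..n. r 1 a * (N * (\<Prod>m=1..d - 1. V (Suc m))))"
    proof (rule sum.cong[OF refl])
      fix a assume a: "a \<in> {1..n}"
      have "(\<Sum>p\<in>perms n. r j (p a)) = fact n * V j" for j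
        using sum_perms_point[OF a, of "r j"] unfolding rV .
      then show "(\<Sum>\<sigma>\<in>perm_tuples d n. \<Prod>j=1..d. r j (perm_at \<sigma> j a)) = r 1 a * (N * (\<Prod>m=1..d - 1. V (Suc m)))"
        using sum_perm_tuples_prod[OF d, of "\<lambda>j p. r j (p a)" n] by (simp add: N_prod[simplified])
    qed
    also have "\<dots> = (\<Sum>a=1..n. r 1 a) * (N * (\<Prod>m=1..d - 1. V (Suc m)))"
      by (simp add: sum_distrib_right)
    also have "(\<Sum>a=1..n. r 1 a) = real n * V 1" using rV[of 1] n by (simp add: field_simps)
    finally show ?thesis using prod_from_1[OF d, of V] by simp
  qed
  have off_abs: "\<bar>\<Sum>a=1..n. \<Sum>b\<in>{1..n} - {a}. K j a b\<bar> \<le> real n * (real n - 1) * \<kappa>" if "j \<in> {1..d}" for j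
  proof -
    have "\<bar>\<Sum>b\<in>{1..n} - {a}. K j a b\<bar> \<le> (real n - 1) * \<kappa>" if "a \<in> {1..n}" for a
      using sum_norm_bound[of "{1..n} - {a}" "\<lambda>b. K j a b" \<kappa>] bd \<open>j \<in> {1..d}\<close> that n
      by (simp add: of_nat_diff)
    then show ?thesis using abs_sum_le[of n "\<lambda>a. \<Sum>b\<in>{1..n} - {a}. K j a b"] by (simp add: mult.assoc)
  qed
  have U_abs: "\<bar>U j\<bar> \<le> \<kappa>" if "j \<in> {1..d}" for j
    using off_abs[OF that] n unfolding U_def off_diag_mean_def
    by (simp add: abs_divide abs_mult divide_le_eq mult.commute)
  have V_abs: "\<bar>V j\<bar> \<le> \<kappa>" if "j \<in> {1..d}" for j
  proof -
    have "\<bar>\<Sum>a=1..n. \<Sum>b=1..n. K j a b\<bar> \<le> real n * (real n * \<kappa>)"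
      using bd that by (intro abs_sum_le) auto
    then show ?thesis using n unfolding V_def
      by (simp add: abs_divide divide_le_eq power2_eq_square mult.commute mult.left_commute)
  qed
  \<comment> \<open>Splitting off the diagonal gives
    \<open>n^2 * V j = trace + n * (n - 1) * U j\<close>. Hence \<open>n^2 * (U j - V j)\<close> is
    \<open>n * U j\<close> minus the trace, and each of these is at most \<open>n * \<kappa>\<close>
    in absolute value.\<close>
  have UV: "\<bar>U j - V j\<bar> \<le> 2 * \<kappa> / real n" if j: "j \<in> {1..d}" for j
  proof -
    have "(\<Sum>a=1..n. \<Sum>b=1..n. K j a b) = (\<Sum>a=1..n. K j a a + (\<Sum>b\<in>{1..n} - {a}. K j a b))"
      by (intro sum.cong refl sum.remove) auto
    also have "\<dots> = (\<Sum>a=1..n. K j a a) + real n * (real n - 1) * U j"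
      using n by (simp add: sum.distrib U_def off_diag_mean_def)
    finally have "V j = ((\<Sum>a=1..n. K j a a) + real n * (real n - 1) * U j) / (real n)\<^sup>2"
      by (simp add: V_def)
    then have "(U j - V j) * (real n * real n) = real n * U j - (\<Sum>a=1..n. K j a a)"
      using n by (simp add: field_simps power2_eq_square)
    moreover have "\<bar>real n * U j - (\<Sum>a=1..n. K j a a)\<bar> \<le> \<bar>real n * U j\<bar> + \<bar>\<Sum>a=1..n. K j a a\<bar>"
      by linarith
    moreover have "\<bar>real n * U j\<bar> \<le> real n * \<kappa>"
      using U_abs[OF j] by (simp add: abs_mult mult_left_mono)
    moreover have "\<bar>\<Sum>a=1..n. K j a a\<bar> \<le> real n * \<kappa>" using bd j by (intro abs_sum_le) auto
    ultimately have "\<bar>(U j - V j) * (real n * real n)\<bar> \<le> 2 * (real n * \<kappa>)" by linarith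
    then have "\<bar>U j - V j\<bar> * real n * real n \<le> 2 * \<kappa> * real n" by (simp add: abs_mult mult.assoc mult.commute[of "real n" \<kappa>])
    then show ?thesis using n by (simp add: field_simps)
  qed
  have prod_diff: "\<bar>(\<Prod>j=1..d. U j) - (\<Prod>j=1..d. V j)\<bar> \<le> \<kappa> ^ d * (real d * (2 * \<kappa> / real n))"
  proof -
    have "\<bar>(\<Prod>j=1..d. U j) - (\<Prod>j=1..d. V j)\<bar> \<le> \<kappa> ^ card {1..d} * (\<Sum>j=1..d. \<bar>U j - V j\<bar>)"
      using \<kappa> U_abs V_abs by (intro prod_diff_le) auto
    also have "\<dots> \<le> \<kappa> ^ card {1..d} * (real d * (2 * \<kappa> / real n))"
      using \<kappa> UV sum_bounded_above[of "{1..d}" "\<lambda>j. \<bar>U j - V j\<bar>" "2 * \<kappa> / real n"]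
      by (intro mult_left_mono) auto
    finally show ?thesis by simp
  qed
  have U_prod: "\<bar>\<Prod>j=1..d. U j\<bar> \<le> \<kappa> ^ d"
    using abs_prod_le[of "{1..d}" U \<kappa>] U_abs by simp
  have n0: "real n > 0" using n by simp
  have "(\<Sum>\<sigma>\<in>perm_tuples d n. gram_stat d n (\<lambda>j a b. K j (perm_at \<sigma> j a) (perm_at \<sigma> j b)))
      \<le> N * (real n * \<kappa> ^ d + real n * (real n - 1) * (\<Prod>j=1..d. U j)) / (real n)\<^sup>2
        + N * (\<Prod>j=1..d. V j) - 2 * (N * (real n * (\<Prod>j=1..d. V j)) / real n)"
    unfolding gram_stat_def sum.distrib sum_subtractf sum_divide_distrib[symmetric]
      sum_distrib_left[symmetric] T2 T3
    using T1 n0 by (simp add: divide_right_mono)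
  also have "\<dots> = N * (\<kappa> ^ d / real n + ((\<Prod>j=1..d. U j) - (\<Prod>j=1..d. V j)) - (\<Prod>j=1..d. U j) / real n)"
    using n0 by (simp add: field_simps power2_eq_square)
  \<comment> \<open>The summand \<open>2 * d\<close> comes from the difference of the products, with
    at most \<open>2 * \<kappa> / n\<close> for each coordinate; the summand 2 covers the diagonal
    and the product of the \<open>U j\<close> over \<open>n\<close>.\<close>
  also have "\<dots> \<le> N * ((2 * real d + 2) * \<kappa> ^ (d + 1) / real n)"
  proof (rule mult_left_mono)
    have "- (\<Prod>j=1..d. U j) / real n \<le> \<kappa> ^ d / real n"
      using U_prod n0 by (intro divide_right_mono) auto
    moreover have "\<kappa> ^ d \<le> \<kappa> ^ (d + 1)" using \<kappa> by (intro power_increasing) auto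
    then have "\<kappa> ^ d / real n \<le> \<kappa> ^ (d + 1) / real n" using n0 by (intro divide_right_mono) auto
    moreover have "\<kappa> ^ d * (real d * (2 * \<kappa> / real n)) = 2 * real d * (\<kappa> ^ (d + 1) / real n)"
      by simp
    moreover have "(2 * real d + 2) * \<kappa> ^ (d + 1) / real n
        = 2 * real d * (\<kappa> ^ (d + 1) / real n) + 2 * (\<kappa> ^ (d + 1) / real n)"
      by (simp add: add_divide_distrib distrib_right)
    ultimately show "\<kappa> ^ d / real n + ((\<Prod>j=1..d. U j) - (\<Prod>j=1..d. V j)) - (\<Prod>j=1..d. U j) / real n
        \<le> (2 * real d + 2) * \<kappa> ^ (d + 1) / real n"
      using prod_diff by linarith
  qed (use N0 in simp)
  finally show ?thesis unfolding N_def .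
qed

section \<open>Borel measures on metric spaces\<close>

lemma openin_mtopology_of_subset: "openin (mtopology_of S) U \<Longrightarrow> U \<subseteq> mspace S"
  using openin_subset[of "mtopology_of S" U] by simp

lemma space_metric_borel [simp]: "space (metric_borel S) = mspace S"
  unfolding metric_borel_def by (rule space_measure_of) (auto dest: openin_mtopology_of_subset)

lemma open_in_metric_borel: "openin (mtopology_of S) U \<Longrightarrow> U \<in> sets (metric_borel S)"
  unfolding metric_borel_def using openin_mtopology_of_subset by (subst sets_measure_of) auto

lemma closed_in_metric_borel:
  assumes "closedin (mtopology_of S) A"
  shows "A \<in> sets (metric_borel S)"
proof -
  have "mspace S - (mspace S - A) \<in> sets (metric_borel S)"
    using assms open_in_metric_borel[of S "mspace S - A"] sets.compl_sets[of "mspace S - A" "metric_borel S"]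
    by (auto simp: closedin_def)
  moreover have "A \<subseteq> mspace S" using closedin_subset[OF assms] by simp
  ultimately show ?thesis by (simp add: double_diff)
qed

lemma Hausdorff_mtopology_of: "Hausdorff_space (mtopology_of S)"
  unfolding mtopology_of_def by (rule Metric_space.Hausdorff_space_mtopology) simp

lemma compact_in_metric_borel: "compactin (mtopology_of S) A \<Longrightarrow> A \<in> sets (metric_borel S)"
  by (intro closed_in_metric_borel compactin_imp_closedin Hausdorff_mtopology_of)

lemma sing_in_metric_borel: "x \<in> mspace S \<Longrightarrow> {x} \<in> sets (metric_borel S)"
  by (intro compact_in_metric_borel) simp

lemma ball_in_metric_borel:
  assumes "x \<in> mspace S"
  shows "{y \<in> mspace S. mdist S x y < e} \<in> sets (metric_borel S)"
proof -
  have "{y \<in> mspace S. mdist S x y < e} = Metric_space.mball (mspace S) (mdist S) x e"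
    using assms Metric_space.in_mball[of "mspace S" "mdist S"] by auto
  then show ?thesis
    using open_in_metric_borel[of S] Metric_space.openin_mball[of "mspace S" "mdist S"]
    by (simp add: mtopology_of_def)
qed

lemma continuous_map_borel_measurable:
  assumes "continuous_map (mtopology_of S) euclideanreal f"
  shows "f \<in> borel_measurable (metric_borel S)"
proof (rule borel_measurableI)
  fix U :: "real set" assume "open U"
  then have "openin (mtopology_of S) {x \<in> mspace S. f x \<in> U}"
    using assms unfolding continuous_map_def by auto
  moreover have "f -` U \<inter> space (metric_borel S) = {x \<in> mspace S. f x \<in> U}" by auto
  ultimately show "f -` U \<inter> space (metric_borel S) \<in> sets (metric_borel S)"
    by (simp add: open_in_metric_borel)
qed

text \<open>On the compact set where \<open>\<bar>f x\<bar> \<ge> 1\<close> continuity gives a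
  bound; elsewhere 1 is one.\<close>

lemma C0_functions_bounded:
  assumes "f \<in> C0_functions T"
  shows "\<exists>b. \<forall>x\<in>topspace T. \<bar>f x\<bar> \<le> b"
proof -
  have "compactin T {x \<in> topspace T. \<bar>f x\<bar> \<ge> 1}" "continuous_map T euclideanreal f"
    using assms unfolding C0_functions_def by auto
  then have "compactin euclideanreal (f ` {x \<in> topspace T. \<bar>f x\<bar> \<ge> 1})"
    by (rule image_compactin)
  then have "bounded (f ` {x \<in> topspace T. \<bar>f x\<bar> \<ge> 1})"
    by (simp add: compact_imp_bounded)
  then obtain b where b: "\<forall>x\<in>{x \<in> topspace T. \<bar>f x\<bar> \<ge> 1}. \<bar>f x\<bar> \<le> b"
    unfolding bounded_iff by auto
  have "\<bar>f x\<bar> \<le> max 1 b" if "x \<in> topspace T" for x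
    using b that by (cases "\<bar>f x\<bar> \<ge> 1") auto
  then show ?thesis by blast
qed

text \<open>The points where \<open>f\<close> does not vanish form a countable union of the compact
  sets where \<open>\<bar>f x\<bar> \<ge> 1 / Suc n\<close>, all of which are null.\<close>

lemma C0_functions_integral_zero:
  assumes f: "f \<in> C0_functions (mtopology_of S)" and P: "sets P = sets (metric_borel S)"
    and null: "\<And>K. compactin (mtopology_of S) K \<Longrightarrow> emeasure P K = 0"
  shows "(\<integral>x. f x \<partial>P) = 0"
proof -
  have sp: "space P = mspace S" using sets_eq_imp_space_eq[OF P] by simp
  have "{x \<in> mspace S. \<bar>f x\<bar> \<ge> 1 / Suc n} \<in> null_sets P" for n
    using f null compact_in_metric_borel[of S] P unfolding C0_functions_def by (auto intro!: null_setsI)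
  then have "(\<Union>n. {x \<in> mspace S. \<bar>f x\<bar> \<ge> 1 / Suc n}) \<in> null_sets P" by (rule null_sets_UN)
  then have "AE x in P. f x = 0"
  proof (rule AE_I')
    have "\<exists>n. \<bar>f x\<bar> \<ge> 1 / Suc n" if "f x \<noteq> 0" for x
      using reals_Archimedean[of "\<bar>f x\<bar>"] that by (auto simp: inverse_eq_divide intro: less_imp_le)
    then show "{x \<in> space P. \<not> f x = 0} \<subseteq> (\<Union>n. {x \<in> mspace S. \<bar>f x\<bar> \<ge> 1 / Suc n})"
      by (auto simp: sp)
  qed
  then show ?thesis by (rule integral_eq_zero_AE)
qed

text \<open>Exhaustion: compact sets whose probabilities approach the supremum have a union
  \<open>F\<close> beyond which no compact set has mass. If the complement of \<open>F\<close> still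
  has mass, conditioning on it gives \<open>Q\<close>. Such a case is conceivable for a diffuse
  measure on all subsets of a very large discrete space.\<close>

lemma sigma_compact_or_compact_null:
  assumes "prob_space P" and P: "sets P = sets (metric_borel S)"
  obtains (concentrated) K :: "nat \<Rightarrow> 'a set" where "\<And>n. compactin (mtopology_of S) (K n)" "AE x in P. x \<in> (\<Union>n. K n)"
  | (escaping) Q where "prob_space Q" "sets Q = sets (metric_borel S)"
      "\<And>K. compactin (mtopology_of S) K \<Longrightarrow> emeasure Q K = 0"
proof -
  interpret prob_space P by fact
  have cs: "K \<in> sets P" if "compactin (mtopology_of S) K" for K
    using compact_in_metric_borel[OF that] P by simp
  define \<K> where "\<K> = {K. compactin (mtopology_of S) K}"
  define s where "s = (SUP K\<in>\<K>. prob K)"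
  have bdd: "bdd_above (prob ` \<K>)" by (intro bdd_aboveI[of _ 1]) auto
  have ne: "{} \<in> \<K>" by (simp add: \<K>_def)
  have "\<exists>K\<in>\<K>. prob K > s - 1 / Suc n" for n :: nat
    using less_cSUP_iff[of \<K> prob "s - 1 / Suc n"] bdd ne unfolding s_def[symmetric] by auto
  then obtain K where K: "\<And>n. K n \<in> \<K>" "\<And>n. prob (K n) > s - 1 / Suc n" by metis
  define F where "F = (\<Union>n. K n)"
  have F: "F \<in> sets P" unfolding F_def using K(1) cs by (auto simp: \<K>_def)
  have null: "prob (L - F) = 0" if L: "L \<in> \<K>" for L
  proof -
    \<comment> \<open>\<open>L \<union> K n\<close> is again compact, so it has mass at most
      \<open>s\<close>, and \<open>K n\<close> alone already takes more than
      \<open>s - 1 / Suc n\<close>.\<close>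
    have le: "prob (L - F) \<le> 1 / Suc n" for n
    proof -
      have "L \<union> K n \<in> \<K>" using L K(1) by (auto simp: \<K>_def compactin_Un)
      then have "prob (L \<union> K n) \<le> s" unfolding s_def by (rule cSUP_upper[OF _ bdd])
      moreover have "L \<union> K n = K n \<union> (L - K n)" by auto
      moreover have "prob (K n \<union> (L - K n)) = prob (K n) + prob (L - K n)"
        using L K(1) cs by (intro finite_measure_Union) (auto simp: \<K>_def)
      moreover have "prob (L - F) \<le> prob (L - K n)"
        using L K(1) cs by (intro finite_measure_mono) (auto simp: \<K>_def F_def)
      ultimately show ?thesis using K(2)[of n] by simp
    qed
    have "prob (L - F) \<le> 0"
    proof (rule field_le_epsilon)
      fix e :: real assume "e > 0"
      then obtain n where "1 / Suc n < e" using reals_Archimedean[of e] by (auto simp: inverse_eq_divide)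
      then show "prob (L - F) \<le> 0 + e" using le[of n] by simp
    qed
    then show ?thesis by (simp add: measure_le_0_iff)
  qed
  show ?thesis
  proof (cases "prob (space P - F) = 0")
    case True
    then have "AE x in P. x \<in> F"
      using F by (intro AE_I[of _ _ "space P - F"]) (auto simp: emeasure_eq_measure)
    then show ?thesis using concentrated[of K] K(1) unfolding F_def \<K>_def by blast
  next
    case False
    show ?thesis
    proof (rule escaping[of "uniform_measure P (space P - F)"])
      show "prob_space (uniform_measure P (space P - F))"
        using False F by (intro prob_space_uniform_measure) (auto simp: emeasure_eq_measure)
      show "sets (uniform_measure P (space P - F)) = sets (metric_borel S)" using P by simp
      fix L assume L: "compactin (mtopology_of S) L"
      have "(space P - F) \<inter> L = L - F" using sets.sets_into_space[OF cs[OF L]] by auto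
      then show "emeasure (uniform_measure P (space P - F)) L = 0"
        using null[of L] L cs[OF L] F by (simp add: \<K>_def emeasure_eq_measure)
    qed
  qed
qed

text \<open>Compact sets are totally bounded; finite nets of every \<open>K n\<close> at all scales
  \<open>1 / Suc m\<close> together form the countable set.\<close>

lemma sigma_compact_separable:
  assumes "\<And>n::nat. compactin (mtopology_of S) (K n)"
  obtains A where "countable A" "A \<subseteq> mspace S"
    "\<And>x e. x \<in> (\<Union>n. K n) \<Longrightarrow> e > 0 \<Longrightarrow> \<exists>a\<in>A. mdist S a x < e"
proof -
  interpret Metric_space "mspace S" "mdist S" by simp
  have "\<exists>A. finite A \<and> A \<subseteq> K n \<and> K n \<subseteq> (\<Union>x\<in>A. mball x (1 / Suc m))" for n m
    using compactin_imp_mtotally_bounded[of "K n"] assms[of n]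
    unfolding mtotally_bounded_def mtopology_of_def by simp
  then obtain A where A: "\<And>n m. finite (A n m)" "\<And>n m. A n m \<subseteq> K n"
    "\<And>n m. K n \<subseteq> (\<Union>x\<in>A n m. mball x (1 / Suc m))" by metis
  show ?thesis
  proof (rule that[of "\<Union>n m. A n m"])
    show "countable (\<Union>n m. A n m)" using A(1) by (intro countable_UN) (auto intro: countable_finite)
    have "K n \<subseteq> mspace S" for n using compactin_subset_topspace[OF assms[of n]] by simp
    then show "(\<Union>n m. A n m) \<subseteq> mspace S" using A(2) by blast
    fix x e assume "x \<in> (\<Union>n. K n)" "(e :: real) > 0"
    then obtain n m where "x \<in> K n" "1 / Suc m < e"
      using reals_Archimedean[of e] by (auto simp: inverse_eq_divide)
    then obtain a where "a \<in> A n m" "mdist S a x < e" using A(3)[of n m] by force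
    then show "\<exists>a\<in>\<Union>n m. A n m. mdist S a x < e" by blast
  qed
qed

text \<open>On a non-separable space a continuous kernel need not be measurable for the product of the
  Borel sigma-algebras, so the first argument is confined to a sigma-compact set.\<close>

lemma measurable_kernel_restrict:
  assumes K: "\<And>n::nat. compactin (mtopology_of S) (K n)"
    and k1: "\<And>y. y \<in> mspace S \<Longrightarrow> continuous_map (mtopology_of S) euclideanreal (\<lambda>x. k x y)"
    and k2: "\<And>x. x \<in> mspace S \<Longrightarrow> k x \<in> borel_measurable (metric_borel S)"
  shows "(\<lambda>(x, y). if x \<in> (\<Union>n. K n) then k x y else (0::real))
    \<in> borel_measurable (metric_borel S \<Otimes>\<^sub>M metric_borel S)"
proof (cases "(\<Union>n. K n) = {}")
  case True
  then show ?thesis by simp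
next
  case False
  interpret Metric_space "mspace S" "mdist S" by simp
  obtain A where A: "countable A" "A \<subseteq> mspace S"
    "\<And>x e. x \<in> (\<Union>n. K n) \<Longrightarrow> e > 0 \<Longrightarrow> \<exists>a\<in>A. mdist S a x < e"
    using sigma_compact_separable[of S K] K by blast
  have "A \<noteq> {}" using False A(3)[of _ 1] by fastforce
  then have rA: "range (from_nat_into A) = A" using A(1) by (rule range_from_nat_into)
  define q where "q = from_nat_into A"
  have q: "q i \<in> mspace S" for i using rA A(2) unfolding q_def by blast
  have Kb: "(\<Union>n. K n) \<in> sets (metric_borel S)" using compact_in_metric_borel[OF K] by blast
  \<comment> \<open>A measurable choice of a nearby point: the first member of the countable dense
    set within \<open>1 / Suc m\<close> of \<open>x\<close>. If there is none, the value of
    \<open>LEAST\<close> is arbitrary, but this does not happen on the union of the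
    \<open>K n\<close>.\<close>
  define g where "g m = (\<lambda>x. LEAST i. mdist S (q i) x < 1 / Suc m)" for m
  have g_meas: "g m \<in> metric_borel S \<rightarrow>\<^sub>M count_space UNIV" for m
    unfolding g_def
  proof (rule measurable_Least)
    fix i show "Measurable.pred (metric_borel S) (\<lambda>x. mdist S (q i) x < 1 / Suc m)"
      using ball_in_metric_borel[OF q, of i] by (simp add: pred_def)
  qed
  \<comment> \<open>After the replacement of \<open>x\<close> by the chosen point only countably
    many sections of \<open>k\<close> occur, which makes \<open>h m\<close> jointly measurable.
    Continuity in the first argument gives convergence to the restricted kernel.\<close>
  define h where "h m = (\<lambda>(x, y). if x \<in> (\<Union>n. K n) then k (q (g m x)) y else 0)" for m
  show ?thesis
  proof (rule borel_measurable_LIMSEQ_real)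
    show "h m \<in> borel_measurable (metric_borel S \<Otimes>\<^sub>M metric_borel S)" for m
    proof -
      have "(\<lambda>z. k (q (g m (fst z))) (snd z)) \<in> borel_measurable (metric_borel S \<Otimes>\<^sub>M metric_borel S)"
      proof (rule measurable_compose_countable[where g="\<lambda>z. g m (fst z)"])
        show "(\<lambda>z. k (q i) (snd z)) \<in> borel_measurable (metric_borel S \<Otimes>\<^sub>M metric_borel S)" for i
          by (rule measurable_compose[OF measurable_snd k2[OF q]])
        show "(\<lambda>z. g m (fst z)) \<in> metric_borel S \<Otimes>\<^sub>M metric_borel S \<rightarrow>\<^sub>M count_space UNIV"
          by (rule measurable_compose[OF measurable_fst g_meas])
      qed
      moreover have "{z \<in> space (metric_borel S \<Otimes>\<^sub>M metric_borel S). fst z \<in> (\<Union>n. K n)}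
          \<in> sets (metric_borel S \<Otimes>\<^sub>M metric_borel S)"
        using measurable_sets[OF measurable_fst Kb, of "metric_borel S"]
        by (simp only: vimage_def Int_def mem_Collect_eq conj_commute)
      ultimately show ?thesis
        unfolding h_def case_prod_beta by (intro measurable_If) auto
    qed
    fix z assume z: "z \<in> space (metric_borel S \<Otimes>\<^sub>M metric_borel S)"
    obtain x y where zxy: "z = (x, y)" "x \<in> mspace S" "y \<in> mspace S" using z by (auto simp: space_pair_measure)
    show "(\<lambda>m. h m z) \<longlonglongrightarrow> (case z of (x, y) \<Rightarrow> if x \<in> (\<Union>n. K n) then k x y else 0)"
    proof (cases "x \<in> (\<Union>n. K n)")
      case True
      have "mdist S (q (g m x)) x < 1 / Suc m" for m
      proof -
        have "\<exists>i. mdist S (q i) x < 1 / Suc m"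
          using A(3)[OF True, of "1 / Suc m"] rA unfolding q_def by (metis divide_pos_pos of_nat_0_less_iff rangeE zero_less_Suc zero_less_one)
        then show ?thesis unfolding g_def by (rule LeastI_ex)
      qed
      then have d0: "(\<lambda>m. mdist S (q (g m x)) x) \<longlonglongrightarrow> 0"
        by (intro tendsto_sandwich[OF _ _ tendsto_const LIMSEQ_Suc[OF lim_1_over_n]])
          (auto intro!: always_eventually less_imp_le)
      have "limitin mtopology (\<lambda>m. q (g m x)) x sequentially"
        unfolding limit_metric_sequentially
      proof (intro conjI allI impI)
        fix e :: real assume "e > 0"
        then have "\<forall>\<^sub>F m in sequentially. mdist S (q (g m x)) x < e" using d0 by (intro order_tendstoD)
        then show "\<exists>N. \<forall>m\<ge>N. q (g m x) \<in> mspace S \<and> mdist S (q (g m x)) x < e"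
          using q unfolding eventually_sequentially by blast
      qed (use zxy in simp)
      then have "limitin euclideanreal ((\<lambda>x. k x y) \<circ> (\<lambda>m. q (g m x))) (k x y) sequentially"
        using continuous_map_limit[OF k1[OF zxy(3)]] by (simp add: mtopology_of_def)
      then show ?thesis using True by (simp add: zxy h_def comp_def)
    qed (simp add: zxy h_def)
  qed
qed

section \<open>Marginals under a characteristic kernel\<close>

text \<open>The kernel section at \<open>x\<close> serves twice: as a test function for the
  embedding and, through the reproducing property, to evaluate \<mu> at \<open>x\<close>. This turns
  abstract embeddings into explicit functions.\<close>

lemma mean_embedding_eval:
  assumes rk: "is_rkhs E k H ip" and P: "space P = E" and \<mu>: "is_mean_embedding H ip P \<mu>" and x: "x \<in> E"
  shows "integrable P (k x)" "\<mu> x = (\<integral>y. k x y \<partial>P)"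
proof -
  have s: "kernel_section E k x \<in> H" using rkhs_section[OF rk x] .
  have i: "integrable P (kernel_section E k x)"
    and e: "(\<integral>y. kernel_section E k x y \<partial>P) = ip (kernel_section E k x) \<mu>"
    using \<mu> s unfolding is_mean_embedding_def by blast+
  have eq: "kernel_section E k x y = k x y" if "y \<in> space P" for y
    using that P by (simp add: kernel_section_def)
  have "integrable P (k x) \<longleftrightarrow> integrable P (kernel_section E k x)"
    by (rule Bochner_Integration.integrable_cong[OF refl]) (simp add: eq)
  then show "integrable P (k x)" using i by simp
  have "\<mu> \<in> H" using \<mu> unfolding is_mean_embedding_def by blast
  then have "\<mu> x = ip (kernel_section E k x) \<mu>"
    using rkhs_eval[OF rk _ x] fhs_commute[OF rkhs_fhs[OF rk] _ s] by simp
  also have "\<dots> = (\<integral>y. k x y \<partial>P)"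
    unfolding e[symmetric] by (rule Bochner_Integration.integral_cong[OF refl eq])
  finally show "\<mu> x = (\<integral>y. k x y \<partial>P)" .
qed

lemma c0_universal_rkhs:
  assumes "c0_universal S k"
  obtains H ip where "is_rkhs (mspace S) k H ip" "H \<subseteq> C0_functions (mtopology_of S)"
  using assms unfolding c0_universal_def by blast

lemma c0_universal_section_C0:
  assumes "c0_universal S k" "x \<in> mspace S"
  shows "kernel_section (mspace S) k x \<in> C0_functions (mtopology_of S)"
proof -
  obtain H ip where "is_rkhs (mspace S) k H ip" "H \<subseteq> C0_functions (mtopology_of S)"
    using c0_universal_rkhs[OF assms(1)] .
  then show ?thesis using rkhs_section[of "mspace S" k H ip x] assms(2) by blast
qed

lemma c0_universal_commute:
  assumes "c0_universal S k" "x \<in> mspace S" "y \<in> mspace S"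
  shows "k x y = k y x"
proof -
  obtain H ip where "is_rkhs (mspace S) k H ip" using c0_universal_rkhs[OF assms(1)] .
  then show ?thesis using rkhs_commute[of "mspace S" k H ip x y] assms(2,3) by blast
qed

lemma c0_universal_continuous:
  assumes "c0_universal S k" "x \<in> mspace S"
  shows "continuous_map (mtopology_of S) euclideanreal (k x)"
proof (rule continuous_map_eq)
  show "continuous_map (mtopology_of S) euclideanreal (kernel_section (mspace S) k x)"
    using c0_universal_section_C0[OF assms] unfolding C0_functions_def by blast
qed (simp add: kernel_section_def)

lemma c0_universal_bounded:
  assumes "c0_universal S k"
  shows "\<exists>b. \<forall>x\<in>mspace S. \<forall>y\<in>mspace S. \<bar>k x y\<bar> \<le> b"
proof -
  obtain H ip where rk: "is_rkhs (mspace S) k H ip" and H: "H \<subseteq> C0_functions (mtopology_of S)"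
    using c0_universal_rkhs[OF assms] .
  have "\<exists>b. \<forall>x\<in>mspace S. \<bar>f x\<bar> \<le> b" if "f \<in> H" for f
    using C0_functions_bounded[of f "mtopology_of S"] H that by auto
  then show ?thesis by (rule rkhs_kernel_bounded[OF rk])
qed

lemma space_prod_borel: "space (prod_borel d S) = (\<Pi>\<^sub>E j\<in>{1..d}. mspace (S j))"
  by (simp add: prod_borel_def space_PiM)

text \<open>A probability measure \<open>Q\<close> on one factor that charges no compact set integrates every
  function of that factor's RKHS to zero, so all measures \<open>Q \<otimes> \<delta>\<^sub>y\<close> embed to zero and a
  characteristic kernel cannot tell them apart.\<close>

lemma characteristic_no_escape:
  assumes char: "characteristic_kernel (prod_borel d S) (tensor_kernel d k)"
    and c0: "\<And>j. j \<in> {1..d} \<Longrightarrow> c0_universal (S j) (k j)"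
    and j: "j \<in> {1..d}" and i: "i \<in> {1..d}" "i \<noteq> j"
    and y: "y \<in> space (prod_borel d S)" and y': "y' \<in> space (prod_borel d S)" and ne: "y i \<noteq> y' i"
    and Q: "prob_space Q" "sets Q = sets (metric_borel (S j))"
    and null: "\<And>K. compactin (mtopology_of (S j)) K \<Longrightarrow> emeasure Q K = 0"
  shows False
proof -
  let ?N = "prod_borel d S"
  interpret Q: prob_space Q by fact
  have sQ: "space Q = mspace (S j)" using sets_eq_imp_space_eq[OF Q(2)] by simp
  obtain H ip where rk: "is_rkhs (space ?N) (tensor_kernel d k) H ip"
    and ex: "\<forall>P. prob_space P \<and> sets P = sets ?N \<longrightarrow> (\<exists>\<mu>. is_mean_embedding H ip P \<mu>)"
    and inj: "\<forall>P Q \<mu> \<nu>. prob_space P \<and> sets P = sets ?N \<and> prob_space Q \<and> sets Q = sets ?N \<and>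
           is_mean_embedding H ip P \<mu> \<and> is_mean_embedding H ip Q \<nu> \<longrightarrow>
           (ip_norm ip (\<lambda>x. \<mu> x - \<nu> x) = 0 \<longleftrightarrow> P = Q)"
    using char unfolding characteristic_kernel_def by (elim exE conjE) (rule that)
  \<comment> \<open>\<open>R u\<close> is the product of \<open>Q\<close> on coordinate
    \<open>j\<close> with the point masses at the other coordinates of \<open>u\<close>.\<close>
  define R where "R u = distr Q ?N (\<lambda>x. u(j := x))" for u
  have meas: "(\<lambda>x. u(j := x)) \<in> Q \<rightarrow>\<^sub>M ?N" if u: "u \<in> space ?N" for u
    unfolding prod_borel_def
  proof (rule measurable_PiM_single')
    fix m assume "m \<in> {1..d}"
    then show "(\<lambda>x. (u(j := x)) m) \<in> Q \<rightarrow>\<^sub>M metric_borel (S m)"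
      using PiE_mem[OF u[unfolded space_prod_borel], of m] measurable_ident_sets[OF Q(2)]
      by (cases "m = j") auto
  next
    show "(\<lambda>x m. (u(j := x)) m) \<in> space Q \<rightarrow> (\<Pi>\<^sub>E m\<in>{1..d}. space (metric_borel (S m)))"
      using u j by (auto simp: space_prod_borel sQ PiE_iff extensional_def)
  qed
  have pR: "prob_space (R u)" "sets (R u) = sets ?N" if "u \<in> space ?N" for u
    unfolding R_def using Q.prob_space_distr[OF meas[OF that]] by auto
  have zero: "\<mu> = (\<lambda>z. 0)" if u: "u \<in> space ?N" and \<mu>: "is_mean_embedding H ip (R u) \<mu>" for u \<mu>
  proof
    fix z
    show "\<mu> z = 0"
    proof (cases "z \<in> space ?N")
      case True
      have sR: "space (R u) = space ?N" by (simp add: R_def)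
      have zj: "z j \<in> mspace (S j)" using True j by (auto simp: space_prod_borel)
      have "\<mu> z = (\<integral>x. tensor_kernel d k z x \<partial>R u)"
        by (rule mean_embedding_eval(2)[OF rk sR \<mu> True])
      also have "\<dots> = (\<integral>x. tensor_kernel d k z (u(j := x)) \<partial>Q)"
        using mean_embedding_eval(1)[OF rk sR \<mu> True] unfolding R_def
        by (intro integral_distr meas[OF u]) simp
      \<comment> \<open>Only factor \<open>j\<close> of the tensor kernel depends on
        \<open>x\<close>; it is a section in \<open>C0_functions\<close>, which \<open>Q\<close>
        integrates to zero.\<close>
      also have "\<dots> = (\<integral>x. (\<Prod>m\<in>{1..d} - {j}. k m (z m) (u m)) * kernel_section (mspace (S j)) (k j) (z j) x \<partial>Q)"
      proof (rule Bochner_Integration.integral_cong[OF refl])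
        fix x assume "x \<in> space Q"
        moreover have "(\<Prod>m\<in>{1..d} - {j}. k m (z m) ((u(j := x)) m)) = (\<Prod>m\<in>{1..d} - {j}. k m (z m) (u m))"
          by (intro prod.cong) auto
        ultimately show "tensor_kernel d k z (u(j := x))
            = (\<Prod>m\<in>{1..d} - {j}. k m (z m) (u m)) * kernel_section (mspace (S j)) (k j) (z j) x"
          unfolding tensor_kernel_def using prod.remove[OF _ j, of "\<lambda>m. k m (z m) ((u(j := x)) m)"]
          by (simp add: kernel_section_def sQ)
      qed
      also have "\<dots> = 0"
        using C0_functions_integral_zero[OF c0_universal_section_C0[OF c0[OF j] zj] Q(2) null] by simp
      finally show ?thesis .
    next
      case False
      then show ?thesis using \<mu> fhs_outside[OF rkhs_fhs[OF rk]] unfolding is_mean_embedding_def by blast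
    qed
  qed
  obtain \<mu> \<nu> where \<mu>: "is_mean_embedding H ip (R y) \<mu>" and \<nu>: "is_mean_embedding H ip (R y') \<nu>"
    using ex pR[OF y] pR[OF y'] by blast
  have "ip (\<lambda>x. 0) (\<lambda>x. 0) = 0"
    using fhs_ip_scale[OF rkhs_fhs[OF rk] fhs_zero[OF rkhs_fhs[OF rk]] fhs_zero[OF rkhs_fhs[OF rk]], of 0] by simp
  then have "ip_norm ip (\<lambda>x. \<mu> x - \<nu> x) = 0"
    using zero[OF y \<mu>] zero[OF y' \<nu>] by (simp add: ip_norm_def)
  then have eq: "R y = R y'" using inj[rule_format, of "R y" "R y'" \<mu> \<nu>] pR[OF y] pR[OF y'] \<mu> \<nu> by simp
  \<comment> \<open>Coordinate \<open>i\<close> is deterministic under both measures: the event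
    \<open>A\<close> has probability one under \<open>R y\<close> and zero under
    \<open>R y'\<close>.\<close>
  define A where "A = {z \<in> space ?N. z i \<in> {y i}}"
  have "y i \<in> mspace (S i)" using y i by (auto simp: space_prod_borel)
  then have "(\<lambda>z. z i) -` {y i} \<inter> space ?N \<in> sets ?N"
    unfolding prod_borel_def
    by (rule measurable_sets[OF measurable_component_singleton[OF i(1)] sing_in_metric_borel])
  moreover have "(\<lambda>z. z i) -` {y i} \<inter> space ?N = A" by (auto simp: A_def)
  ultimately have A: "A \<in> sets ?N" by simp
  have emb: "(\<lambda>x. u(j := x)) -` A \<inter> space Q = (if u i = y i then space Q else {})" if "u \<in> space ?N" for u
    using measurable_space[OF meas[OF that]] i by (auto simp: A_def)
  have "measure (R u) A = (if u i = y i then 1 else 0)" if "u \<in> space ?N" for u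
    unfolding R_def using measure_distr[OF meas[OF that] A] emb[OF that] Q.prob_space by simp
  from this[OF y] this[OF y'] show False using eq ne by simp
qed

text \<open>A coordinate confined to at most one value is independent of everything, so with only
  coordinate \<open>j\<close> free the joint law is a product.\<close>

lemma distr_eq_PiM_of_const:
  assumes "prob_space M" and X: "X \<in> M \<rightarrow>\<^sub>M PiM I N" and I: "finite I" and j: "j \<in> I"
    and const: "\<And>i y y'. i \<in> I \<Longrightarrow> i \<noteq> j \<Longrightarrow> y \<in> space (PiM I N) \<Longrightarrow> y' \<in> space (PiM I N) \<Longrightarrow> y i = y' i"
  shows "distr M (PiM I N) X = PiM I (\<lambda>i. distr M (N i) (\<lambda>\<omega>. X \<omega> i))"
proof -
  interpret prM: prob_space M by fact
  have Xi: "(\<lambda>\<omega>. X \<omega> i) \<in> M \<rightarrow>\<^sub>M N i" if "i \<in> I" for i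
    using measurable_compose[OF X measurable_component_singleton[OF that]] .
  \<comment> \<open>\<open>product_prob_space\<close> needs a probability measure at every index;
    outside \<open>I\<close> the counting measure on one point serves as a default.\<close>
  define L where "L i = (if i \<in> I then distr M (N i) (\<lambda>\<omega>. X \<omega> i) else count_space {undefined})" for i
  have pL: "prob_space (L i)" for i
    using prM.prob_space_distr[OF Xi, of i] by (cases "i \<in> I") (simp_all add: L_def prob_spaceI)
  interpret L: product_prob_space L UNIV
    by (intro product_prob_spaceI pL)
  have sL: "sets (PiM I L) = sets (PiM I N)" by (intro sets_PiM_cong) (auto simp: L_def)
  have "distr M (PiM I N) X = PiM I L"
  proof (rule L.PiM_eqI[OF I])
    show "sets (distr M (PiM I N) X) = sets (PiM I L)" by (simp add: sL)
    fix A assume A': "\<And>i. i \<in> I \<Longrightarrow> A i \<in> sets (L i)"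
    have A: "A i \<in> sets (N i)" if "i \<in> I" for i using A'[OF that] that by (simp add: L_def)
    have AE: "Pi\<^sub>E I A \<in> sets (PiM I N)" by (rule sets_PiM_I_finite[OF I A])
    have L_A: "emeasure (L i) (A i) = emeasure M ((\<lambda>\<omega>. X \<omega> i) -` A i \<inter> space M)" if "i \<in> I" for i
      using emeasure_distr[OF Xi[OF that] A[OF that]] that by (simp add: L_def)
    have XE: "X \<omega> \<in> space (PiM I N)" if "\<omega> \<in> space M" for \<omega> using measurable_space[OF X that] .
    have "emeasure M (X -` Pi\<^sub>E I A \<inter> space M) = (\<Prod>i\<in>I. emeasure (L i) (A i))"
    \<comment> \<open>A constant coordinate meets its side of the rectangle either never, and both
      sides of the equation vanish, or always, and only the condition on coordinate \<open>j\<close>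
      is left.\<close>
    proof (cases "\<exists>i\<in>I - {j}. \<forall>\<omega>\<in>space M. X \<omega> i \<notin> A i")
      case True
      then obtain i where i: "i \<in> I" "\<And>\<omega>. \<omega> \<in> space M \<Longrightarrow> X \<omega> i \<notin> A i" by blast
      then have "X -` Pi\<^sub>E I A \<inter> space M = {}" "(\<lambda>\<omega>. X \<omega> i) -` A i \<inter> space M = {}" by auto
      then show ?thesis using L_A[OF i(1)] prod_zero[OF I, of "\<lambda>i. emeasure (L i) (A i)"] i(1) by auto
    next
      case False
      then have all: "X \<omega> i \<in> A i" if "i \<in> I - {j}" "\<omega> \<in> space M" for i \<omega>
      proof -
        have "\<not> (\<forall>\<omega>\<in>space M. X \<omega> i \<notin> A i)"
          using False bexI[OF _ that(1), of "\<lambda>i. \<forall>\<omega>\<in>space M. X \<omega> i \<notin> A i"] by (rule contrapos_nn)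
        then obtain \<omega>' where "\<omega>' \<in> space M" "X \<omega>' i \<in> A i" by auto
        moreover have "X \<omega> i = X \<omega>' i"
          by (rule const[OF _ _ XE[OF that(2)] XE[OF \<open>\<omega>' \<in> space M\<close>]]) (use that(1) in auto)
        ultimately show ?thesis by simp
      qed
      have "X -` Pi\<^sub>E I A \<inter> space M = (\<lambda>\<omega>. X \<omega> j) -` A j \<inter> space M"
      proof -
        have "X \<omega> \<in> Pi\<^sub>E I A \<longleftrightarrow> X \<omega> j \<in> A j" if \<omega>: "\<omega> \<in> space M" for \<omega>
        proof
          assume "X \<omega> j \<in> A j"
          then have "X \<omega> i \<in> A i" if "i \<in> I" for i
            using all[of i \<omega>] that \<omega> \<open>X \<omega> j \<in> A j\<close> by (cases "i = j") blast+
          moreover have "X \<omega> \<in> (\<Pi>\<^sub>E i\<in>I. space (N i))" using XE[OF \<omega>] by (simp add: space_PiM)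
          ultimately show "X \<omega> \<in> Pi\<^sub>E I A" by (simp add: PiE_iff)
        qed (rule PiE_mem[OF _ j])
        then show ?thesis by blast
      qed
      then have "emeasure M (X -` Pi\<^sub>E I A \<inter> space M) = emeasure (L j) (A j)" by (simp only: L_A[OF j])
      moreover have "emeasure (L i) (A i) = 1" if "i \<in> I - {j}" for i
      proof -
        have "(\<lambda>\<omega>. X \<omega> i) -` A i \<inter> space M = space M" using all[OF that] by blast
        then show ?thesis using L_A[of i] that prM.emeasure_space_1 by (metis DiffD1)
      qed
      then have "(\<Prod>i\<in>I - {j}. emeasure (L i) (A i)) = 1" by (rule prod.neutral[OF ballI])
      ultimately show ?thesis using prod.remove[OF I j, of "\<lambda>i. emeasure (L i) (A i)"] by simp
    qed
    then show "emeasure (distr M (PiM I N) X) (Pi\<^sub>E I A) = (\<Prod>i\<in>I. emeasure (L i) (A i))"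
      by (simp add: emeasure_distr[OF X AE])
  qed
  also have "\<dots> = PiM I (\<lambda>i. distr M (N i) (\<lambda>\<omega>. X \<omega> i))" by (intro PiM_cong) (auto simp: L_def)
  finally show ?thesis .
qed

text \<open>The escaping alternative is refuted by two points that differ in a coordinate other than
  \<open>j\<close>. If no such points exist, the law of \<open>X\<close> is already the product of
  its marginals, contrary to dependence.\<close>

lemma marginal_sigma_compact:
  assumes M: "prob_space M" and X: "X \<in> M \<rightarrow>\<^sub>M prod_borel d S"
    and char: "characteristic_kernel (prod_borel d S) (tensor_kernel d k)"
    and c0: "\<And>j. j \<in> {1..d} \<Longrightarrow> c0_universal (S j) (k j)"
    and dep: "distr M (prod_borel d S) X \<noteq> (\<Pi>\<^sub>M j\<in>{1..d}. distr M (metric_borel (S j)) (\<lambda>\<omega>. X \<omega> j))"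
    and j: "j \<in> {1..d}"
  obtains K :: "nat \<Rightarrow> 'a set" where "\<And>n. compactin (mtopology_of (S j)) (K n)"
    "AE x in distr M (metric_borel (S j)) (\<lambda>\<omega>. X \<omega> j). x \<in> (\<Union>n. K n)"
proof -
  let ?P = "distr M (metric_borel (S j)) (\<lambda>\<omega>. X \<omega> j)"
  have "(\<lambda>\<omega>. X \<omega> j) \<in> M \<rightarrow>\<^sub>M metric_borel (S j)"
    using measurable_compose[OF X[unfolded prod_borel_def] measurable_component_singleton[OF j]] .
  then have P: "prob_space ?P" "sets ?P = sets (metric_borel (S j))"
    using prob_space.prob_space_distr[OF M] by auto
  have "\<exists>i y y'. i \<in> {1..d} \<and> i \<noteq> j \<and> y \<in> space (prod_borel d S) \<and> y' \<in> space (prod_borel d S) \<and> y i \<noteq> y' i"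
  proof (rule ccontr)
    assume neg: "\<not> ?thesis"
    have "distr M (prod_borel d S) X = (\<Pi>\<^sub>M j\<in>{1..d}. distr M (metric_borel (S j)) (\<lambda>\<omega>. X \<omega> j))"
      unfolding prod_borel_def
    proof (rule distr_eq_PiM_of_const[OF M X[unfolded prod_borel_def] _ j])
      show "y i = y' i" if "i \<in> {1..d}" "i \<noteq> j" "y \<in> space (\<Pi>\<^sub>M j\<in>{1..d}. metric_borel (S j))"
        "y' \<in> space (\<Pi>\<^sub>M j\<in>{1..d}. metric_borel (S j))" for i y y'
        using neg that unfolding prod_borel_def by blast
    qed simp
    then show False using dep by contradiction
  qed
  then obtain i y y' where "i \<in> {1..d}" "i \<noteq> j" "y \<in> space (prod_borel d S)" "y' \<in> space (prod_borel d S)" "y i \<noteq> y' i"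
    by (elim exE conjE) (rule that)
  note no = characteristic_no_escape[OF char c0 j this]
  show ?thesis
  proof (cases rule: sigma_compact_or_compact_null[OF P])
    case (1 K)
    then show ?thesis by (rule that)
  next
    case (2 Q)
    then show ?thesis using no by blast
  qed
qed

section \<open>Mean convergence of averages\<close>

text \<open>Fubini for the product of the two laws, pulled back to \<open>M\<close>. The inner
  integral over a fresh \<omega>' plays the role of a conditional expectation given
  \<open>U\<close>.\<close>

lemma (in prob_space) indep_var_integral_iterated:
  assumes ind: "indep_var S U T V" and F[measurable]: "F \<in> borel_measurable (S \<Otimes>\<^sub>M T)"
    and bd: "\<And>z. z \<in> space (S \<Otimes>\<^sub>M T) \<Longrightarrow> \<bar>F z :: real\<bar> \<le> c"
  shows "(\<integral>\<omega>. F (U \<omega>, V \<omega>) \<partial>M) = (\<integral>\<omega>. \<integral>\<omega>'. F (U \<omega>, V \<omega>') \<partial>M \<partial>M)"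
proof -
  have U[measurable]: "U \<in> M \<rightarrow>\<^sub>M S" and V[measurable]: "V \<in> M \<rightarrow>\<^sub>M T"
    and eq: "distr M S U \<Otimes>\<^sub>M distr M T V = distr M (S \<Otimes>\<^sub>M T) (\<lambda>\<omega>. (U \<omega>, V \<omega>))"
    using ind unfolding indep_var_distribution_eq by auto
  interpret U: prob_space "distr M S U" by (rule prob_space_distr) fact
  interpret V: prob_space "distr M T V" by (rule prob_space_distr) fact
  interpret UV: pair_prob_space "distr M S U" "distr M T V" ..
  have F': "F \<in> borel_measurable (distr M S U \<Otimes>\<^sub>M distr M T V)" by simp
  have "integrable (distr M S U \<Otimes>\<^sub>M distr M T V) F"
    using F' bd by (intro UV.integrable_const_bound[of _ c]) (auto simp: space_pair_measure)
  then have "integral\<^sup>L (distr M S U \<Otimes>\<^sub>M distr M T V) F = (\<integral>u. \<integral>v. F (u, v) \<partial>distr M T V \<partial>distr M S U)"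
    by (rule UV.integral_fst'[symmetric])
  also have "\<dots> = (\<integral>\<omega>. \<integral>v. F (U \<omega>, v) \<partial>distr M T V \<partial>M)"
    by (rule integral_distr[OF U]) measurable
  also have "\<dots> = (\<integral>\<omega>. \<integral>\<omega>'. F (U \<omega>, V \<omega>') \<partial>M \<partial>M)"
  proof (rule Bochner_Integration.integral_cong[OF refl])
    fix \<omega> assume "\<omega> \<in> space M"
    then have "U \<omega> \<in> space S" using measurable_space[OF U] by blast
    then have "(\<lambda>v. F (U \<omega>, v)) \<in> borel_measurable T" by measurable
    then show "(\<integral>v. F (U \<omega>, v) \<partial>distr M T V) = (\<integral>\<omega>'. F (U \<omega>, V \<omega>') \<partial>M)" by (rule integral_distr[OF V])
  qed
  finally show ?thesis unfolding eq by (subst (asm) integral_distr) auto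
qed

text \<open>The common law is a parameter, so that it can be given as the law of a variable outside
  the sequence.\<close>

locale iid_sequence = prob_space M for M :: "'w measure" +
  fixes N :: "'b measure" and P :: "'b measure" and Y :: "nat \<Rightarrow> 'w \<Rightarrow> 'b"
  assumes indep: "indep_vars (\<lambda>i. N) Y {1..}" and law: "\<And>i. i \<ge> 1 \<Longrightarrow> distr M N (Y i) = P"
begin

lemma measurable_Y: "i \<ge> 1 \<Longrightarrow> Y i \<in> M \<rightarrow>\<^sub>M N"
  using indep unfolding indep_vars_def by simp

lemma Y_space: "i \<ge> 1 \<Longrightarrow> \<omega> \<in> space M \<Longrightarrow> Y i \<omega> \<in> space N"
  using measurable_space[OF measurable_Y] .

lemma sets_P [measurable_cong, simp]: "sets P = sets N"
  using law[of 1] sets_distr[of M N "Y 1"] by simp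

lemma space_P [simp]: "space P = space N"
  using sets_eq_imp_space_eq[OF sets_P] .

lemma prob_space_P: "prob_space P"
  using law[of 1] prob_space_distr[OF measurable_Y[of 1]] by simp

lemma integral_Y:
  fixes f :: "'b \<Rightarrow> real"
  assumes "i \<ge> 1" "f \<in> borel_measurable N"
  shows "(\<integral>\<omega>. f (Y i \<omega>) \<partial>M) = (\<integral>x. f x \<partial>P)"
  using integral_distr[OF measurable_Y assms(2), of i] assms(1) law by simp

lemma integrable_bounded:
  fixes f :: "'w \<Rightarrow> real"
  assumes "f \<in> borel_measurable M" "\<And>\<omega>. \<omega> \<in> space M \<Longrightarrow> \<bar>f \<omega>\<bar> \<le> c"
  shows "integrable M f"
  using assms by (intro integrable_const_bound[of _ c]) auto

lemma integral_le_bound: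
  fixes f :: "'w \<Rightarrow> real"
  assumes "integrable M f" "\<And>\<omega>. \<omega> \<in> space M \<Longrightarrow> f \<omega> \<le> c"
  shows "(\<integral>\<omega>. f \<omega> \<partial>M) \<le> c"
  using integral_mono[OF assms(1), of "\<lambda>_. c"] assms(2) by (simp add: prob_space)

text \<open>For a \<noteq> b this is the conditional expectation of \<open>g (Y a, Y b)\<close>
  given \<open>Y a = x\<close>.\<close>

definition partial_mean :: "('b \<times> 'b \<Rightarrow> real) \<Rightarrow> 'b \<Rightarrow> real" where
  "partial_mean g x = (\<integral>y. g (x, y) \<partial>P)"

text \<open>For b \<noteq> a the conditional mean given \<open>Y a\<close> is zero. For b = a it
  need not be, so the orthogonality argument must get by with one fresh index.\<close>

definition resid :: "('b \<times> 'b \<Rightarrow> real) \<Rightarrow> nat \<Rightarrow> nat \<Rightarrow> 'w \<Rightarrow> real" where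
  "resid g a b \<omega> = g (Y a \<omega>, Y b \<omega>) - partial_mean g (Y a \<omega>)"

context
  fixes g :: "'b \<times> 'b \<Rightarrow> real" and c :: real
  assumes g: "g \<in> borel_measurable (N \<Otimes>\<^sub>M N)"
    and g_le: "\<And>x y. x \<in> space N \<Longrightarrow> y \<in> space N \<Longrightarrow> \<bar>g (x, y)\<bar> \<le> c"
begin

lemma measurable_partial_mean: "partial_mean g \<in> borel_measurable N"
proof -
  interpret P: prob_space P by (rule prob_space_P)
  have "g \<in> borel_measurable (N \<Otimes>\<^sub>M P)"
    using g by (simp cong: measurable_cong_sets sets_pair_measure_cong)
  then show ?thesis unfolding partial_mean_def[abs_def] by (intro P.borel_measurable_lebesgue_integral) simp
qed

lemma partial_mean_le: "x \<in> space N \<Longrightarrow> \<bar>partial_mean g x\<bar> \<le> c"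
proof -
  assume x: "x \<in> space N"
  interpret P: prob_space P by (rule prob_space_P)
  have m: "(\<lambda>y. g (x, y)) \<in> borel_measurable P"
    using measurable_compose[OF measurable_Pair1'[OF x] g] by simp
  have i: "integrable P (\<lambda>y. g (x, y))"
    using m g_le[OF x] by (intro P.integrable_const_bound[of _ c]) auto
  have "\<bar>partial_mean g x\<bar> \<le> (\<integral>y. \<bar>g (x, y)\<bar> \<partial>P)" unfolding partial_mean_def by (rule integral_abs_bound)
  also have "\<dots> \<le> (\<integral>y. c \<partial>P)"
    using i g_le[OF x] by (intro integral_mono) auto
  finally show ?thesis using P.prob_space by simp
qed

lemma measurable_g_Y: "a \<ge> 1 \<Longrightarrow> b \<ge> 1 \<Longrightarrow> (\<lambda>\<omega>. g (Y a \<omega>, Y b \<omega>)) \<in> borel_measurable M"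
  by (rule measurable_compose[OF measurable_Pair g]) (auto intro: measurable_Y)

lemma measurable_partial_mean_Y: "a \<ge> 1 \<Longrightarrow> (\<lambda>\<omega>. partial_mean g (Y a \<omega>)) \<in> borel_measurable M"
  by (rule measurable_compose[OF measurable_Y measurable_partial_mean])

lemma measurable_resid: "a \<ge> 1 \<Longrightarrow> b \<ge> 1 \<Longrightarrow> resid g a b \<in> borel_measurable M"
  unfolding resid_def[abs_def] by (intro borel_measurable_diff measurable_g_Y measurable_partial_mean_Y)

lemma resid_le: "a \<ge> 1 \<Longrightarrow> b \<ge> 1 \<Longrightarrow> \<omega> \<in> space M \<Longrightarrow> \<bar>resid g a b \<omega>\<bar> \<le> 2 * c"
  using g_le[OF Y_space Y_space, of a \<omega> b \<omega>] partial_mean_le[OF Y_space, of a \<omega>] unfolding resid_def by simp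

lemma kernel_bound_nonneg: "0 \<le> c"
proof -
  obtain \<omega> where "\<omega> \<in> space M" using not_empty by blast
  then show ?thesis using resid_le[of 1 1 \<omega>] abs_ge_zero[of "resid g 1 1 \<omega>"] by simp
qed

text \<open>Given the data points with indices \<open>a\<close> and \<open>b\<close>, the residual with the fresh
  index \<open>e\<close> has conditional mean zero.\<close>

lemma resid_orthogonal_fresh:
  assumes "a \<ge> 1" "b \<ge> 1" "e \<ge> 1" "e \<noteq> a" "e \<noteq> b"
  shows "(\<integral>\<omega>. resid g a b \<omega> * resid g a e \<omega> \<partial>M) = 0"
proof -
  \<comment> \<open>The block \<open>{a, b}\<close> may be a single index; independence only uses
    that it is disjoint from \<open>{e}\<close>.\<close>
  let ?U = "\<lambda>\<omega>. restrict (\<lambda>i. Y i \<omega>) {a, b}" and ?V = "\<lambda>\<omega>. restrict (\<lambda>i. Y i \<omega>) {e}"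
  let ?S = "PiM {a, b} (\<lambda>i. N)" and ?T = "PiM {e} (\<lambda>i. N)"
  define F where "F = (\<lambda>(u, v). (g (u a, u b) - partial_mean g (u a)) * (g (u a, v e) - partial_mean g (u a)))"
  have ind: "indep_var ?S ?U ?T ?V"
    using assms by (intro indep_var_restrict[OF indep]) auto
  have ca: "(\<lambda>z. fst z a) \<in> ?S \<Otimes>\<^sub>M ?T \<rightarrow>\<^sub>M N" and cb: "(\<lambda>z. fst z b) \<in> ?S \<Otimes>\<^sub>M ?T \<rightarrow>\<^sub>M N"
    by (rule measurable_compose[OF measurable_fst measurable_component_singleton], simp)+
  have ce: "(\<lambda>z. snd z e) \<in> ?S \<Otimes>\<^sub>M ?T \<rightarrow>\<^sub>M N"
    by (rule measurable_compose[OF measurable_snd measurable_component_singleton], simp)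
  have F: "F \<in> borel_measurable (?S \<Otimes>\<^sub>M ?T)"
    unfolding F_def case_prod_beta
    by (intro borel_measurable_times borel_measurable_diff measurable_compose[OF measurable_Pair g]
        measurable_compose[OF ca measurable_partial_mean] ca cb ce)
  have "\<bar>F z\<bar> \<le> (2 * c) * (2 * c)" if "z \<in> space (?S \<Otimes>\<^sub>M ?T)" for z
  proof -
    have s: "fst z a \<in> space N" "fst z b \<in> space N" "snd z e \<in> space N"
      using measurable_space[OF ca that] measurable_space[OF cb that] measurable_space[OF ce that] by auto
    have "\<bar>g (fst z a, fst z b) - partial_mean g (fst z a)\<bar> \<le> 2 * c" "\<bar>g (fst z a, snd z e) - partial_mean g (fst z a)\<bar> \<le> 2 * c"
      using g_le[OF s(1,2)] g_le[OF s(1,3)] partial_mean_le[OF s(1)] by auto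
    then show ?thesis unfolding F_def case_prod_beta abs_mult using kernel_bound_nonneg by (intro mult_mono) auto
  qed
  then have "(\<integral>\<omega>. F (?U \<omega>, ?V \<omega>) \<partial>M) = (\<integral>\<omega>. \<integral>\<omega>'. F (?U \<omega>, ?V \<omega>') \<partial>M \<partial>M)"
    by (rule indep_var_integral_iterated[OF ind F])
  also have "\<dots> = (\<integral>\<omega>. 0 \<partial>M)"
  proof (rule Bochner_Integration.integral_cong[OF refl])
    fix \<omega> assume \<omega>: "\<omega> \<in> space M"
    have x: "Y a \<omega> \<in> space N" using Y_space assms \<omega> by blast
    have m: "(\<lambda>y. g (Y a \<omega>, y)) \<in> borel_measurable N"
      using measurable_compose[OF measurable_Pair1'[OF x] g] .
    have "integrable M (\<lambda>\<omega>'. g (Y a \<omega>, Y e \<omega>'))"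
      using measurable_compose[OF measurable_Y m, of e] g_le[OF x Y_space] assms
      by (intro integrable_bounded[of _ c]) auto
    then have "(\<integral>\<omega>'. g (Y a \<omega>, Y e \<omega>') - partial_mean g (Y a \<omega>) \<partial>M) = 0"
      using integral_Y[OF assms(3) m] by (simp add: prob_space partial_mean_def)
    then show "(\<integral>\<omega>'. F (?U \<omega>, ?V \<omega>') \<partial>M) = 0" by (simp add: F_def)
  qed
  finally show ?thesis by (simp add: F_def resid_def)
qed

text \<open>Of two distinct indices at most one equals \<open>a\<close>, so the other is
  fresh.\<close>

lemma resid_orthogonal:
  assumes "a \<ge> 1" "b \<ge> 1" "e \<ge> 1" "b \<noteq> e"
  shows "(\<integral>\<omega>. resid g a b \<omega> * resid g a e \<omega> \<partial>M) = 0"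
proof (cases "e = a")
  case True
  then show ?thesis using resid_orthogonal_fresh[of a e b] assms by (simp add: mult.commute)
qed (use resid_orthogonal_fresh[of a b e] assms in simp)

text \<open>By orthogonality the second moment of the averaged residuals is at most
  \<open>(2 * c)^2 / n\<close>. The index \<open>a\<close> may be among those averaged over.\<close>

lemma average_partial_mean_bound:
  assumes n: "n \<ge> 1" and a: "a \<ge> 1"
  shows "(\<integral>\<omega>. \<bar>(\<Sum>b=1..n. g (Y a \<omega>, Y b \<omega>)) / real n - partial_mean g (Y a \<omega>)\<bar> \<partial>M) \<le> (4 * c\<^sup>2 + 1) / sqrt n"
proof -
  define W where "W \<omega> = (\<Sum>b=1..n. resid g a b \<omega>) / real n" for \<omega>
  have W_eq: "(\<Sum>b=1..n. g (Y a \<omega>, Y b \<omega>)) / real n - partial_mean g (Y a \<omega>) = W \<omega>" for \<omega>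
    using n by (simp add: W_def resid_def sum_subtractf diff_divide_distrib)
  have W_meas: "W \<in> borel_measurable M"
    unfolding W_def[abs_def] using a by (intro borel_measurable_divide borel_measurable_sum measurable_resid) auto
  have W_le: "\<bar>W \<omega>\<bar> \<le> 2 * c" if "\<omega> \<in> space M" for \<omega>
  proof -
    have "\<bar>\<Sum>b=1..n. resid g a b \<omega>\<bar> \<le> real n * (2 * c)"
      using sum_norm_bound[of "{1..n}" "\<lambda>b. resid g a b \<omega>" "2 * c"] resid_le a that by simp
    then show ?thesis using n by (simp add: W_def abs_divide divide_le_eq mult.commute)
  qed
  have int: "integrable M (\<lambda>\<omega>. resid g a b \<omega> * resid g a e \<omega>)" if "b \<ge> 1" "e \<ge> 1" for b e
  proof (rule integrable_bounded[of _ "(2 * c) * (2 * c)"])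
    show "(\<lambda>\<omega>. resid g a b \<omega> * resid g a e \<omega>) \<in> borel_measurable M"
      using a that by (intro borel_measurable_times measurable_resid)
    show "\<bar>resid g a b \<omega> * resid g a e \<omega>\<bar> \<le> 2 * c * (2 * c)" if "\<omega> \<in> space M" for \<omega>
      unfolding abs_mult using a \<open>b \<ge> 1\<close> \<open>e \<ge> 1\<close> that kernel_bound_nonneg by (intro mult_mono resid_le) auto
  qed
  have "(\<integral>\<omega>. (W \<omega>)\<^sup>2 \<partial>M) = (\<integral>\<omega>. (\<Sum>b=1..n. \<Sum>e=1..n. resid g a b \<omega> * resid g a e \<omega>) / (real n)\<^sup>2 \<partial>M)"
    by (simp add: W_def power_divide power2_eq_square sum_product)
  also have "\<dots> = (\<Sum>b=1..n. \<Sum>e=1..n. \<integral>\<omega>. resid g a b \<omega> * resid g a e \<omega> \<partial>M) / (real n)\<^sup>2"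
  proof -
    have "(\<integral>\<omega>. (\<Sum>b=1..n. \<Sum>e=1..n. resid g a b \<omega> * resid g a e \<omega>) \<partial>M)
        = (\<Sum>b=1..n. \<integral>\<omega>. (\<Sum>e=1..n. resid g a b \<omega> * resid g a e \<omega>) \<partial>M)"
      by (intro Bochner_Integration.integral_sum Bochner_Integration.integrable_sum int) auto
    also have "\<dots> = (\<Sum>b=1..n. \<Sum>e=1..n. \<integral>\<omega>. resid g a b \<omega> * resid g a e \<omega> \<partial>M)"
      by (intro sum.cong refl Bochner_Integration.integral_sum int) auto
    finally show ?thesis by simp
  qed
  also have "\<dots> \<le> (\<Sum>b=1..n. (2 * c) * (2 * c)) / (real n)\<^sup>2"
  proof (intro divide_right_mono sum_mono)
    fix b assume b: "b \<in> {1..n}"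
    have "(\<Sum>e=1..n. \<integral>\<omega>. resid g a b \<omega> * resid g a e \<omega> \<partial>M) = (\<Sum>e=1..n. if e = b then \<integral>\<omega>. resid g a b \<omega> * resid g a b \<omega> \<partial>M else 0)"
      using b a by (intro sum.cong refl) (auto intro: resid_orthogonal)
    also have "\<dots> = (\<integral>\<omega>. resid g a b \<omega> * resid g a b \<omega> \<partial>M)" using b by simp
    also have "\<dots> \<le> (2 * c) * (2 * c)"
    proof (rule integral_le_bound[OF int])
      fix \<omega> assume "\<omega> \<in> space M"
      then have "\<bar>resid g a b \<omega>\<bar> * \<bar>resid g a b \<omega>\<bar> \<le> 2 * c * (2 * c)"
        using a b kernel_bound_nonneg by (intro mult_mono resid_le) auto
      then show "resid g a b \<omega> * resid g a b \<omega> \<le> 2 * c * (2 * c)" by simp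
    qed (use b in auto)
    finally show "(\<Sum>e=1..n. \<integral>\<omega>. resid g a b \<omega> * resid g a e \<omega> \<partial>M) \<le> 2 * c * (2 * c)" .
  qed simp
  also have "\<dots> = 4 * c\<^sup>2 / real n" using n by (simp add: power2_eq_square)
  finally have second_moment: "(\<integral>\<omega>. (W \<omega>)\<^sup>2 \<partial>M) \<le> 4 * c\<^sup>2 / real n" .
  have iW2: "integrable M (\<lambda>\<omega>. (W \<omega>)\<^sup>2)"
    using W_meas power_mono[OF W_le abs_ge_zero, of _ 2] by (intro integrable_bounded[of _ "(2 * c)\<^sup>2"]) auto
  have iW: "integrable M (\<lambda>\<omega>. \<bar>W \<omega>\<bar>)"
    using W_meas W_le by (intro integrable_bounded[of _ "2 * c"]) auto
  have s: "sqrt n > 0" "sqrt n * sqrt n = n" using n by auto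
  \<comment> \<open>The first moment comes from
    \<open>2 * \<bar>w\<bar> \<le> sqrt n * w^2 + 1 / sqrt n\<close>; the two summands explain the
    constant \<open>4 * c^2 + 1\<close>.\<close>
  have "(\<integral>\<omega>. \<bar>W \<omega>\<bar> \<partial>M) \<le> (\<integral>\<omega>. sqrt n * (W \<omega>)\<^sup>2 + 1 / sqrt n \<partial>M)"
  proof (rule integral_mono[OF iW])
    show "integrable M (\<lambda>\<omega>. sqrt n * (W \<omega>)\<^sup>2 + 1 / sqrt n)" using iW2 by simp
    fix \<omega>
    have "0 \<le> (sqrt n * \<bar>W \<omega>\<bar> - 1)\<^sup>2 / sqrt n" by simp
    also have "\<dots> = (sqrt n * (W \<omega>)\<^sup>2 + 1 / sqrt n) - 2 * \<bar>W \<omega>\<bar>"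
      using s by (simp add: power2_diff power_mult_distrib field_simps)
    finally show "\<bar>W \<omega>\<bar> \<le> sqrt n * (W \<omega>)\<^sup>2 + 1 / sqrt n" by simp
  qed
  also have "\<dots> = sqrt n * (\<integral>\<omega>. (W \<omega>)\<^sup>2 \<partial>M) + 1 / sqrt n" using iW2 by (simp add: prob_space)
  also have "\<dots> \<le> sqrt n * (4 * c\<^sup>2 / real n) + 1 / sqrt n"
    using second_moment by (intro add_right_mono mult_left_mono) auto
  also have "sqrt n * (4 * c\<^sup>2 / real n) = 4 * c\<^sup>2 / sqrt n"
    using s by (simp add: field_simps)
  finally show ?thesis unfolding W_eq by (simp add: add_divide_distrib)
qed

end

text \<open>A law of large numbers with a rate, as the case of a function of pairs that ignores its
  first argument.\<close>

lemma average_bound: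
  fixes h :: "'b \<Rightarrow> real"
  assumes h: "h \<in> borel_measurable N" "\<And>x. x \<in> space N \<Longrightarrow> \<bar>h x\<bar> \<le> c" and n: "n \<ge> 1"
  shows "(\<integral>\<omega>. \<bar>(\<Sum>b=1..n. h (Y b \<omega>)) / real n - (\<integral>x. h x \<partial>P)\<bar> \<partial>M) \<le> (4 * c\<^sup>2 + 1) / sqrt n"
proof -
  have g: "(\<lambda>z. h (snd z)) \<in> borel_measurable (N \<Otimes>\<^sub>M N)"
    by (rule measurable_compose[OF measurable_snd h(1)])
  show ?thesis
    using average_partial_mean_bound[OF g _ n, of c 1] h(2) by (simp add: partial_mean_def)
qed

end

section \<open>From averages to the statistic\<close>

lemma sum_average_le:
  fixes f :: "nat \<Rightarrow> real"
  assumes "n \<ge> 1" "\<And>a. a \<in> {1..n} \<Longrightarrow> \<bar>f a\<bar> \<le> c"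
  shows "\<bar>(\<Sum>a=1..n. f a) / real n\<bar> \<le> c"
  using abs_sum_le[OF assms(2)] assms(1) by (simp add: abs_divide divide_le_eq mult.commute)

lemma double_average_eq:
  fixes f :: "nat \<Rightarrow> nat \<Rightarrow> real"
  shows "(\<Sum>a=1..n. \<Sum>b=1..n. f a b) / (real n)\<^sup>2 = (\<Sum>a=1..n. (\<Sum>b=1..n. f a b) / real n) / real n"
  by (simp add: sum_divide_distrib[symmetric] power2_eq_square)

lemma average_diff_le:
  fixes u v :: "nat \<Rightarrow> real"
  shows "\<bar>(\<Sum>a=1..n. u a) / real n - (\<Sum>a=1..n. v a) / real n\<bar> \<le> (\<Sum>a=1..n. \<bar>u a - v a\<bar>) / real n"
proof -
  have "\<bar>(\<Sum>a=1..n. u a) / real n - (\<Sum>a=1..n. v a) / real n\<bar> = \<bar>\<Sum>a=1..n. u a - v a\<bar> / real n"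
    by (simp add: sum_subtractf diff_divide_distrib[symmetric] abs_divide)
  also have "\<dots> \<le> (\<Sum>a=1..n. \<bar>u a - v a\<bar>) / real n" by (intro divide_right_mono sum_abs) simp
  finally show ?thesis .
qed

lemma gram_stat_le:
  assumes n: "n \<ge> 1"
    and bd: "\<And>j a b. j \<in> {1..d} \<Longrightarrow> a \<in> {1..n} \<Longrightarrow> b \<in> {1..n} \<Longrightarrow> \<bar>K j a b\<bar> \<le> \<kappa>"
  shows "\<bar>gram_stat d n K\<bar> \<le> 4 * \<kappa> ^ d"
proof -
  have p: "\<bar>\<Prod>j=1..d. z j\<bar> \<le> \<kappa> ^ d" if "\<And>j. j \<in> {1..d} \<Longrightarrow> \<bar>z j\<bar> \<le> \<kappa>" for z :: "nat \<Rightarrow> real"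
    using abs_prod_le[of "{1..d}" z \<kappa>] that by simp
  have "\<bar>(\<Sum>a=1..n. \<Sum>b=1..n. \<Prod>j=1..d. K j a b) / (real n)\<^sup>2\<bar> \<le> \<kappa> ^ d"
    unfolding double_average_eq by (intro sum_average_le[OF n] p bd)
  moreover have "\<bar>\<Prod>j=1..d. (\<Sum>a=1..n. \<Sum>b=1..n. K j a b) / (real n)\<^sup>2\<bar> \<le> \<kappa> ^ d"
    unfolding double_average_eq by (intro sum_average_le[OF n] p bd)
  moreover have "\<bar>(\<Sum>a=1..n. \<Prod>j=1..d. (\<Sum>b=1..n. K j a b) / real n) / real n\<bar> \<le> \<kappa> ^ d"
    by (intro sum_average_le[OF n] p bd)
  ultimately show ?thesis unfolding gram_stat_def by linarith
qed

context iid_sequence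
begin

lemma integrable_average_partial_mean_error:
  assumes g: "g \<in> borel_measurable (N \<Otimes>\<^sub>M N)"
    and bd: "\<And>x y. x \<in> space N \<Longrightarrow> y \<in> space N \<Longrightarrow> \<bar>g (x, y)\<bar> \<le> c"
    and n: "n \<ge> 1" and a: "a \<ge> 1"
  shows "integrable M (\<lambda>\<omega>. \<bar>(\<Sum>b=1..n. g (Y a \<omega>, Y b \<omega>)) / real n - partial_mean g (Y a \<omega>)\<bar>)"
proof (rule integrable_bounded[of _ "2 * c"])
  show "(\<lambda>\<omega>. \<bar>(\<Sum>b=1..n. g (Y a \<omega>, Y b \<omega>)) / real n - partial_mean g (Y a \<omega>)\<bar>) \<in> borel_measurable M"
    using a by (intro borel_measurable_abs borel_measurable_diff borel_measurable_divide
        borel_measurable_sum borel_measurable_const measurable_g_Y[OF g bd] measurable_partial_mean_Y[OF g bd]) auto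
  fix \<omega> assume \<omega>: "\<omega> \<in> space M"
  have "\<bar>(\<Sum>b=1..n. g (Y a \<omega>, Y b \<omega>)) / real n\<bar> \<le> c"
    using a \<omega> by (intro sum_average_le[OF n] bd Y_space) auto
  moreover have "\<bar>partial_mean g (Y a \<omega>)\<bar> \<le> c" using partial_mean_le[OF g bd Y_space[OF a \<omega>]] .
  ultimately show "\<bar>\<bar>(\<Sum>b=1..n. g (Y a \<omega>, Y b \<omega>)) / real n - partial_mean g (Y a \<omega>)\<bar>\<bar> \<le> 2 * c" by linarith
qed

lemma integrable_average_error:
  fixes h :: "'b \<Rightarrow> real"
  assumes h: "h \<in> borel_measurable N" "\<And>x. x \<in> space N \<Longrightarrow> \<bar>h x\<bar> \<le> c" and n: "n \<ge> 1"
  shows "integrable M (\<lambda>\<omega>. \<bar>(\<Sum>b=1..n. h (Y b \<omega>)) / real n - (\<integral>x. h x \<partial>P)\<bar>)"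
proof -
  have g: "(\<lambda>z. h (snd z)) \<in> borel_measurable (N \<Otimes>\<^sub>M N)"
    by (rule measurable_compose[OF measurable_snd h(1)])
  show ?thesis
    using integrable_average_partial_mean_error[OF g _ n, of c 1] h(2) by (simp add: partial_mean_def)
qed

text \<open>Row means must be compared with conditional means at the data points themselves, since
  that is where the terms of the statistic use them.\<close>

definition total_error :: "('b \<times> 'b \<Rightarrow> real) \<Rightarrow> nat \<Rightarrow> 'w \<Rightarrow> real" where
  "total_error g n \<omega> = (\<Sum>a=1..n. \<bar>(\<Sum>b=1..n. g (Y a \<omega>, Y b \<omega>)) / real n - partial_mean g (Y a \<omega>)\<bar>) / real n"

lemma total_error_bound:
  assumes g: "g \<in> borel_measurable (N \<Otimes>\<^sub>M N)"
    and bd: "\<And>x y. x \<in> space N \<Longrightarrow> y \<in> space N \<Longrightarrow> \<bar>g (x, y)\<bar> \<le> c" and n: "n \<ge> 1"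
  shows "integrable M (total_error g n)" "(\<integral>\<omega>. total_error g n \<omega> \<partial>M) \<le> (4 * c\<^sup>2 + 1) / sqrt n"
proof -
  have i: "integrable M (\<lambda>\<omega>. \<bar>(\<Sum>b=1..n. g (Y a \<omega>, Y b \<omega>)) / real n - partial_mean g (Y a \<omega>)\<bar>)" if "a \<in> {1..n}" for a
    using integrable_average_partial_mean_error[OF g bd n, of a] that by simp
  show "integrable M (total_error g n)"
    unfolding total_error_def[abs_def]
    by (intro integrable_divide Bochner_Integration.integrable_sum i)
  have "(\<integral>\<omega>. total_error g n \<omega> \<partial>M) = (\<Sum>a=1..n. \<integral>\<omega>. \<bar>(\<Sum>b=1..n. g (Y a \<omega>, Y b \<omega>)) / real n - partial_mean g (Y a \<omega>)\<bar> \<partial>M) / real n"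
    unfolding total_error_def by (subst Bochner_Integration.integral_sum[symmetric, OF i]) simp_all
  also have "\<dots> \<le> (\<Sum>a=1..n. (4 * c\<^sup>2 + 1) / sqrt n) / real n"
    using average_partial_mean_bound[OF g bd n] by (intro divide_right_mono sum_mono) auto
  also have "\<dots> = (4 * c\<^sup>2 + 1) / sqrt n" using n by simp
  finally show "(\<integral>\<omega>. total_error g n \<omega> \<partial>M) \<le> (4 * c\<^sup>2 + 1) / sqrt n" .
qed

definition mean_error :: "('b \<Rightarrow> real) \<Rightarrow> nat \<Rightarrow> 'w \<Rightarrow> real" where
  "mean_error h n \<omega> = \<bar>(\<Sum>b=1..n. h (Y b \<omega>)) / real n - (\<integral>x. h x \<partial>P)\<bar>"

lemma mean_error_bound:
  fixes h :: "'b \<Rightarrow> real"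
  assumes h: "h \<in> borel_measurable N" "\<And>x. x \<in> space N \<Longrightarrow> \<bar>h x\<bar> \<le> c" and n: "n \<ge> 1"
  shows "integrable M (mean_error h n)" "(\<integral>\<omega>. mean_error h n \<omega> \<partial>M) \<le> (4 * c\<^sup>2 + 1) / sqrt n"
  using integrable_average_error[OF assms] average_bound[OF assms] unfolding mean_error_def[abs_def] by auto

lemma double_average_error_le:
  "\<bar>(\<Sum>a=1..n. \<Sum>b=1..n. g (Y a \<omega>, Y b \<omega>)) / (real n)\<^sup>2 - (\<integral>x. partial_mean g x \<partial>P)\<bar>
    \<le> total_error g n \<omega> + mean_error (partial_mean g) n \<omega>"
  using average_diff_le[where n=n and u="\<lambda>a. (\<Sum>b=1..n. g (Y a \<omega>, Y b \<omega>)) / real n" and v="\<lambda>a. partial_mean g (Y a \<omega>)"]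
  unfolding double_average_eq total_error_def mean_error_def by linarith

text \<open>For kernels of single coordinates the three integrals are the double integrals of the
  tensor kernel under P x P, Q x Q and P x Q, where Q is the product of the marginals of
  \<open>P\<close>.\<close>

definition gram_limit :: "nat \<Rightarrow> (nat \<Rightarrow> 'b \<times> 'b \<Rightarrow> real) \<Rightarrow> real" where
  "gram_limit d g = (\<integral>x. partial_mean (\<lambda>z. \<Prod>j=1..d. g j z) x \<partial>P) + (\<Prod>j=1..d. \<integral>x. partial_mean (g j) x \<partial>P)
     - 2 * (\<integral>x. (\<Prod>j=1..d. partial_mean (g j) x) \<partial>P)"

text \<open>Convergence in mean is the form that Markov's inequality needs. The constant constructed
  depends on \<open>d\<close> and \<open>\<kappa>\<close> alone.\<close>

lemma gram_stat_L1:
  assumes g: "\<And>j. j \<in> {1..d} \<Longrightarrow> g j \<in> borel_measurable (N \<Otimes>\<^sub>M N)"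
    and bd: "\<And>j x y. j \<in> {1..d} \<Longrightarrow> x \<in> space N \<Longrightarrow> y \<in> space N \<Longrightarrow> \<bar>g j (x, y)\<bar> \<le> \<kappa>"
    and \<kappa>: "\<kappa> \<ge> 1"
  shows "\<exists>c\<ge>0. \<forall>n\<ge>1. integrable M (\<lambda>\<omega>. \<bar>gram_stat d n (\<lambda>j a b. g j (Y a \<omega>, Y b \<omega>)) - gram_limit d g\<bar>) \<and>
    (\<integral>\<omega>. \<bar>gram_stat d n (\<lambda>j a b. g j (Y a \<omega>, Y b \<omega>)) - gram_limit d g\<bar> \<partial>M) \<le> c / sqrt n"
proof -
  define G where "G z = (\<Prod>j=1..d. g j z)" for z
  define h where "h x = (\<Prod>j=1..d. partial_mean (g j) x)" for x
  interpret P: prob_space P by (rule prob_space_P)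
  have G: "G \<in> borel_measurable (N \<Otimes>\<^sub>M N)"
    unfolding G_def[abs_def] by (intro borel_measurable_prod g)
  have Gb: "\<bar>G (x, y)\<bar> \<le> \<kappa> ^ d" if "x \<in> space N" "y \<in> space N" for x y
    using abs_prod_le[of "{1..d}" "\<lambda>j. g j (x, y)" \<kappa>] bd that by (simp add: G_def)
  have pm: "partial_mean (g j) \<in> borel_measurable N" if "j \<in> {1..d}" for j
    using measurable_partial_mean[OF g bd] that by blast
  have pb: "\<bar>partial_mean (g j) x\<bar> \<le> \<kappa>" if "j \<in> {1..d}" "x \<in> space N" for j x
    using partial_mean_le[OF g bd] that by blast
  have h: "h \<in> borel_measurable N" unfolding h_def[abs_def] by (intro borel_measurable_prod pm)
  have hb: "\<bar>h x\<bar> \<le> \<kappa> ^ d" if "x \<in> space N" for x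
    using abs_prod_le[of "{1..d}" "\<lambda>j. partial_mean (g j) x" \<kappa>] pb that by (simp add: h_def)
  define A where "A = 4 * \<kappa>\<^sup>2 + 1"
  define A' where "A' = 4 * (\<kappa> ^ d)\<^sup>2 + 1"
  define c where "c = 2 * A' + \<kappa> ^ d * (real d * (2 * A)) + 2 * (\<kappa> ^ d * (real d * A) + A')"
  have c0: "c \<ge> 0" using \<kappa> by (simp add: c_def A_def A'_def)
  show ?thesis
  proof (intro exI[of _ c] conjI allI impI c0)
    fix n :: nat assume n: "n \<ge> 1"
    let ?S = "\<lambda>\<omega>. gram_stat d n (\<lambda>j a b. g j (Y a \<omega>, Y b \<omega>))"
    \<comment> \<open>One line for each term of the statistic: passing from row means to conditional
      means costs \<open>total_error\<close>, passing from the outer average to an integral costs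
      \<open>mean_error\<close>, and products enter through \<open>prod_diff_le\<close> with the
      factor \<open>\<kappa> ^ d\<close>.\<close>
    define R where "R \<omega> = (total_error G n \<omega> + mean_error (partial_mean G) n \<omega>)
        + \<kappa> ^ d * (\<Sum>j=1..d. total_error (g j) n \<omega> + mean_error (partial_mean (g j)) n \<omega>)
        + 2 * (\<kappa> ^ d * (\<Sum>j=1..d. total_error (g j) n \<omega>) + mean_error h n \<omega>)" for \<omega>
    note te = total_error_bound[OF g bd n] and teG = total_error_bound[OF G Gb n]
    note me = mean_error_bound[OF pm pb n] and meG = mean_error_bound[OF measurable_partial_mean[OF G Gb] partial_mean_le[OF G Gb] n]
    note meh = mean_error_bound[OF h hb n]
    have iR: "integrable M R"
      unfolding R_def[abs_def] using te(1) me(1) teG(1) meG(1) meh(1)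
      by (intro Bochner_Integration.integrable_add integrable_mult_right Bochner_Integration.integrable_sum) auto
    have ptw: "\<bar>?S \<omega> - gram_limit d g\<bar> \<le> R \<omega>" if \<omega>: "\<omega> \<in> space M" for \<omega>
    proof -
      have T1: "\<bar>(\<Sum>a=1..n. \<Sum>b=1..n. G (Y a \<omega>, Y b \<omega>)) / (real n)\<^sup>2 - (\<integral>x. partial_mean G x \<partial>P)\<bar>
          \<le> total_error G n \<omega> + mean_error (partial_mean G) n \<omega>" by (rule double_average_error_le)
      have T2: "\<bar>(\<Prod>j=1..d. (\<Sum>a=1..n. \<Sum>b=1..n. g j (Y a \<omega>, Y b \<omega>)) / (real n)\<^sup>2) - (\<Prod>j=1..d. \<integral>x. partial_mean (g j) x \<partial>P)\<bar>
          \<le> \<kappa> ^ d * (\<Sum>j=1..d. total_error (g j) n \<omega> + mean_error (partial_mean (g j)) n \<omega>)"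
      proof -
        have "\<bar>(\<Sum>a=1..n. \<Sum>b=1..n. g j (Y a \<omega>, Y b \<omega>)) / (real n)\<^sup>2\<bar> \<le> \<kappa>" if "j \<in> {1..d}" for j
          unfolding double_average_eq using that \<omega> by (intro sum_average_le[OF n] bd Y_space) auto
        moreover have "\<bar>\<integral>x. partial_mean (g j) x \<partial>P\<bar> \<le> \<kappa>" if "j \<in> {1..d}" for j
        proof -
          have "integrable P (partial_mean (g j))"
            using pm[OF that] pb[OF that] by (intro P.integrable_const_bound[of _ \<kappa>]) auto
          then have le: "(\<integral>x. \<bar>partial_mean (g j) x\<bar> \<partial>P) \<le> (\<integral>x. \<kappa> \<partial>P)"
            using pb[OF that] by (intro integral_mono) auto
          have "(\<integral>x. \<kappa> \<partial>P) = \<kappa>" using P.prob_space by simp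
          then show ?thesis using order_trans[OF integral_abs_bound le] by (simp only:)
        qed
        ultimately have "\<bar>(\<Prod>j=1..d. (\<Sum>a=1..n. \<Sum>b=1..n. g j (Y a \<omega>, Y b \<omega>)) / (real n)\<^sup>2) - (\<Prod>j=1..d. \<integral>x. partial_mean (g j) x \<partial>P)\<bar>
          \<le> \<kappa> ^ card {1..d} * (\<Sum>j=1..d. \<bar>(\<Sum>a=1..n. \<Sum>b=1..n. g j (Y a \<omega>, Y b \<omega>)) / (real n)\<^sup>2 - (\<integral>x. partial_mean (g j) x \<partial>P)\<bar>)"
          by (intro prod_diff_le \<kappa>) auto
        also have "\<dots> \<le> \<kappa> ^ card {1..d} * (\<Sum>j=1..d. total_error (g j) n \<omega> + mean_error (partial_mean (g j)) n \<omega>)"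
          using \<kappa> by (intro mult_left_mono sum_mono double_average_error_le) auto
        finally show ?thesis by simp
      qed
      have T3: "\<bar>(\<Sum>a=1..n. \<Prod>j=1..d. (\<Sum>b=1..n. g j (Y a \<omega>, Y b \<omega>)) / real n) / real n - (\<integral>x. h x \<partial>P)\<bar>
          \<le> \<kappa> ^ d * (\<Sum>j=1..d. total_error (g j) n \<omega>) + mean_error h n \<omega>"
      proof -
        have "\<bar>(\<Sum>a=1..n. \<Prod>j=1..d. (\<Sum>b=1..n. g j (Y a \<omega>, Y b \<omega>)) / real n) / real n - (\<Sum>a=1..n. h (Y a \<omega>)) / real n\<bar>
            \<le> (\<Sum>a=1..n. \<bar>(\<Prod>j=1..d. (\<Sum>b=1..n. g j (Y a \<omega>, Y b \<omega>)) / real n) - h (Y a \<omega>)\<bar>) / real n"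
          by (rule average_diff_le)
        also have "\<dots> \<le> (\<Sum>a=1..n. \<kappa> ^ d * (\<Sum>j=1..d. \<bar>(\<Sum>b=1..n. g j (Y a \<omega>, Y b \<omega>)) / real n - partial_mean (g j) (Y a \<omega>)\<bar>)) / real n"
        proof (intro divide_right_mono sum_mono)
          fix a assume a: "a \<in> {1..n}"
          then have Ya: "Y a \<omega> \<in> space N" using Y_space \<omega> by simp
          have "\<bar>(\<Prod>j=1..d. (\<Sum>b=1..n. g j (Y a \<omega>, Y b \<omega>)) / real n) - (\<Prod>j=1..d. partial_mean (g j) (Y a \<omega>))\<bar>
              \<le> \<kappa> ^ card {1..d} * (\<Sum>j=1..d. \<bar>(\<Sum>b=1..n. g j (Y a \<omega>, Y b \<omega>)) / real n - partial_mean (g j) (Y a \<omega>)\<bar>)"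
            using a Ya \<omega> by (intro prod_diff_le \<kappa> sum_average_le[OF n] bd pb Y_space) auto
          then show "\<bar>(\<Prod>j=1..d. (\<Sum>b=1..n. g j (Y a \<omega>, Y b \<omega>)) / real n) - h (Y a \<omega>)\<bar>
              \<le> \<kappa> ^ d * (\<Sum>j=1..d. \<bar>(\<Sum>b=1..n. g j (Y a \<omega>, Y b \<omega>)) / real n - partial_mean (g j) (Y a \<omega>)\<bar>)"
            by (simp add: h_def)
        qed simp
        also have "\<dots> = \<kappa> ^ d * ((\<Sum>a=1..n. \<Sum>j=1..d. \<bar>(\<Sum>b=1..n. g j (Y a \<omega>, Y b \<omega>)) / real n - partial_mean (g j) (Y a \<omega>)\<bar>) / real n)"
          by (simp add: sum_distrib_left)
        also have "\<dots> = \<kappa> ^ d * (\<Sum>j=1..d. total_error (g j) n \<omega>)"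
          by (subst sum.swap) (simp add: total_error_def sum_divide_distrib[symmetric])
        finally show ?thesis unfolding mean_error_def by linarith
      qed
      have combine: "\<bar>(t1 + t2 - 2 * t3) - (s1 + s2 - 2 * s3)\<bar> \<le> e1 + e2 + 2 * e3"
        if "\<bar>t1 - s1\<bar> \<le> e1" "\<bar>t2 - s2\<bar> \<le> e2" "\<bar>t3 - s3\<bar> \<le> e3"
        for t1 t2 t3 s1 s2 s3 e1 e2 e3 :: real using that by linarith
      show ?thesis
        unfolding gram_stat_def gram_limit_def R_def G_def[symmetric] h_def[symmetric] G_def[abs_def, symmetric]
        by (rule combine[OF T1 T2 T3])
    qed
    have Sm: "?S \<in> borel_measurable M"
      unfolding gram_stat_def[abs_def]
      by (intro borel_measurable_add borel_measurable_diff borel_measurable_times borel_measurable_divide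
          borel_measurable_sum borel_measurable_prod borel_measurable_const measurable_g_Y[OF g bd]) auto
    show iS: "integrable M (\<lambda>\<omega>. \<bar>?S \<omega> - gram_limit d g\<bar>)"
      using iR Sm ptw by (intro Bochner_Integration.integrable_bound[OF iR]) (auto intro!: AE_I2 simp: abs_le_iff order_trans[OF _ abs_ge_self])
    have "(\<integral>\<omega>. \<bar>?S \<omega> - gram_limit d g\<bar> \<partial>M) \<le> (\<integral>\<omega>. R \<omega> \<partial>M)"
      by (rule integral_mono[OF iS iR ptw])
    also have "\<dots> = ((\<integral>\<omega>. total_error G n \<omega> \<partial>M) + (\<integral>\<omega>. mean_error (partial_mean G) n \<omega> \<partial>M))
        + \<kappa> ^ d * (\<Sum>j=1..d. (\<integral>\<omega>. total_error (g j) n \<omega> \<partial>M) + (\<integral>\<omega>. mean_error (partial_mean (g j)) n \<omega> \<partial>M))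
        + 2 * (\<kappa> ^ d * (\<Sum>j=1..d. (\<integral>\<omega>. total_error (g j) n \<omega> \<partial>M)) + (\<integral>\<omega>. mean_error h n \<omega> \<partial>M))"
    proof -
      define U where "U \<omega> = (\<Sum>j=1..d. total_error (g j) n \<omega> + mean_error (partial_mean (g j)) n \<omega>)" for \<omega>
      define V where "V \<omega> = (\<Sum>j=1..d. total_error (g j) n \<omega>)" for \<omega>
      have iUV: "integrable M U" "integrable M V"
        unfolding U_def[abs_def] V_def[abs_def] using te(1) me(1)
        by (auto intro!: Bochner_Integration.integrable_sum Bochner_Integration.integrable_add)
      have "(\<integral>\<omega>. U \<omega> \<partial>M) = (\<Sum>j=1..d. (\<integral>\<omega>. total_error (g j) n \<omega> \<partial>M) + (\<integral>\<omega>. mean_error (partial_mean (g j)) n \<omega> \<partial>M))"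
        unfolding U_def using te(1) me(1)
        by (subst Bochner_Integration.integral_sum) (auto intro!: sum.cong Bochner_Integration.integrable_add Bochner_Integration.integral_add)
      moreover have "(\<integral>\<omega>. V \<omega> \<partial>M) = (\<Sum>j=1..d. (\<integral>\<omega>. total_error (g j) n \<omega> \<partial>M))"
        unfolding V_def using te(1) by (intro Bochner_Integration.integral_sum) auto
      ultimately show ?thesis
        unfolding R_def U_def[symmetric] V_def[symmetric] using iUV teG(1) meG(1) meh(1) by simp
    qed
    also have "\<dots> \<le> (A' / sqrt n + A' / sqrt n) + \<kappa> ^ d * (\<Sum>j=1..d. A / sqrt n + A / sqrt n)
        + 2 * (\<kappa> ^ d * (\<Sum>j=1..d. A / sqrt n) + A' / sqrt n)"
      using te(2) me(2) teG(2) meG(2) meh(2) \<kappa> unfolding A_def A'_def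
      by (intro add_mono mult_left_mono sum_mono) auto
    also have "\<dots> = c / sqrt n"
      by (simp add: c_def add_divide_distrib)
    finally show "(\<integral>\<omega>. \<bar>?S \<omega> - gram_limit d g\<bar> \<partial>M) \<le> c / sqrt n" .
  qed
qed

end

section \<open>Random permutations\<close>

lemma space_perm_vectors: "space (perm_vectors d n) = perm_tuples d n"
  by (simp add: perm_vectors_def perm_tuples_def space_PiM)

lemma sing_in_perm_vectors:
  assumes "\<sigma> \<in> perm_tuples d n"
  shows "{\<sigma>} \<in> sets (perm_vectors d n)"
proof -
  have "(\<Pi>\<^sub>E m\<in>{1..d - 1}. {\<sigma> m}) \<in> sets (perm_vectors d n)"
    unfolding perm_vectors_def using assms by (intro sets_PiM_I_finite) (auto simp: perm_tuples_def)
  moreover have "(\<Pi>\<^sub>E m\<in>{1..d - 1}. {\<sigma> m}) = {\<sigma>}"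
    using assms PiE_singleton[of \<sigma> "{1..d - 1}"] by (simp add: perm_tuples_def PiE_iff)
  ultimately show ?thesis by simp
qed

text \<open>The event is an intersection of \<open>d - 1\<close> independent events of probability
  \<open>1 / fact n\<close>.\<close>

lemma uniform_perm_vector_prob:
  assumes M: "prob_space M" and d: "d \<ge> 2" and \<psi>: "uniform_perm_vector M d n \<psi>" and \<sigma>: "\<sigma> \<in> perm_tuples d n"
  shows "measure M {\<omega> \<in> space M. \<psi> \<omega> = \<sigma>} = 1 / fact n ^ (d - 1)"
proof -
  interpret prob_space M by fact
  have meas: "\<psi> \<in> M \<rightarrow>\<^sub>M perm_vectors d n"
    and ind: "indep_vars (\<lambda>m. count_space (perms n)) (\<lambda>m \<omega>. \<psi> \<omega> m) {1..d - 1}"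
    and unif: "\<And>m. m \<in> {1..d - 1} \<Longrightarrow> distr M (count_space (perms n)) (\<lambda>\<omega>. \<psi> \<omega> m) = uniform_count_measure (perms n)"
    using \<psi> unfolding uniform_perm_vector_def by auto
  have s: "\<psi> \<omega> \<in> perm_tuples d n" if "\<omega> \<in> space M" for \<omega>
    using measurable_space[OF meas that] by (simp add: space_perm_vectors)
  have "{\<omega> \<in> space M. \<psi> \<omega> = \<sigma>} = (\<Inter>m\<in>{1..d - 1}. (\<lambda>\<omega>. \<psi> \<omega> m) -` {\<sigma> m} \<inter> space M)"
  proof (intro equalityI subsetI)
    fix \<omega> assume a: "\<omega> \<in> (\<Inter>m\<in>{1..d - 1}. (\<lambda>\<omega>. \<psi> \<omega> m) -` {\<sigma> m} \<inter> space M)"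
    \<comment> \<open>There is at least one component because d \<ge> 2; an empty intersection would
      not confine \<omega> to the space.\<close>
    have "1 \<in> {1..d - 1}" using d by simp
    with a have \<omega>: "\<omega> \<in> space M" by blast
    have "\<psi> \<omega> = \<sigma>"
      by (rule PiE_ext[OF s[OF \<omega>, unfolded perm_tuples_def] \<sigma>[unfolded perm_tuples_def]]) (use a in auto)
    then show "\<omega> \<in> {\<omega> \<in> space M. \<psi> \<omega> = \<sigma>}" using \<omega> by simp
  qed auto
  also have "prob \<dots> = (\<Prod>m\<in>{1..d - 1}. prob ((\<lambda>\<omega>. \<psi> \<omega> m) -` {\<sigma> m} \<inter> space M))"
    using d \<sigma> by (intro indep_varsD_finite[OF ind]) (auto simp: perm_tuples_def)
  also have "\<dots> = (\<Prod>m\<in>{1..d - 1}. 1 / fact n)"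
  proof (rule prod.cong[OF refl])
    fix m assume m: "m \<in> {1..d - 1}"
    have rv: "(\<lambda>\<omega>. \<psi> \<omega> m) \<in> M \<rightarrow>\<^sub>M count_space (perms n)"
      using ind m unfolding indep_vars_def by blast
    have \<sigma>m: "\<sigma> m \<in> perms n" using \<sigma> m by (auto simp: perm_tuples_def)
    have "prob ((\<lambda>\<omega>. \<psi> \<omega> m) -` {\<sigma> m} \<inter> space M) = measure (uniform_count_measure (perms n)) {\<sigma> m}"
      using measure_distr[OF rv, of "{\<sigma> m}"] \<sigma>m unif[OF m] by simp
    also have "\<dots> = 1 / fact n"
      using \<sigma>m by (subst measure_uniform_count_measure) (auto simp: finite_perms card_perms)
    finally show "prob ((\<lambda>\<omega>. \<psi> \<omega> m) -` {\<sigma> m} \<inter> space M) = 1 / fact n" .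
  qed
  also have "\<dots> = 1 / fact n ^ (d - 1)" by (simp add: power_divide)
  finally show ?thesis .
qed

lemma Int_stable_vimage: "Int_stable {f -` A \<inter> \<Omega> | A. A \<in> sets N}"
proof (rule Int_stableI)
  fix a b assume "a \<in> {f -` A \<inter> \<Omega> | A. A \<in> sets N}" "b \<in> {f -` A \<inter> \<Omega> | A. A \<in> sets N}"
  then obtain A B where "A \<in> sets N" "B \<in> sets N" "a = f -` A \<inter> \<Omega>" "b = f -` B \<inter> \<Omega>" by blast
  then have "a \<inter> b = f -` (A \<inter> B) \<inter> \<Omega>" "A \<inter> B \<in> sets N" by auto
  then show "a \<inter> b \<in> {f -` A \<inter> \<Omega> | A. A \<in> sets N}" by blast
qed

text \<open>Data and permutations have different types, but real functions of them generate smaller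
  sigma-algebras and are thus independent real variables, to which the product rule for expectations
  applies.\<close>

lemma indep_elements_integral:
  fixes f :: "'b \<Rightarrow> real" and h :: "'c \<Rightarrow> real"
  assumes M: "prob_space M" and ind: "indep_elements M N D N' Z"
    and f: "f \<in> borel_measurable N" and h: "h \<in> borel_measurable N'"
    and int: "integrable M (\<lambda>\<omega>. f (D \<omega>))" "integrable M (\<lambda>\<omega>. h (Z \<omega>))"
  shows "integrable M (\<lambda>\<omega>. f (D \<omega>) * h (Z \<omega>))"
    and "(\<integral>\<omega>. f (D \<omega>) * h (Z \<omega>) \<partial>M) = (\<integral>\<omega>. f (D \<omega>) \<partial>M) * (\<integral>\<omega>. h (Z \<omega>) \<partial>M)"
proof -
  interpret prob_space M by fact
  have D: "D \<in> M \<rightarrow>\<^sub>M N" and Z: "Z \<in> M \<rightarrow>\<^sub>M N'"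
    and i: "indep_set {D -` A \<inter> space M | A. A \<in> sets N} {Z -` A \<inter> space M | A. A \<in> sets N'}"
    using ind unfolding indep_elements_def by auto
  have sub: "{(\<lambda>\<omega>. g (T \<omega>)) -` A \<inter> space M | A. A \<in> sets borel} \<subseteq> {T -` A \<inter> space M | A. A \<in> sets K}"
    if T: "T \<in> M \<rightarrow>\<^sub>M K" and g: "g \<in> borel_measurable K" for g :: "'e \<Rightarrow> real" and T K
  proof
    fix B assume "B \<in> {(\<lambda>\<omega>. g (T \<omega>)) -` A \<inter> space M | A. A \<in> sets borel}"
    then obtain A where A: "A \<in> sets borel" "B = (\<lambda>\<omega>. g (T \<omega>)) -` A \<inter> space M" by blast
    have "B = T -` (g -` A \<inter> space K) \<inter> space M" using A(2) measurable_space[OF T] by auto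
    moreover have "g -` A \<inter> space K \<in> sets K" using measurable_sets[OF g A(1)] .
    ultimately show "B \<in> {T -` A \<inter> space M | A. A \<in> sets K}" by blast
  qed
  have "indep_set {(\<lambda>\<omega>. f (D \<omega>)) -` A \<inter> space M | A. A \<in> sets borel} {(\<lambda>\<omega>. h (Z \<omega>)) -` A \<inter> space M | A. A \<in> sets borel}"
    unfolding indep_set_def
    by (rule indep_sets_mono_sets[OF i[unfolded indep_set_def]]) (use sub[OF D f] sub[OF Z h] in \<open>auto split: bool.splits\<close>)
  then have "indep_set (sigma_sets (space M) {(\<lambda>\<omega>. f (D \<omega>)) -` A \<inter> space M | A. A \<in> sets borel})
      (sigma_sets (space M) {(\<lambda>\<omega>. h (Z \<omega>)) -` A \<inter> space M | A. A \<in> sets borel})"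
    by (rule indep_set_sigma_sets) (rule Int_stable_vimage)+
  then have "indep_var borel (\<lambda>\<omega>. f (D \<omega>)) borel (\<lambda>\<omega>. h (Z \<omega>))"
    unfolding indep_var_eq using measurable_compose[OF D f] measurable_compose[OF Z h] by blast
  from indep_var_integrable[OF this int] indep_var_lebesgue_integral[OF this int]
  show "integrable M (\<lambda>\<omega>. f (D \<omega>) * h (Z \<omega>))"
    and "(\<integral>\<omega>. f (D \<omega>) * h (Z \<omega>) \<partial>M) = (\<integral>\<omega>. f (D \<omega>) \<partial>M) * (\<integral>\<omega>. h (Z \<omega>) \<partial>M)" by blast+
qed

section \<open>Consistency of the statistic\<close>

text \<open>The sets \<open>\<Union>n. K j n\<close> carry the marginals; confining the second argument of each kernel to
  them makes the kernels jointly measurable and changes the statistic only on a null set.\<close>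

locale dependent_sample = iid_sequence M "prod_borel d S" "distr M (prod_borel d S) X" Xs
  for M :: "'w measure" and d :: nat and S :: "nat \<Rightarrow> 'a metric" and X :: "'w \<Rightarrow> nat \<Rightarrow> 'a"
    and Xs :: "nat \<Rightarrow> 'w \<Rightarrow> nat \<Rightarrow> 'a" +
  fixes k :: "nat \<Rightarrow> 'a \<Rightarrow> 'a \<Rightarrow> real" and K :: "nat \<Rightarrow> nat \<Rightarrow> 'a set" and \<kappa> :: real
  assumes d: "d \<ge> 2"
    and c0: "\<And>j. j \<in> {1..d} \<Longrightarrow> c0_universal (S j) (k j)"
    and char: "characteristic_kernel (prod_borel d S) (tensor_kernel d k)"
    and X: "X \<in> M \<rightarrow>\<^sub>M prod_borel d S"
    and dep: "distr M (prod_borel d S) X \<noteq> (\<Pi>\<^sub>M j\<in>{1..d}. distr M (metric_borel (S j)) (\<lambda>\<omega>. X \<omega> j))"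
    and K: "\<And>j n. j \<in> {1..d} \<Longrightarrow> compactin (mtopology_of (S j)) (K j n)"
    and XK: "\<And>j. j \<in> {1..d} \<Longrightarrow> AE x in distr M (metric_borel (S j)) (\<lambda>\<omega>. X \<omega> j). x \<in> (\<Union>n. K j n)"
    and \<kappa>: "\<kappa> \<ge> 1"
    and k_le: "\<And>j x y. j \<in> {1..d} \<Longrightarrow> x \<in> mspace (S j) \<Longrightarrow> y \<in> mspace (S j) \<Longrightarrow> \<bar>k j x y\<bar> \<le> \<kappa>"
    and meas: "\<And>n i. n \<ge> 2 * d \<Longrightarrow> i \<in> index_tuples (2 * d) n \<Longrightarrow>
      (\<lambda>\<omega>. \<Prod>j=1..d. k j (Xs (i (2 * j - 1)) \<omega> j) (Xs (i (2 * j)) \<omega> j)) \<in> borel_measurable M"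
begin

abbreviation "N \<equiv> prod_borel d S"
abbreviation "P \<equiv> distr M N X"
abbreviation "marg j \<equiv> distr M (metric_borel (S j)) (\<lambda>\<omega>. X \<omega> j)"

text \<open>Only the second argument is cut. The first stays free, so integrating out the second
  gives the true means at every point and not just almost everywhere.\<close>

definition confined :: "nat \<Rightarrow> 'a \<Rightarrow> 'a \<Rightarrow> real" where
  "confined j x y = (if y \<in> (\<Union>n. K j n) then k j x y else 0)"

definition coord_kernel :: "nat \<Rightarrow> (nat \<Rightarrow> 'a) \<times> (nat \<Rightarrow> 'a) \<Rightarrow> real" where
  "coord_kernel j = (\<lambda>(x, y). confined j (x j) (y j))"

lemma coord_measurable: "j \<in> {1..d} \<Longrightarrow> (\<lambda>x. x j) \<in> N \<rightarrow>\<^sub>M metric_borel (S j)"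
  unfolding prod_borel_def by (rule measurable_component_singleton)

lemma coord_space: "x \<in> space N \<Longrightarrow> j \<in> {1..d} \<Longrightarrow> x j \<in> mspace (S j)"
  using measurable_space[OF coord_measurable] by simp

lemma X_coord: "j \<in> {1..d} \<Longrightarrow> (\<lambda>\<omega>. X \<omega> j) \<in> M \<rightarrow>\<^sub>M metric_borel (S j)"
  using measurable_compose[OF X coord_measurable] .

lemma k_measurable: "j \<in> {1..d} \<Longrightarrow> x \<in> mspace (S j) \<Longrightarrow> k j x \<in> borel_measurable (metric_borel (S j))"
  by (intro continuous_map_borel_measurable c0_universal_continuous c0)

text \<open>\<open>measurable_kernel_restrict\<close> confines the first argument; symmetry of the
  kernel carries this over to the second.\<close>

lemma confined_measurable:
  assumes j: "j \<in> {1..d}"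
  shows "(\<lambda>(x, y). confined j x y) \<in> borel_measurable (metric_borel (S j) \<Otimes>\<^sub>M metric_borel (S j))"
proof -
  let ?B = "metric_borel (S j)"
  have "(\<lambda>(x, y). if x \<in> (\<Union>n. K j n) then k j x y else 0) \<in> borel_measurable (?B \<Otimes>\<^sub>M ?B)"
  proof (rule measurable_kernel_restrict[OF K[OF j] _ k_measurable[OF j]])
    fix y assume y: "y \<in> mspace (S j)"
    show "continuous_map (mtopology_of (S j)) euclideanreal (\<lambda>x. k j x y)"
      by (rule continuous_map_eq[OF c0_universal_continuous[OF c0[OF j] y]])
        (use c0_universal_commute[OF c0[OF j] y] in simp)
  qed
  then have sw: "(\<lambda>(x, y). if y \<in> (\<Union>n. K j n) then k j y x else 0) \<in> borel_measurable (?B \<Otimes>\<^sub>M ?B)"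
    using measurable_pair_swap by force
  have eq: "(case z of (x, y) \<Rightarrow> confined j x y) = (case z of (x, y) \<Rightarrow> if y \<in> (\<Union>n. K j n) then k j y x else 0)"
    if "z \<in> space (?B \<Otimes>\<^sub>M ?B)" for z
    using that c0_universal_commute[OF c0[OF j], of "fst z" "snd z"] unfolding confined_def
    by (cases z) (simp add: space_pair_measure)
  show ?thesis using sw by (subst measurable_cong[OF eq])
qed

lemma confined_le: "j \<in> {1..d} \<Longrightarrow> x \<in> mspace (S j) \<Longrightarrow> y \<in> mspace (S j) \<Longrightarrow> \<bar>confined j x y\<bar> \<le> \<kappa>"
  unfolding confined_def using k_le[of j x y] \<kappa> by simp

lemma coord_kernel_measurable:
  assumes j: "j \<in> {1..d}"
  shows "coord_kernel j \<in> borel_measurable (N \<Otimes>\<^sub>M N)"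
proof -
  have "(\<lambda>z. (fst z j, snd z j)) \<in> N \<Otimes>\<^sub>M N \<rightarrow>\<^sub>M metric_borel (S j) \<Otimes>\<^sub>M metric_borel (S j)"
    by (intro measurable_Pair measurable_compose[OF measurable_fst coord_measurable[OF j]]
        measurable_compose[OF measurable_snd coord_measurable[OF j]])
  from measurable_compose[OF this confined_measurable[OF j]]
  show ?thesis by (simp add: coord_kernel_def case_prod_beta)
qed

lemma coord_kernel_le: "j \<in> {1..d} \<Longrightarrow> x \<in> space N \<Longrightarrow> y \<in> space N \<Longrightarrow> \<bar>coord_kernel j (x, y)\<bar> \<le> \<kappa>"
  unfolding coord_kernel_def using confined_le coord_space by simp

lemma AE_X: "AE \<omega> in M. \<forall>j\<in>{1..d}. X \<omega> j \<in> (\<Union>n. K j n)"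
  by (intro AE_finite_allI AE_distrD[OF X_coord XK]) auto

text \<open>Each coordinate of each sample has the law of the corresponding marginal, and there are
  countably many conditions.\<close>

lemma AE_Xs: "AE \<omega> in M. \<forall>i\<in>{1..}. \<forall>j\<in>{1..d}. Xs i \<omega> j \<in> (\<Union>n. K j n)"
proof -
  have "AE \<omega> in M. Xs i \<omega> j \<in> (\<Union>n. K j n)" if i: "i \<in> {1..}" and j: "j \<in> {1..d}" for i j
  proof -
    have "distr M (metric_borel (S j)) (\<lambda>\<omega>. Xs i \<omega> j) = distr (distr M N (Xs i)) (metric_borel (S j)) (\<lambda>x. x j)"
      using distr_distr[OF coord_measurable[OF j] measurable_Y, of i] i by (simp add: comp_def)
    also have "\<dots> = marg j"
      using law[of i] i distr_distr[OF coord_measurable[OF j] X] by (simp add: comp_def)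
    finally have eq: "distr M (metric_borel (S j)) (\<lambda>\<omega>. Xs i \<omega> j) = marg j" .
    have "AE x in distr M (metric_borel (S j)) (\<lambda>\<omega>. Xs i \<omega> j). x \<in> (\<Union>n. K j n)"
      unfolding eq by (rule XK[OF j])
    then show ?thesis
      by (rule AE_distrD[rotated]) (use measurable_compose[OF measurable_Y coord_measurable[OF j], of i] i in simp)
  qed
  then have "AE \<omega> in M. \<forall>j\<in>{1..d}. Xs i \<omega> j \<in> (\<Union>n. K j n)" if "i \<in> {1..}" for i
    using that by (intro AE_finite_allI) auto
  then show ?thesis by (subst AE_ball_countable) auto
qed

lemma integral_P:
  fixes f :: "(nat \<Rightarrow> 'a) \<Rightarrow> real"
  assumes "f \<in> borel_measurable N"
  shows "(\<integral>x. f x \<partial>P) = (\<integral>\<omega>. f (X \<omega>) \<partial>M)"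
  using assms by (rule integral_distr[OF X])

lemma integral_marg:
  fixes f :: "'a \<Rightarrow> real"
  assumes "j \<in> {1..d}" "f \<in> borel_measurable (metric_borel (S j))"
  shows "(\<integral>x. f x \<partial>marg j) = (\<integral>\<omega>. f (X \<omega> j) \<partial>M)"
  using assms(2) by (rule integral_distr[OF X_coord[OF assms(1)]])

lemma prob_space_marg: "j \<in> {1..d} \<Longrightarrow> prob_space (marg j)"
  by (rule prob_space_distr[OF X_coord])

section \<open>Mean embeddings of the law and of the product of its marginals\<close>

definition marg_mean :: "nat \<Rightarrow> 'a \<Rightarrow> real" where
  "marg_mean j t = (\<integral>s. confined j t s \<partial>marg j)"

lemma marg_mean_measurable:
  assumes j: "j \<in> {1..d}"
  shows "marg_mean j \<in> borel_measurable (metric_borel (S j))"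
proof -
  interpret m: prob_space "marg j" using prob_space_marg[OF j] .
  have "(\<lambda>(x, y). confined j x y) \<in> borel_measurable (metric_borel (S j) \<Otimes>\<^sub>M marg j)"
    using confined_measurable[OF j] by (simp cong: measurable_cong_sets sets_pair_measure_cong)
  then show ?thesis unfolding marg_mean_def[abs_def] by (rule m.borel_measurable_lebesgue_integral)
qed

lemma confined_section_measurable:
  assumes "j \<in> {1..d}" "t \<in> mspace (S j)"
  shows "confined j t \<in> borel_measurable (metric_borel (S j))"
  using measurable_compose[OF measurable_Pair1' confined_measurable[OF assms(1)], of t] assms(2) by simp

lemma marg_mean_le:
  assumes j: "j \<in> {1..d}" and t: "t \<in> mspace (S j)"
  shows "\<bar>marg_mean j t\<bar> \<le> \<kappa>"
proof -
  interpret m: prob_space "marg j" using prob_space_marg[OF j] .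
  have "integrable (marg j) (confined j t)"
    using confined_section_measurable[OF j t] confined_le[OF j t] by (intro m.integrable_const_bound[of _ \<kappa>]) auto
  then have le: "(\<integral>s. \<bar>confined j t s\<bar> \<partial>marg j) \<le> (\<integral>s. \<kappa> \<partial>marg j)"
    using confined_le[OF j t] by (intro integral_mono) auto
  have "(\<integral>s. \<kappa> \<partial>marg j) = \<kappa>" using m.prob_space by simp
  then show ?thesis using order_trans[OF integral_abs_bound le] by (simp only: marg_mean_def)
qed

lemma marg_mean_eq:
  assumes j: "j \<in> {1..d}" and t: "t \<in> mspace (S j)"
  shows "marg_mean j t = (\<integral>s. k j t s \<partial>marg j)"
  unfolding marg_mean_def
proof (rule integral_cong_AE)
  show "confined j t \<in> borel_measurable (marg j)" "k j t \<in> borel_measurable (marg j)"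
    using confined_section_measurable[OF j t] k_measurable[OF j t] by simp_all
  show "AE s in marg j. confined j t s = k j t s"
    using XK[OF j] by eventually_elim (simp add: confined_def)
qed

lemma partial_mean_coord_kernel:
  assumes j: "j \<in> {1..d}" and x: "x \<in> space N"
  shows "partial_mean (coord_kernel j) x = marg_mean j (x j)"
proof -
  have "partial_mean (coord_kernel j) x = (\<integral>\<omega>. confined j (x j) (X \<omega> j) \<partial>M)"
    unfolding partial_mean_def coord_kernel_def
    using measurable_compose[OF coord_measurable[OF j] confined_section_measurable[OF j coord_space[OF x j]]]
    by (subst integral_P) simp_all
  also have "\<dots> = marg_mean j (x j)"
    unfolding marg_mean_def by (rule integral_marg[OF j confined_section_measurable[OF j coord_space[OF x j]], symmetric])
  finally show ?thesis .
qed

lemma tensor_measurable: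
  assumes x: "x \<in> space N"
  shows "tensor_kernel d k x \<in> borel_measurable N"
  unfolding tensor_kernel_def[abs_def]
  by (intro borel_measurable_prod measurable_compose[OF coord_measurable k_measurable] coord_space[OF x])

lemma partial_mean_prod_coord_kernel:
  assumes x: "x \<in> space N"
  shows "partial_mean (\<lambda>z. \<Prod>j=1..d. coord_kernel j z) x = (\<integral>y. tensor_kernel d k x y \<partial>P)"
proof -
  have m: "(\<lambda>y. \<Prod>j=1..d. coord_kernel j (x, y)) \<in> borel_measurable N"
    by (intro borel_measurable_prod measurable_compose[OF measurable_Pair1' coord_kernel_measurable] x)
  show ?thesis
    unfolding partial_mean_def integral_P[OF m] integral_P[OF tensor_measurable[OF x]]
  proof (rule integral_cong_AE)
    show "AE \<omega> in M. (\<Prod>j=1..d. coord_kernel j (x, X \<omega>)) = tensor_kernel d k x (X \<omega>)"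
      using AE_X
    proof eventually_elim
      case (elim \<omega>)
      then show ?case unfolding tensor_kernel_def by (intro prod.cong) (auto simp: coord_kernel_def confined_def)
    qed
  qed (use measurable_compose[OF X m] measurable_compose[OF X tensor_measurable[OF x]] in auto)
qed

lemma integral_product_of_marginals:
  assumes f: "\<And>j. j \<in> {1..d} \<Longrightarrow> f j \<in> borel_measurable (metric_borel (S j))"
    and b: "\<And>j x. j \<in> {1..d} \<Longrightarrow> x \<in> mspace (S j) \<Longrightarrow> \<bar>f j x :: real\<bar> \<le> c"
  shows "(\<integral>x. (\<Prod>j=1..d. f j (x j)) \<partial>(\<Pi>\<^sub>M j\<in>{1..d}. marg j)) = (\<Prod>j=1..d. \<integral>x. f j x \<partial>marg j)"
proof -
  \<comment> \<open>As before, one-point probability spaces fill the indices outside the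
    range.\<close>
  define L where "L j = (if j \<in> {1..d} then marg j else count_space {undefined})" for j
  have pL: "prob_space (L j)" for j
    using prob_space_marg[of j] by (auto simp: L_def intro!: prob_spaceI)
  interpret L: product_prob_space L UNIV by (intro product_prob_spaceI pL)
  have "(\<Pi>\<^sub>M j\<in>{1..d}. marg j) = (\<Pi>\<^sub>M j\<in>{1..d}. L j)" by (intro PiM_cong) (auto simp: L_def)
  then have "(\<integral>x. (\<Prod>j=1..d. f j (x j)) \<partial>(\<Pi>\<^sub>M j\<in>{1..d}. marg j)) = (\<integral>x. (\<Prod>j=1..d. f j (x j)) \<partial>(\<Pi>\<^sub>M j\<in>{1..d}. L j))"
    by simp
  also have "\<dots> = (\<Prod>j=1..d. \<integral>x. f j x \<partial>L j)"
  proof (rule L.product_integral_prod)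
    fix j assume j: "j \<in> {1..d}"
    interpret m: prob_space "marg j" using prob_space_marg[OF j] .
    have "integrable (marg j) (f j)" using f[OF j] b[OF j] by (intro m.integrable_const_bound[of _ c]) auto
    then show "integrable (L j) (f j)" using j by (simp add: L_def)
  qed simp
  also have "\<dots> = (\<Prod>j=1..d. \<integral>x. f j x \<partial>marg j)" by (intro prod.cong) (auto simp: L_def)
  finally show ?thesis .
qed

text \<open>The embeddings are themselves elements of \<open>H\<close>, so each may be inserted as a
  test function into the defining property of the other. This expresses all three integrals as inner
  products, which combine to a squared distance.\<close>

lemma gram_limit_pos: "gram_limit d coord_kernel > 0"
proof -
  let ?Q = "\<Pi>\<^sub>M j\<in>{1..d}. marg j"
  obtain H ip where rk: "is_rkhs (space N) (tensor_kernel d k) H ip"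
    and ex: "\<forall>P. prob_space P \<and> sets P = sets N \<longrightarrow> (\<exists>\<mu>. is_mean_embedding H ip P \<mu>)"
    and inj: "\<forall>P Q \<mu> \<nu>. prob_space P \<and> sets P = sets N \<and> prob_space Q \<and> sets Q = sets N \<and>
           is_mean_embedding H ip P \<mu> \<and> is_mean_embedding H ip Q \<nu> \<longrightarrow>
           (ip_norm ip (\<lambda>x. \<mu> x - \<nu> x) = 0 \<longleftrightarrow> P = Q)"
    using char unfolding characteristic_kernel_def by (elim exE conjE) (rule that)
  note fh = rkhs_fhs[OF rk]
  have P: "prob_space P" "sets P = sets N" using prob_space_P by simp_all
  have sQ: "sets ?Q = sets N" unfolding prod_borel_def by (intro sets_PiM_cong) auto
  have pQ: "prob_space ?Q" by (intro prob_space_PiM prob_space_marg)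
  have spQ: "space ?Q = space N" using sets_eq_imp_space_eq[OF sQ] .
  have spP: "space P = space N" by simp
  obtain \<mu> \<nu> where \<mu>: "is_mean_embedding H ip P \<mu>" and \<nu>: "is_mean_embedding H ip ?Q \<nu>"
    using ex P pQ sQ by blast
  have mH: "\<mu> \<in> H" "\<nu> \<in> H" using \<mu> \<nu> unfolding is_mean_embedding_def by blast+
  \<comment> \<open>Both embeddings are written as explicit functions on the whole product space, in
    terms of the cut kernels that occur in \<open>gram_limit\<close>.\<close>
  have \<mu>_eq: "\<mu> x = partial_mean (\<lambda>z. \<Prod>j=1..d. coord_kernel j z) x" if "x \<in> space N" for x
    using mean_embedding_eval(2)[OF rk spP \<mu> that] partial_mean_prod_coord_kernel[OF that] by simp
  have \<nu>_eq: "\<nu> x = (\<Prod>j=1..d. marg_mean j (x j))" if x: "x \<in> space N" for x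
  proof -
    have "\<nu> x = (\<integral>y. (\<Prod>j=1..d. k j (x j) (y j)) \<partial>?Q)"
      using mean_embedding_eval(2)[OF rk spQ \<nu> x] by (simp add: tensor_kernel_def)
    also have "\<dots> = (\<Prod>j=1..d. \<integral>s. k j (x j) s \<partial>marg j)"
      by (rule integral_product_of_marginals[where c=\<kappa>]) (use k_measurable k_le coord_space[OF x] in auto)
    also have "\<dots> = (\<Prod>j=1..d. marg_mean j (x j))" by (intro prod.cong refl marg_mean_eq[symmetric] coord_space[OF x])
    finally show ?thesis .
  qed
  have "ip \<mu> \<mu> = (\<integral>x. \<mu> x \<partial>P)" "ip \<nu> \<mu> = (\<integral>x. \<nu> x \<partial>P)" "ip \<nu> \<nu> = (\<integral>x. \<nu> x \<partial>?Q)"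
    using \<mu> \<nu> mH unfolding is_mean_embedding_def by simp_all
  moreover have "(\<integral>x. \<mu> x \<partial>P) = (\<integral>x. partial_mean (\<lambda>z. \<Prod>j=1..d. coord_kernel j z) x \<partial>P)"
    by (rule Bochner_Integration.integral_cong[OF refl \<mu>_eq]) simp
  moreover have "(\<integral>x. \<nu> x \<partial>P) = (\<integral>x. (\<Prod>j=1..d. partial_mean (coord_kernel j) x) \<partial>P)"
    by (rule Bochner_Integration.integral_cong[OF refl]) (simp add: \<nu>_eq partial_mean_coord_kernel)
  moreover have "(\<integral>x. \<nu> x \<partial>?Q) = (\<Prod>j=1..d. \<integral>x. partial_mean (coord_kernel j) x \<partial>P)"
  proof -
    have "(\<integral>x. \<nu> x \<partial>?Q) = (\<integral>x. (\<Prod>j=1..d. marg_mean j (x j)) \<partial>?Q)"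
      by (rule Bochner_Integration.integral_cong[OF refl \<nu>_eq]) (simp only: spQ)
    also have "\<dots> = (\<Prod>j=1..d. \<integral>s. marg_mean j s \<partial>marg j)"
      by (rule integral_product_of_marginals[where c=\<kappa>]) (use marg_mean_measurable marg_mean_le in auto)
    also have "\<dots> = (\<Prod>j=1..d. \<integral>x. partial_mean (coord_kernel j) x \<partial>P)"
    proof (rule prod.cong[OF refl])
      fix j assume j: "j \<in> {1..d}"
      have "(\<integral>x. partial_mean (coord_kernel j) x \<partial>P) = (\<integral>x. marg_mean j (x j) \<partial>P)"
        by (rule Bochner_Integration.integral_cong[OF refl partial_mean_coord_kernel[OF j]]) simp
      also have "\<dots> = (\<integral>\<omega>. marg_mean j (X \<omega> j) \<partial>M)"
        by (rule integral_P[OF measurable_compose[OF coord_measurable[OF j] marg_mean_measurable[OF j]]])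
      also have "\<dots> = (\<integral>s. marg_mean j s \<partial>marg j)" by (rule integral_marg[OF j marg_mean_measurable[OF j], symmetric])
      finally show "(\<integral>s. marg_mean j s \<partial>marg j) = (\<integral>x. partial_mean (coord_kernel j) x \<partial>P)" by simp
    qed
    finally show ?thesis .
  qed
  ultimately have "gram_limit d coord_kernel = ip \<mu> \<mu> - 2 * ip \<mu> \<nu> + ip \<nu> \<nu>"
    unfolding gram_limit_def using fhs_commute[OF fh mH] by simp
  also have "\<dots> = ip (\<lambda>x. \<mu> x - \<nu> x) (\<lambda>x. \<mu> x - \<nu> x)" by (rule fhs_ip_diff_self[OF fh mH, symmetric])
  finally have eq: "gram_limit d coord_kernel = ip (\<lambda>x. \<mu> x - \<nu> x) (\<lambda>x. \<mu> x - \<nu> x)" .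
  have "ip_norm ip (\<lambda>x. \<mu> x - \<nu> x) \<noteq> 0"
    using inj[rule_format, of P ?Q \<mu> \<nu>] P pQ sQ \<mu> \<nu> dep by simp
  then have "gram_limit d coord_kernel \<noteq> 0" unfolding eq ip_norm_def by simp
  moreover have "gram_limit d coord_kernel \<ge> 0" unfolding eq using fhs_nonneg[OF fh fhs_diff[OF fh mH]] .
  ultimately show ?thesis by simp
qed

end

section \<open>Tail of the original statistic and mean of a permuted one\<close>

context dependent_sample
begin

text \<open>\<open>p j\<close> relabels the data points in coordinate \<open>j\<close>: the identity
  gives the original data, \<open>perm_at \<sigma>\<close> the permuted data.\<close>

definition stat :: "nat \<Rightarrow> (nat \<Rightarrow> nat \<Rightarrow> nat) \<Rightarrow> 'w \<Rightarrow> real" where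
  "stat n p \<omega> = gram_stat d n (\<lambda>j a b. k j (Xs (p j a) \<omega> j) (Xs (p j b) \<omega> j))"

definition confined_stat :: "nat \<Rightarrow> (nat \<Rightarrow> nat \<Rightarrow> nat) \<Rightarrow> 'w \<Rightarrow> real" where
  "confined_stat n p \<omega> = gram_stat d n (\<lambda>j a b. coord_kernel j (Xs (p j a) \<omega>, Xs (p j b) \<omega>))"

text \<open>The locale provides measurability for products along index tuples of length
  \<open>2 * d\<close>; interleaving \<open>p\<close> and \<open>q\<close> gives such a tuple, and
  repeated indices are allowed.\<close>

lemma prod_measurable:
  assumes n: "n \<ge> 2 * d" and pq: "\<And>j. j \<in> {1..d} \<Longrightarrow> p j \<in> {1..n}" "\<And>j. j \<in> {1..d} \<Longrightarrow> q j \<in> {1..n}"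
  shows "(\<lambda>\<omega>. \<Prod>j=1..d. k j (Xs (p j) \<omega> j) (Xs (q j) \<omega> j)) \<in> borel_measurable M"
proof -
  define i where "i = (\<lambda>m\<in>{1..2 * d}. if odd m then p (Suc (m div 2)) else q (m div 2))"
  have "Suc (m div 2) \<in> {1..d}" if "m \<in> {1..2 * d}" "odd m" for m
    using that by (auto elim!: oddE)
  moreover have "m div 2 \<in> {1..d}" if "m \<in> {1..2 * d}" "even m" for m
    using that by (auto elim!: evenE)
  ultimately have "i \<in> index_tuples (2 * d) n"
    unfolding i_def index_tuples_def using pq by (intro restrict_PiE_iff[THEN iffD2] ballI) auto
  moreover have "i (2 * j - 1) = p j" "i (2 * j) = q j" if "j \<in> {1..d}" for j
  proof -
    have "2 * j - 1 \<in> {1..2 * d}" "2 * j \<in> {1..2 * d}" "odd (2 * j - 1)" "Suc ((2 * j - 1) div 2) = j"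
      using that by auto
    then show "i (2 * j - 1) = p j" "i (2 * j) = q j" unfolding i_def by simp_all
  qed
  ultimately show ?thesis using meas[OF n, of i] by (simp cong: prod.cong_simp)
qed

text \<open>What is known to be measurable are full products over all coordinates, so the statistic
  is taken in its expanded form \<open>dHSIC\<close>, where every summand is such a product.\<close>

lemma stat_measurable:
  assumes n: "n \<ge> 2 * d" and p: "\<And>j a. j \<in> {1..d} \<Longrightarrow> a \<in> {1..n} \<Longrightarrow> p j a \<in> {1..n}"
  shows "stat n p \<in> borel_measurable M"
proof -
  have "stat n p = (\<lambda>\<omega>. dHSIC d k n (\<lambda>a j. Xs (p j a) \<omega> j))"
    by (simp add: fun_eq_iff stat_def dHSIC_eq_gram_stat)
  also have "\<dots> \<in> borel_measurable M"
    unfolding dHSIC_def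
  proof (intro borel_measurable_add borel_measurable_diff borel_measurable_times borel_measurable_const borel_measurable_sum)
    fix i assume "i \<in> index_tuples 2 n"
    then have "i 1 \<in> {1..n}" "i 2 \<in> {1..n}" unfolding index_tuples_def by auto
    then show "(\<lambda>\<omega>. \<Prod>j=1..d. k j (Xs (p j (i 1)) \<omega> j) (Xs (p j (i 2)) \<omega> j)) \<in> borel_measurable M"
      using p by (intro prod_measurable[OF n]) auto
  next
    fix i assume i: "i \<in> index_tuples (2 * d) n"
    have "i (2 * j - 1) \<in> {1..n}" "i (2 * j) \<in> {1..n}" if "j \<in> {1..d}" for j
    proof -
      have "2 * j - 1 \<in> {1..2 * d}" "2 * j \<in> {1..2 * d}" using that by auto
      then show "i (2 * j - 1) \<in> {1..n}" "i (2 * j) \<in> {1..n}"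
        using i unfolding index_tuples_def by (blast dest: PiE_mem)+
    qed
    then show "(\<lambda>\<omega>. \<Prod>j=1..d. k j (Xs (p j (i (2 * j - 1))) \<omega> j) (Xs (p j (i (2 * j))) \<omega> j)) \<in> borel_measurable M"
      using p by (intro prod_measurable[OF n]) blast+
  next
    fix i assume i: "i \<in> index_tuples (d + 1) n"
    then have "i 1 \<in> {1..n}" "\<And>j. j \<in> {1..d} \<Longrightarrow> i (j + 1) \<in> {1..n}"
      unfolding index_tuples_def by auto
    then show "(\<lambda>\<omega>. \<Prod>j=1..d. k j (Xs (p j (i 1)) \<omega> j) (Xs (p j (i (j + 1))) \<omega> j)) \<in> borel_measurable M"
      using p by (intro prod_measurable[OF n]) blast+
  qed
  finally show ?thesis .
qed

lemma AE_stat: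
  assumes p: "\<And>j a. j \<in> {1..d} \<Longrightarrow> a \<in> {1..n} \<Longrightarrow> p j a \<in> {1..n}"
  shows "AE \<omega> in M. stat n p \<omega> = confined_stat n p \<omega>"
  using AE_Xs
proof eventually_elim
  case (elim \<omega>)
  show ?case unfolding stat_def confined_stat_def
  proof (rule gram_stat_cong)
    fix j a b assume "j \<in> {1..d}" "a \<in> {1..n}" "b \<in> {1..n}"
    then show "k j (Xs (p j a) \<omega> j) (Xs (p j b) \<omega> j) = coord_kernel j (Xs (p j a) \<omega>, Xs (p j b) \<omega>)"
      using elim p[of j b] by (simp add: coord_kernel_def confined_def)
  qed
qed

text \<open>This rests on positive semidefiniteness of the true tensor kernel. The cut kernels are
  in general not symmetric, so nonnegativity is shown for \<open>stat\<close> and not for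
  \<open>confined_stat\<close>.\<close>

lemma stat_nonneg:
  assumes p: "\<And>j a. j \<in> {1..d} \<Longrightarrow> a \<in> {1..n} \<Longrightarrow> p j a \<in> {1..n}" and n: "n \<ge> 1" and \<omega>: "\<omega> \<in> space M"
  shows "stat n p \<omega> \<ge> 0"
proof -
  obtain H ip where rk: "is_rkhs (space N) (tensor_kernel d k) H ip"
    using char unfolding characteristic_kernel_def by blast
  have "gram_stat d n (\<lambda>j a b. k j ((\<lambda>a j. Xs (p j a) \<omega> j) a j) ((\<lambda>a j. Xs (p j a) \<omega> j) b j)) \<ge> 0"
  proof (rule gram_stat_nonneg[OF rk n])
    fix g assume g: "g \<in> {1..d} \<rightarrow>\<^sub>E {1..n}"
    have "Xs (p j (g j)) \<omega> j \<in> mspace (S j)" if j: "j \<in> {1..d}" for j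
    proof -
      have "p j (g j) \<in> {1..n}" using p[OF j PiE_mem[OF g j]] .
      then show ?thesis using coord_space[OF Y_space[OF _ \<omega>] j] by simp
    qed
    then show "(\<lambda>j\<in>{1..d}. Xs (p j (g j)) \<omega> j) \<in> space N" by (simp add: space_prod_borel)
  qed
  then show ?thesis by (simp add: stat_def)
qed

text \<open>A value of at most half the limit deviates from it by at least that half, so Markov's
  inequality applies to the mean deviation. The latter is bounded for the cut kernels and
  transferred by almost sure equality.\<close>

lemma original_tail:
  "\<exists>c\<ge>0. \<forall>n\<ge>2 * d. measure M {\<omega> \<in> space M. stat n (\<lambda>j a. a) \<omega> \<le> gram_limit d coord_kernel / 2} \<le> c / sqrt n"
proof -
  define \<delta> where "\<delta> = gram_limit d coord_kernel"
  have \<delta>: "\<delta> > 0" unfolding \<delta>_def by (rule gram_limit_pos)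
  obtain c where c: "c \<ge> 0" and c_int: "\<And>n. n \<ge> 1 \<Longrightarrow> integrable M (\<lambda>\<omega>. \<bar>confined_stat n (\<lambda>j a. a) \<omega> - \<delta>\<bar>)"
    and c_le: "\<And>n. n \<ge> 1 \<Longrightarrow> (\<integral>\<omega>. \<bar>confined_stat n (\<lambda>j a. a) \<omega> - \<delta>\<bar> \<partial>M) \<le> c / sqrt n"
    using gram_stat_L1[of d coord_kernel \<kappa>, OF coord_kernel_measurable coord_kernel_le \<kappa>] unfolding confined_stat_def \<delta>_def by auto
  show ?thesis
  proof (intro exI[of _ "c / (\<delta> / 2)"] conjI allI impI)
    show "c / (\<delta> / 2) \<ge> 0" using c \<delta> by simp
    fix n assume n: "n \<ge> 2 * d"
    then have n1: "n \<ge> 1" using d by simp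
    let ?A = "{\<omega> \<in> space M. stat n (\<lambda>j a. a) \<omega> \<le> \<delta> / 2}"
    let ?D = "\<lambda>\<omega>. \<bar>stat n (\<lambda>j a. a) \<omega> - \<delta>\<bar>"
    have sm: "stat n (\<lambda>j a. a) \<in> borel_measurable M" by (rule stat_measurable[OF n])
    have ae: "AE \<omega> in M. \<bar>confined_stat n (\<lambda>j a. a) \<omega> - \<delta>\<bar> = ?D \<omega>"
      using AE_stat[of n "\<lambda>j a. a"] by (auto elim: eventually_mono)
    have Dm: "?D \<in> borel_measurable M" using sm by simp
    have iD: "integrable M ?D"
      using integrable_cong_AE_imp[OF c_int[OF n1] Dm] ae by (auto elim: eventually_mono)
    have "measure M ?A \<le> measure M {\<omega> \<in> space M. ?D \<omega> \<ge> \<delta> / 2}"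
    proof (rule finite_measure_mono)
      have "\<delta> / 2 \<le> \<bar>y - \<delta>\<bar>" if "y \<le> \<delta> / 2" for y using that \<delta> by linarith
      then show "?A \<subseteq> {\<omega> \<in> space M. ?D \<omega> \<ge> \<delta> / 2}" by blast
    qed (use Dm in measurable)
    also have "\<dots> \<le> (\<integral>\<omega>. ?D \<omega> \<partial>M) / (\<delta> / 2)"
      using \<delta> by (intro integral_Markov_inequality_measure[OF iD sets.top]) auto
    also have "(\<integral>\<omega>. ?D \<omega> \<partial>M) = (\<integral>\<omega>. \<bar>confined_stat n (\<lambda>j a. a) \<omega> - \<delta>\<bar> \<partial>M)"
      using integral_cong_AE[OF borel_measurable_integrable[OF c_int[OF n1]] Dm ae] by simp
    also have "\<dots> / (\<delta> / 2) \<le> (c / sqrt n) / (\<delta> / 2)"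
      using \<delta> by (intro divide_right_mono c_le[OF n1]) simp
    finally show "measure M {\<omega> \<in> space M. stat n (\<lambda>j a. a) \<omega> \<le> gram_limit d coord_kernel / 2} \<le> c / (\<delta> / 2) / sqrt n"
      by (simp add: \<delta>_def mult.commute)
  qed
qed

text \<open>Splitting by the value of \<phi> and using independence from the data, the mean becomes
  an expected average over all permutation vectors, to which the deterministic bound applies.
  Independence is available for the whole collection \<open>Z\<close> of permutation vectors, of
  which \<phi> is the component \<open>b\<close>.\<close>

lemma permuted_mean:
  assumes n: "n \<ge> 2 * d"
    and unif: "uniform_perm_vector M d n \<phi>"
    and b: "b \<in> J" and Z: "\<And>\<omega>. \<omega> \<in> space M \<Longrightarrow> Z \<omega> b = \<phi> \<omega>"
    and ind: "indep_elements M (\<Pi>\<^sub>M i\<in>{1..n}. N) (\<lambda>\<omega>. \<lambda>i\<in>{1..n}. Xs i \<omega>) (\<Pi>\<^sub>M b\<in>J. perm_vectors d n) Z"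
  shows "integrable M (\<lambda>\<omega>. stat n (perm_at (\<phi> \<omega>)) \<omega>)"
    "(\<integral>\<omega>. stat n (perm_at (\<phi> \<omega>)) \<omega> \<partial>M) \<le> (2 * real d + 2) * \<kappa> ^ (d + 1) / real n"
proof -
  have n1: "n \<ge> 1" "n \<ge> 2" and d1: "d \<ge> 1" using d n by auto
  let ?D = "\<lambda>\<omega>. \<lambda>i\<in>{1..n}. Xs i \<omega>"
  have at: "perm_at \<sigma> j a \<in> {1..n}" if "\<sigma> \<in> perm_tuples d n" "j \<in> {1..d}" "a \<in> {1..n}" for \<sigma> j a
    using permutes_in_image[OF perm_at_permutes[OF that(1,2)]] that(3) by blast
  have \<phi>m: "\<phi> \<in> M \<rightarrow>\<^sub>M perm_vectors d n" using unif unfolding uniform_perm_vector_def by blast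
  have \<phi>: "\<phi> \<omega> \<in> perm_tuples d n" if "\<omega> \<in> space M" for \<omega>
    using measurable_space[OF \<phi>m that] by (simp add: space_perm_vectors)
  \<comment> \<open>The cut statistic as a measurable function of the data array \<open>u\<close>,
    the form in which independence can be applied.\<close>
  define f where "f \<sigma> u = gram_stat d n (\<lambda>j a b. coord_kernel j (u (perm_at \<sigma> j a), u (perm_at \<sigma> j b)))"
    for \<sigma> and u :: "nat \<Rightarrow> nat \<Rightarrow> 'a"
  have f_stat: "f \<sigma> (?D \<omega>) = confined_stat n (perm_at \<sigma>) \<omega>" if "\<sigma> \<in> perm_tuples d n" for \<sigma> \<omega>
    unfolding f_def confined_stat_def using at[OF that] by (intro gram_stat_cong) simp
  have f_meas: "f \<sigma> \<in> borel_measurable (\<Pi>\<^sub>M i\<in>{1..n}. N)" if \<sigma>: "\<sigma> \<in> perm_tuples d n" for \<sigma>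
  proof -
    have "(\<lambda>u. coord_kernel j (u (perm_at \<sigma> j a), u (perm_at \<sigma> j b))) \<in> borel_measurable (\<Pi>\<^sub>M i\<in>{1..n}. N)"
      if "j \<in> {1..d}" "a \<in> {1..n}" "b \<in> {1..n}" for j a b
      by (rule measurable_compose[OF measurable_Pair coord_kernel_measurable[OF that(1)]])
        (intro measurable_component_singleton at[OF \<sigma>] that)+
    then show ?thesis
      unfolding f_def[abs_def] gram_stat_def
      by (intro borel_measurable_add borel_measurable_diff borel_measurable_times borel_measurable_divide
          borel_measurable_sum borel_measurable_prod borel_measurable_const)
  qed
  have D_meas: "?D \<in> M \<rightarrow>\<^sub>M (\<Pi>\<^sub>M i\<in>{1..n}. N)" using ind unfolding indep_elements_def by blast
  have Z_meas: "Z \<in> M \<rightarrow>\<^sub>M (\<Pi>\<^sub>M b\<in>J. perm_vectors d n)" using ind unfolding indep_elements_def by blast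
  have confined_stat_le: "\<bar>confined_stat n (perm_at \<sigma>) \<omega>\<bar> \<le> 4 * \<kappa> ^ d" if "\<sigma> \<in> perm_tuples d n" "\<omega> \<in> space M" for \<sigma> \<omega>
    unfolding confined_stat_def
  proof (rule gram_stat_le[OF n1(1)])
    fix j a b assume j: "j \<in> {1..d}" and ab: "a \<in> {1..n}" "b \<in> {1..n}"
    show "\<bar>coord_kernel j (Xs (perm_at \<sigma> j a) \<omega>, Xs (perm_at \<sigma> j b) \<omega>)\<bar> \<le> \<kappa>"
      using at[OF that(1) j ab(1)] at[OF that(1) j ab(2)] that(2) by (intro coord_kernel_le[OF j] Y_space) auto
  qed
  have i_f: "integrable M (\<lambda>\<omega>. f \<sigma> (?D \<omega>))" if \<sigma>: "\<sigma> \<in> perm_tuples d n" for \<sigma>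
    using measurable_compose[OF D_meas f_meas[OF \<sigma>]] confined_stat_le[OF \<sigma>] f_stat[OF \<sigma>]
    by (intro integrable_bounded[of _ "4 * \<kappa> ^ d"]) simp_all
  have h_meas: "(\<lambda>z. indicator {\<sigma>} (z b) :: real) \<in> borel_measurable (\<Pi>\<^sub>M b\<in>J. perm_vectors d n)"
    if "\<sigma> \<in> perm_tuples d n" for \<sigma>
    by (rule measurable_compose[OF measurable_component_singleton[OF b] borel_measurable_indicator[OF sing_in_perm_vectors[OF that]]])
  have i_h: "integrable M (\<lambda>\<omega>. indicator {\<sigma>} (Z \<omega> b) :: real)" if "\<sigma> \<in> perm_tuples d n" for \<sigma>
    using measurable_compose[OF Z_meas h_meas[OF that]]
    by (intro integrable_bounded[of _ 1]) (auto simp: indicator_def)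
  have int_e: "(\<integral>\<omega>. indicat_real {\<sigma>} (Z \<omega> b) \<partial>M) = 1 / fact n ^ (d - 1)" if \<sigma>: "\<sigma> \<in> perm_tuples d n" for \<sigma>
  proof -
    have "(\<integral>\<omega>. indicat_real {\<sigma>} (Z \<omega> b) \<partial>M) = (\<integral>\<omega>. indicat_real {\<omega> \<in> space M. \<phi> \<omega> = \<sigma>} \<omega> \<partial>M)"
      by (rule Bochner_Integration.integral_cong[OF refl]) (simp add: Z indicator_def)
    also have "\<dots> = measure M ({\<omega> \<in> space M. \<phi> \<omega> = \<sigma>} \<inter> space M)" by simp
    also have "{\<omega> \<in> space M. \<phi> \<omega> = \<sigma>} \<inter> space M = {\<omega> \<in> space M. \<phi> \<omega> = \<sigma>}" by auto
    also have "measure M {\<omega> \<in> space M. \<phi> \<omega> = \<sigma>} = 1 / fact n ^ (d - 1)" by (rule uniform_perm_vector_prob[OF prob_space_axioms d unif \<sigma>])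
    finally show ?thesis .
  qed
  have prod: "integrable M (\<lambda>\<omega>. f \<sigma> (?D \<omega>) * indicator {\<sigma>} (Z \<omega> b))"
    "(\<integral>\<omega>. f \<sigma> (?D \<omega>) * indicator {\<sigma>} (Z \<omega> b) \<partial>M) = (\<integral>\<omega>. f \<sigma> (?D \<omega>) \<partial>M) * (1 / fact n ^ (d - 1))"
    if \<sigma>: "\<sigma> \<in> perm_tuples d n" for \<sigma>
    using indep_elements_integral[OF prob_space_axioms ind f_meas[OF \<sigma>] h_meas[OF \<sigma>], OF i_f[OF \<sigma>] i_h[OF \<sigma>]]
    by (simp_all only: int_e[OF \<sigma>])
  \<comment> \<open>Permutation vectors take finitely many values, so conditioning on one amounts to
    a finite sum with indicators.\<close>
  have decomp: "stat n (perm_at (\<phi> \<omega>)) \<omega> = (\<Sum>\<sigma>\<in>perm_tuples d n. stat n (perm_at \<sigma>) \<omega> * indicator {\<sigma>} (Z \<omega> b))"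
    if "\<omega> \<in> space M" for \<omega>
  proof -
    have "(\<Sum>\<sigma>\<in>perm_tuples d n. stat n (perm_at \<sigma>) \<omega> * indicator {\<sigma>} (Z \<omega> b))
        = (\<Sum>\<sigma>\<in>perm_tuples d n. if \<sigma> = \<phi> \<omega> then stat n (perm_at \<sigma>) \<omega> else 0)"
      by (intro sum.cong) (auto simp: Z[OF that] indicator_def)
    then show ?thesis using \<phi>[OF that] finite_perm_tuples by simp
  qed
  have ae: "AE \<omega> in M. (\<Sum>\<sigma>\<in>perm_tuples d n. f \<sigma> (?D \<omega>) * indicator {\<sigma>} (Z \<omega> b)) = stat n (perm_at (\<phi> \<omega>)) \<omega>"
  proof -
    have "AE \<omega> in M. \<forall>\<sigma>\<in>perm_tuples d n. stat n (perm_at \<sigma>) \<omega> = confined_stat n (perm_at \<sigma>) \<omega>"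
      using finite_perm_tuples at by (intro AE_finite_allI AE_stat) auto
    then show ?thesis using AE_space
    proof eventually_elim
      case (elim \<omega>)
      then show ?case unfolding decomp[OF elim(2)] by (intro sum.cong refl) (simp only: f_stat)
    qed
  qed
  have sm: "(\<lambda>\<omega>. stat n (perm_at (\<phi> \<omega>)) \<omega>) \<in> borel_measurable M"
  proof (subst measurable_cong[OF decomp])
    show "(\<lambda>\<omega>. \<Sum>\<sigma>\<in>perm_tuples d n. stat n (perm_at \<sigma>) \<omega> * indicator {\<sigma>} (Z \<omega> b)) \<in> borel_measurable M"
      using at i_h by (intro borel_measurable_sum borel_measurable_times stat_measurable[OF n] borel_measurable_integrable) auto
  qed
  have iS: "integrable M (\<lambda>\<omega>. \<Sum>\<sigma>\<in>perm_tuples d n. f \<sigma> (?D \<omega>) * indicator {\<sigma>} (Z \<omega> b))"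
    by (intro Bochner_Integration.integrable_sum prod)
  show "integrable M (\<lambda>\<omega>. stat n (perm_at (\<phi> \<omega>)) \<omega>)"
    by (rule integrable_cong_AE_imp[OF iS sm]) (use ae in \<open>auto elim: eventually_mono\<close>)
  have "(\<integral>\<omega>. stat n (perm_at (\<phi> \<omega>)) \<omega> \<partial>M) = (\<integral>\<omega>. (\<Sum>\<sigma>\<in>perm_tuples d n. f \<sigma> (?D \<omega>) * indicator {\<sigma>} (Z \<omega> b)) \<partial>M)"
    using integral_cong_AE[OF borel_measurable_integrable[OF iS] sm ae] by simp
  also have "\<dots> = (\<Sum>\<sigma>\<in>perm_tuples d n. (\<integral>\<omega>. f \<sigma> (?D \<omega>) \<partial>M) * (1 / fact n ^ (d - 1)))"
    by (subst Bochner_Integration.integral_sum[OF prod(1)]) (simp_all only: prod(2) cong: sum.cong)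
  also have "\<dots> = (\<integral>\<omega>. (\<Sum>\<sigma>\<in>perm_tuples d n. f \<sigma> (?D \<omega>)) \<partial>M) * (1 / fact n ^ (d - 1))"
    by (subst Bochner_Integration.integral_sum[OF i_f]) (simp_all only: sum_distrib_right)
  \<comment> \<open>The permutations are no longer random here: at each \<omega> the sum runs over
    all of them with the data fixed.\<close>
  also have "\<dots> \<le> (fact n ^ (d - 1) * ((2 * real d + 2) * \<kappa> ^ (d + 1) / real n)) * (1 / fact n ^ (d - 1))"
  proof (rule mult_right_mono[OF integral_le_bound])
    show "integrable M (\<lambda>\<omega>. \<Sum>\<sigma>\<in>perm_tuples d n. f \<sigma> (?D \<omega>))"
      by (intro Bochner_Integration.integrable_sum i_f)
    fix \<omega> assume \<omega>: "\<omega> \<in> space M"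
    have "(\<Sum>\<sigma>\<in>perm_tuples d n. f \<sigma> (?D \<omega>))
        = (\<Sum>\<sigma>\<in>perm_tuples d n. gram_stat d n (\<lambda>j a b. (\<lambda>j a b. coord_kernel j (Xs a \<omega>, Xs b \<omega>)) j (perm_at \<sigma> j a) (perm_at \<sigma> j b)))"
      by (intro sum.cong refl) (simp only: f_stat confined_stat_def)
    also have "\<dots> \<le> fact n ^ (d - 1) * ((2 * real d + 2) * \<kappa> ^ (d + 1) / real n)"
      by (rule gram_stat_perm_average[OF d1 n1(2) \<kappa>]) (intro coord_kernel_le Y_space \<omega>; simp)
    finally show "(\<Sum>\<sigma>\<in>perm_tuples d n. f \<sigma> (?D \<omega>)) \<le> fact n ^ (d - 1) * ((2 * real d + 2) * \<kappa> ^ (d + 1) / real n)" .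
  qed simp
  also have "\<dots> = (2 * real d + 2) * \<kappa> ^ (d + 1) / real n" by simp
  finally show "(\<integral>\<omega>. stat n (perm_at (\<phi> \<omega>)) \<omega> \<partial>M) \<le> (2 * real d + 2) * \<kappa> ^ (d + 1) / real n" .
qed

end

section \<open>Union bound and passage to the limit\<close>

theorem theorem6:
  fixes d :: nat and S :: "nat \<Rightarrow> 'a metric" and k :: "nat \<Rightarrow> 'a \<Rightarrow> 'a \<Rightarrow> real"
    and M :: "'w measure"
    and X :: "'w \<Rightarrow> nat \<Rightarrow> 'a" and Xs :: "nat \<Rightarrow> 'w \<Rightarrow> nat \<Rightarrow> 'a"
    and \<psi> :: "nat \<Rightarrow> nat \<Rightarrow> 'w \<Rightarrow> nat \<Rightarrow> nat \<Rightarrow> nat"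
    and C \<alpha> :: real and B :: nat
  assumes "d \<ge> 2"
    and "\<And>j. j \<in> {1..d} \<Longrightarrow> locally_compact_space (mtopology_of (S j))"
    and "\<And>j. j \<in> {1..d} \<Longrightarrow> c0_universal (S j) (k j)"
    and "characteristic_kernel (prod_borel d S) (tensor_kernel d k)"
    and "prob_space M"
    and "X \<in> M \<rightarrow>\<^sub>M prod_borel d S"
    and "distr M (prod_borel d S) X \<noteq>
           (\<Pi>\<^sub>M j\<in>{1..d}. distr M (metric_borel (S j)) (\<lambda>\<omega>. X \<omega> j))"
    and "prob_space.indep_vars M (\<lambda>i. prod_borel d S) Xs {1..}"
    and "\<And>i. i \<ge> 1 \<Longrightarrow> distr M (prod_borel d S) (Xs i) = distr M (prod_borel d S) X"
    and "C > 0"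
    and "\<And>n i. n \<ge> 2 * d \<Longrightarrow> i \<in> index_tuples (2 * d) n \<Longrightarrow>
           integrable M (\<lambda>\<omega>. \<Prod>j=1..d. k j (Xs (i (2 * j - 1)) \<omega> j) (Xs (i (2 * j)) \<omega> j)) \<and>
           (\<integral>\<omega>. \<bar>\<Prod>j=1..d. k j (Xs (i (2 * j - 1)) \<omega> j) (Xs (i (2 * j)) \<omega> j)\<bar> \<partial>M) < C"
    and "0 < \<alpha>" and "\<alpha> < 1"
    and "B \<ge> 1" and "real B \<ge> 1 / \<alpha> - 1"
    and "\<And>n b. n \<ge> 1 \<Longrightarrow> b \<in> {1..B} \<Longrightarrow> uniform_perm_vector M d n (\<psi> n b)"
    and "\<And>n. n \<ge> 1 \<Longrightarrow>
           prob_space.indep_vars M (\<lambda>b. perm_vectors d n) (\<psi> n) {1..B}"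
    and "\<And>n. n \<ge> 1 \<Longrightarrow>
           indep_elements M
             (\<Pi>\<^sub>M i\<in>{1..n}. prod_borel d S) (\<lambda>\<omega>. \<lambda>i\<in>{1..n}. Xs i \<omega>)
             (\<Pi>\<^sub>M b\<in>{1..B}. perm_vectors d n) (\<lambda>\<omega>. \<lambda>b\<in>{1..B}. \<psi> n b \<omega>)"
  shows "(\<lambda>n. measure M {\<omega> \<in> space M.
            perm_p_value d k n B (\<lambda>b. \<psi> n b \<omega>) (\<lambda>i. Xs i \<omega>) \<le> \<alpha>}) \<longlonglongrightarrow> 1"
proof -
  note d = assms(1) and c0 = assms(3) and char = assms(4) and pM = assms(5) and X = assms(6)
    and dep = assms(7) and ind = assms(8) and law = assms(9) and moment = assms(11)
    and \<alpha>0 = assms(12) and B = assms(14,15) and unif = assms(16) and data_perm = assms(18)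
  have "\<exists>b. \<forall>j\<in>{1..d}. \<forall>x\<in>mspace (S j). \<forall>y\<in>mspace (S j). \<bar>k j x y\<bar> \<le> b j"
    using c0_universal_bounded[OF c0] by (intro bchoice) blast
  then obtain b where b: "\<And>j x y. j \<in> {1..d} \<Longrightarrow> x \<in> mspace (S j) \<Longrightarrow> y \<in> mspace (S j) \<Longrightarrow> \<bar>k j x y\<bar> \<le> b j"
    by blast
  \<comment> \<open>One bound for all kernels, and at least 1, as \<open>prod_diff_le\<close> and
    the permutation average require.\<close>
  define \<kappa> where "\<kappa> = 1 + (\<Sum>j=1..d. \<bar>b j\<bar>)"
  have \<kappa>1: "\<kappa> \<ge> 1" by (simp add: \<kappa>_def sum_nonneg)
  have b\<kappa>: "b j \<le> \<kappa>" if "j \<in> {1..d}" for j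
    using member_le_sum[OF that, of "\<lambda>j. \<bar>b j\<bar>"] by (simp add: \<kappa>_def)
  let ?ok = "\<lambda>j K. (\<forall>n::nat. compactin (mtopology_of (S j)) (K n)) \<and>
      (AE x in distr M (metric_borel (S j)) (\<lambda>\<omega>. X \<omega> j). x \<in> (\<Union>n. K n))"
  have "\<exists>K. ?ok j K" if j: "j \<in> {1..d}" for j
  proof (rule marginal_sigma_compact[OF pM X char c0 dep j])
    fix K :: "nat \<Rightarrow> 'a set"
    assume K: "\<And>n. compactin (mtopology_of (S j)) (K n)"
      and XK: "AE x in distr M (metric_borel (S j)) (\<lambda>\<omega>. X \<omega> j). x \<in> (\<Union>n. K n)"
    show ?thesis by (intro exI[of _ K] conjI allI K XK)
  qed
  then have "\<exists>K. \<forall>j\<in>{1..d}. ?ok j (K j)" by (intro bchoice ballI)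
  then obtain K where ok: "\<forall>j\<in>{1..d}. ?ok j (K j)" ..
  have K: "\<And>j n. j \<in> {1..d} \<Longrightarrow> compactin (mtopology_of (S j)) (K j n)"
    and XK: "\<And>j. j \<in> {1..d} \<Longrightarrow> AE x in distr M (metric_borel (S j)) (\<lambda>\<omega>. X \<omega> j). x \<in> (\<Union>n. K j n)"
    using bspec[OF ok] by blast+
  interpret prob_space M by (rule pM)
  interpret dependent_sample M d S X Xs k K \<kappa>
  proof unfold_locales
    show "\<bar>k j x y\<bar> \<le> \<kappa>" if "j \<in> {1..d}" "x \<in> mspace (S j)" "y \<in> mspace (S j)" for j x y
      using b[OF that] b\<kappa>[OF that(1)] by linarith
    show "(\<lambda>\<omega>. \<Prod>j=1..d. k j (Xs (i (2 * j - 1)) \<omega> j) (Xs (i (2 * j)) \<omega> j)) \<in> borel_measurable M"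
      if "n \<ge> 2 * d" "i \<in> index_tuples (2 * d) n" for n i
      using moment[OF that] by (blast intro: borel_measurable_integrable)
  qed (rule d c0 char X dep ind law K XK \<kappa>1; assumption?)+
  define \<delta> where "\<delta> = gram_limit d coord_kernel"
  have \<delta>: "\<delta> > 0" unfolding \<delta>_def by (rule gram_limit_pos)
  obtain c where c: "c \<ge> 0"
    and tail: "\<And>n. n \<ge> 2 * d \<Longrightarrow> prob {\<omega> \<in> space M. stat n (\<lambda>j a. a) \<omega> \<le> \<delta> / 2} \<le> c / sqrt n"
    using original_tail unfolding \<delta>_def by blast
  \<comment> \<open>The constant of \<open>permuted_mean\<close> divided by the Markov level
    \<open>\<delta> / 2\<close>.\<close>
  define c' where "c' = (2 * real d + 2) * \<kappa> ^ (d + 1) / (\<delta> / 2)"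
  define A where "A n = {\<omega> \<in> space M. perm_p_value d k n B (\<lambda>b. \<psi> n b \<omega>) (\<lambda>i. Xs i \<omega>) \<le> \<alpha>}" for n
  have bound: "1 - (c / sqrt n + real B * (c' / real n)) \<le> prob (A n)" if n: "n \<ge> 2 * d" for n
  proof -
    have n1: "n \<ge> 1" using n d by simp
    have orig: "dHSIC d k n (\<lambda>i. Xs i \<omega>) = stat n (\<lambda>j a. a) \<omega>" for \<omega>
      by (simp add: dHSIC_eq_gram_stat stat_def)
    have perm: "dHSIC d k n (permute_data (\<psi> n b \<omega>) (\<lambda>i. Xs i \<omega>)) = stat n (perm_at (\<psi> n b \<omega>)) \<omega>" for b \<omega>
      by (simp add: dHSIC_eq_gram_stat stat_def permute_data_eq)
    \<comment> \<open>Both kinds of exceptional event include the threshold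
      \<open>\<delta> / 2\<close>. Off them the original statistic lies strictly above it and every
      permuted one strictly below, so that ties, which count against rejection, cannot
      occur.\<close>
    define E0 where "E0 = {\<omega> \<in> space M. stat n (\<lambda>j a. a) \<omega> \<le> \<delta> / 2}"
    define E where "E b = {\<omega> \<in> space M. stat n (perm_at (\<psi> n b \<omega>)) \<omega> \<ge> \<delta> / 2}" for b
    have m0: "stat n (\<lambda>j a. a) \<in> borel_measurable M" by (rule stat_measurable[OF n])
    have mean: "integrable M (\<lambda>\<omega>. stat n (perm_at (\<psi> n b \<omega>)) \<omega>)"
        "(\<integral>\<omega>. stat n (perm_at (\<psi> n b \<omega>)) \<omega> \<partial>M) \<le> (2 * real d + 2) * \<kappa> ^ (d + 1) / real n" if b: "b \<in> {1..B}" for b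
      using permuted_mean[OF n unif[OF n1 b] b _ data_perm[OF n1]] b by simp_all
    have mb: "(\<lambda>\<omega>. stat n (perm_at (\<psi> n b \<omega>)) \<omega>) \<in> borel_measurable M" if "b \<in> {1..B}" for b
      using mean(1)[OF that] by (rule borel_measurable_integrable)
    have E0: "E0 \<in> events" unfolding E0_def using m0 by measurable
    have Eb: "E b \<in> events" if "b \<in> {1..B}" for b unfolding E_def using mb[OF that] by measurable
    have prob_Eb: "prob (E b) \<le> c' / real n" if b: "b \<in> {1..B}" for b
    proof -
      have "\<psi> n b \<omega> \<in> perm_tuples d n" if "\<omega> \<in> space M" for \<omega>
        using unif[OF n1 b] measurable_space[OF _ that, of "\<psi> n b" "perm_vectors d n"]
        unfolding uniform_perm_vector_def by (simp add: space_perm_vectors)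
      then have nn: "stat n (perm_at (\<psi> n b \<omega>)) \<omega> \<ge> 0" if "\<omega> \<in> space M" for \<omega>
        using that permutes_in_image[OF perm_at_permutes] by (intro stat_nonneg n1) blast+
      have "prob (E b) \<le> (\<integral>\<omega>. stat n (perm_at (\<psi> n b \<omega>)) \<omega> \<partial>M) / (\<delta> / 2)"
        unfolding E_def using \<delta> nn by (intro integral_Markov_inequality_measure[OF mean(1)[OF b] sets.top]) auto
      also have "\<dots> \<le> ((2 * real d + 2) * \<kappa> ^ (d + 1) / real n) / (\<delta> / 2)"
        using \<delta> by (intro divide_right_mono mean(2)[OF b]) simp
      finally show ?thesis by (simp add: c'_def mult.commute)
    qed
    have mA: "A n \<in> events"
    proof -
      have "(\<lambda>\<omega>. perm_p_value d k n B (\<lambda>b. \<psi> n b \<omega>) (\<lambda>i. Xs i \<omega>)) \<in> borel_measurable M"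
        unfolding perm_p_value_def orig perm
        by (intro borel_measurable_add borel_measurable_times borel_measurable_const borel_measurable_sum measurable_If)
          (use m0 mb in \<open>auto intro: borel_measurable_le\<close>)
      then show ?thesis unfolding A_def by measurable
    qed
    have sub: "space M - (E0 \<union> (\<Union>b\<in>{1..B}. E b)) \<subseteq> A n"
    proof
      fix \<omega> assume \<omega>: "\<omega> \<in> space M - (E0 \<union> (\<Union>b\<in>{1..B}. E b))"
      have "\<not> dHSIC d k n (\<lambda>i. Xs i \<omega>) \<le> dHSIC d k n (permute_data (\<psi> n b \<omega>) (\<lambda>i. Xs i \<omega>))"
        if "b \<in> {1..B}" for b
      proof -
        have \<omega>s: "\<omega> \<in> space M" "\<omega> \<notin> E0" "\<omega> \<notin> E b" using \<omega> that by blast+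
        then have "stat n (\<lambda>j a. a) \<omega> > \<delta> / 2" "stat n (perm_at (\<psi> n b \<omega>)) \<omega> < \<delta> / 2"
          using \<omega>s that unfolding E0_def E_def by (auto simp: not_le)
        then show ?thesis unfolding orig perm by linarith
      qed
      then have "perm_p_value d k n B (\<lambda>b. \<psi> n b \<omega>) (\<lambda>i. Xs i \<omega>) = 1 / (real B + 1)"
        unfolding perm_p_value_def by simp
      also have "\<dots> \<le> \<alpha>"
        using B(2) \<alpha>0 by (simp add: field_simps)
      finally show "\<omega> \<in> A n" using \<omega> unfolding A_def by simp
    qed
    have "prob (E0 \<union> (\<Union>b\<in>{1..B}. E b)) \<le> prob E0 + prob (\<Union>b\<in>{1..B}. E b)"
      using E0 Eb by (intro measure_Un_le) auto
    also have "prob (\<Union>b\<in>{1..B}. E b) \<le> (\<Sum>b\<in>{1..B}. prob (E b))"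
      using Eb by (intro measure_UNION_le) auto
    also have "\<dots> \<le> real B * (c' / real n)"
      using sum_bounded_above[of "{1..B}" "\<lambda>b. prob (E b)" "c' / real n"] prob_Eb by simp
    also have "prob E0 \<le> c / sqrt n" unfolding E0_def by (rule tail[OF n])
    finally have "prob (E0 \<union> (\<Union>b\<in>{1..B}. E b)) \<le> c / sqrt n + real B * (c' / real n)" by simp
    moreover have "prob (space M - (E0 \<union> (\<Union>b\<in>{1..B}. E b))) = 1 - prob (E0 \<union> (\<Union>b\<in>{1..B}. E b))"
      using E0 Eb by (intro prob_compl) auto
    moreover have "prob (space M - (E0 \<union> (\<Union>b\<in>{1..B}. E b))) \<le> prob (A n)"
      by (rule finite_measure_mono[OF sub mA])
    ultimately show ?thesis by linarith
  qed
  have "(\<lambda>n. prob (A n)) \<longlonglongrightarrow> 1"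
  proof (rule tendsto_sandwich)
    show "\<forall>\<^sub>F n in sequentially. 1 - (c / sqrt n + real B * (c' / real n)) \<le> prob (A n)"
      using bound unfolding eventually_sequentially by blast
    show "\<forall>\<^sub>F n in sequentially. prob (A n) \<le> 1" by simp
    have "(\<lambda>n. c / sqrt (real n)) \<longlonglongrightarrow> 0"
      by (rule real_tendsto_divide_at_top[OF tendsto_const filterlim_compose[OF sqrt_at_top filterlim_real_sequentially]])
    moreover have "(\<lambda>n. c' / real n) \<longlonglongrightarrow> 0"
      by (rule real_tendsto_divide_at_top[OF tendsto_const filterlim_real_sequentially])
    ultimately have "(\<lambda>n. 1 - (c / sqrt (real n) + real B * (c' / real n))) \<longlonglongrightarrow> 1 - (0 + real B * 0)"
      by (intro tendsto_intros)
    then show "(\<lambda>n. 1 - (c / sqrt (real n) + real B * (c' / real n))) \<longlonglongrightarrow> 1" by simp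
  qed simp
  then show ?thesis unfolding A_def .
qed

end
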